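(* Let $p>2$ be a prime, and let $G$ and $H$ be finite nonabelian $p$-groups whose Frattini subgroups $\Phi(G)$ and $\Phi(H)$ are cyclic. Then the groups $V(\mathbb{F}_pG)$ and $V(\mathbb{F}_pH)$ are isomorphic if and only if $G$ and $H$ are isomorphic.
   Context: $\mathbb{F}_p$ is the field of $p$ elements. For a finite $p$-group $G$, $\mathbb{F}_pG$ is its group algebra over $\mathbb{F}_p$, and $$V(\mathbb{F}_pG)=\Bigl\{\sum_{g\in G}\alpha_g g\in\mathbb{F}_pG \;\Bigm|\; \sum_{g\in G}\alpha_g=1\Bigr\}$$ is the group of normalized units of $\mathbb{F}_pG$ (a finite group under multiplication, of order $p^{|G|-1}$). *)

theory Defs
  imports "HOL-Algebra.Elementary_Groups" "HOL-Number_Theory.Residues"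
begin

definition p_group :: "nat \<Rightarrow> ('a, 'm) monoid_scheme \<Rightarrow> bool" where
  "p_group p G \<longleftrightarrow> group G \<and> (\<exists>n. order G = p ^ n)"

definition maximal_subgroup :: "'a set \<Rightarrow> ('a, 'm) monoid_scheme \<Rightarrow> bool" where
  "maximal_subgroup M G \<longleftrightarrow>
     subgroup M G \<and> M \<noteq> carrier G \<and>
     (\<forall>K. subgroup K G \<and> M \<subseteq> K \<longrightarrow> K = M \<or> K = carrier G)"

text \<open>The intersection with the carrier only matters if there are no maximal subgroups;
  the Frattini subgroup is then the whole group.\<close>

definition frattini :: "('a, 'm) monoid_scheme \<Rightarrow> 'a set" where
  "frattini G = carrier G \<inter> \<Inter>{M. maximal_subgroup M G}"

text \<open>The group algebra of a finite group \<open>G\<close> over \<open>R\<close>. The element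
  \<open>\<Sum>g. \<alpha>\<^sub>g g\<close> is the coefficient function \<open>g \<mapsto> \<alpha>\<^sub>g\<close>, extensional outside \<open>carrier G\<close>, so
  that equal elements are equal functions. There is no finite-support condition, so the definition is
  only meaningful for finite \<open>G\<close>.\<close>

definition group_algebra ::
  "('r, 'k) ring_scheme \<Rightarrow> ('a, 'm) monoid_scheme \<Rightarrow> ('a \<Rightarrow> 'r) ring" where
  "group_algebra R G =
    \<lparr>carrier = carrier G \<rightarrow>\<^sub>E carrier R,
     monoid.mult = (\<lambda>a b. \<lambda>g\<in>carrier G.
       \<Oplus>\<^bsub>R\<^esub>h\<in>carrier G. a h \<otimes>\<^bsub>R\<^esub> b (inv\<^bsub>G\<^esub> h \<otimes>\<^bsub>G\<^esub> g)),
     monoid.one = (\<lambda>g\<in>carrier G. if g = \<one>\<^bsub>G\<^esub> then \<one>\<^bsub>R\<^esub> else \<zero>\<^bsub>R\<^esub>),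
     ring.zero = (\<lambda>g\<in>carrier G. \<zero>\<^bsub>R\<^esub>),
     ring.add = (\<lambda>a b. \<lambda>g\<in>carrier G. a g \<oplus>\<^bsub>R\<^esub> b g)\<rparr>"

text \<open>When \<open>R\<close> is a field of characteristic \<open>p\<close> and \<open>G\<close> is a finite \<open>p\<close>-group, every element
  whose coefficients sum to one is invertible, so invertibility is not imposed separately.\<close>

definition normalized_units ::
  "('r, 'k) ring_scheme \<Rightarrow> ('a, 'm) monoid_scheme \<Rightarrow> ('a \<Rightarrow> 'r) monoid" where
  "normalized_units R G =
    \<lparr>carrier = {a \<in> carrier (group_algebra R G). (\<Oplus>\<^bsub>R\<^esub>g\<in>carrier G. a g) = \<one>\<^bsub>R\<^esub>},
     monoid.mult = monoid.mult (group_algebra R G),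
     monoid.one = monoid.one (group_algebra R G)\<rparr>"

end

theory Submission
  imports Defs "HOL-Combinatorics.Multiset_Permutations" "HOL-Algebra.Group_Action"
begin

text \<open>Since \<open>p\<close> is odd, a nonabelian \<open>p\<close>-group with cyclic Frattini subgroup has a central
  commutator subgroup \<open>\<langle>c\<rangle>\<close> of order \<open>p\<close>, and \<open>x \<mapsto> x\<^sup>p\<close> is a homomorphism with cyclic image. Peeling off
  hyperbolic pairs and central elements of order \<open>p\<close> shows that such a group is determined by its order,
  its exponent, and the order and the exponent of its centre.

  In the group algebra, \<open>u\<^sup>p\<close> is the sum of the \<open>\<alpha>\<^sub>g g\<^sup>p\<close> plus an excess, a combination of sums of products
  of \<open>p\<close> not all equal group elements over all their arrangements. Modulo \<open>p\<close> such a sum is a sum of iterated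
  commutators, each of which contributes a factor \<open>c - 1\<close>; so the excess is invariant under
  multiplication by \<open>c\<close>, and it vanishes on the centre. This yields the order and the exponent of the centre
  of \<open>V\<close>, and shows that \<open>u\<^sup>q = 1\<close> for all \<open>u\<close> in \<open>V\<close> iff \<open>g\<^sup>q = 1\<close> for all \<open>g\<close> in \<open>G\<close>, for the powers \<open>q\<close> of \<open>p\<close>
  with \<open>q \<ge> p\<^sup>2\<close>. The only remaining ambiguity is between exponent \<open>p\<close> and exponent \<open>p\<^sup>2\<close> with
  elementary abelian centre. There the multiplication of \<open>G\<close> can be twisted by powers of \<open>c\<close> into one of
  exponent \<open>p\<close>; this does not change the excess, so that the twisted group algebra has strictly more units
  with \<open>u\<^sup>p = 1\<close>.\<close>

section \<open>Central extensions by a group of prime order\<close>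

text \<open>Write p^(k+1) for the exponent of the centre of G. The group itself then has exponent
  p^(k+1) or p^(k+2), according to whether or not the p-th powers are generated by the p-th power of
  a central element, so that the two orders and k leave two candidates. For k > 0 the exponent of V
  separates them: one p-th power makes a unit central, and the next one removes whatever the excess
  has left outside the centre of G. For k = 0 only one p-th power is available, and the excess is
  not removed. Counting the solutions of u^p = 1 takes over, but two abstract candidates offer no
  common coordinates for comparing the counts. The twist of the group of exponent p^2 provides them:
  by the classification it is the other candidate, living on the same underlying set, where the two
  solution sets are nested and an element of order p^2 lies in only one of them. The order of the
  centre of G is read off from the number of conjugacy classes, because outside the centre the
  classes are exactly the cosets of <c>.\<close>

definition center :: "('a, 'm) monoid_scheme \<Rightarrow> 'a set" where
  "center G = {z \<in> carrier G. \<forall>x\<in>carrier G. z \<otimes>\<^bsub>G\<^esub> x = x \<otimes>\<^bsub>G\<^esub> z}"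

definition centralizer :: "('a, 'm) monoid_scheme \<Rightarrow> 'a set \<Rightarrow> 'a set" where
  "centralizer G S = {z \<in> carrier G. \<forall>x\<in>S. z \<otimes>\<^bsub>G\<^esub> x = x \<otimes>\<^bsub>G\<^esub> z}"

lemma centerD: "z \<in> center G \<Longrightarrow> z \<in> carrier G"
  "z \<in> center G \<Longrightarrow> x \<in> carrier G \<Longrightarrow> z \<otimes>\<^bsub>G\<^esub> x = x \<otimes>\<^bsub>G\<^esub> z"
  by (auto simp: center_def)

lemma centerI:
  "z \<in> carrier G \<Longrightarrow> (\<And>x. x \<in> carrier G \<Longrightarrow> z \<otimes>\<^bsub>G\<^esub> x = x \<otimes>\<^bsub>G\<^esub> z) \<Longrightarrow> z \<in> center G"
  by (auto simp: center_def)

lemma centralizerD: "z \<in> centralizer G S \<Longrightarrow> z \<in> carrier G"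
  "z \<in> centralizer G S \<Longrightarrow> x \<in> S \<Longrightarrow> z \<otimes>\<^bsub>G\<^esub> x = x \<otimes>\<^bsub>G\<^esub> z"
  by (auto simp: centralizer_def)

lemma centralizerI:
  "z \<in> carrier G \<Longrightarrow> (\<And>x. x \<in> S \<Longrightarrow> z \<otimes>\<^bsub>G\<^esub> x = x \<otimes>\<^bsub>G\<^esub> z) \<Longrightarrow> z \<in> centralizer G S"
  by (auto simp: centralizer_def)

lemma center_in_centralizer: "z \<in> center G \<Longrightarrow> S \<subseteq> carrier G \<Longrightarrow> z \<in> centralizer G S"
  by (rule centralizerI[OF centerD(1)]) (auto intro: centerD(2))

lemma centralizer_carrier: "centralizer G (carrier G) = center G"
  by (simp add: center_def centralizer_def)

context group
begin

lemma cancel_inv_left [simp]: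
  assumes "t \<in> carrier G" "z \<in> carrier G"
  shows "t \<otimes> (inv t \<otimes> z) = z" "inv t \<otimes> (t \<otimes> z) = z"
  using assms by (simp_all flip: m_assoc)

lemma subgroup_centralizer:
  assumes S: "S \<subseteq> carrier G"
  shows "subgroup (centralizer G S) G"
proof
  fix x y assume x: "x \<in> centralizer G S" and y: "y \<in> centralizer G S"
  have "x \<otimes> y \<otimes> z = z \<otimes> (x \<otimes> y)" if z: "z \<in> S" for z
  proof -
    have zG: "z \<in> carrier G"
      using z S by blast
    have "x \<otimes> y \<otimes> z = x \<otimes> (z \<otimes> y)"
      using x y zG centralizerD(2)[OF y z] by (simp add: m_assoc centralizerD(1))
    also have "\<dots> = z \<otimes> x \<otimes> y"
      using x y zG centralizerD(2)[OF x z] by (simp add: centralizerD(1) flip: m_assoc)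
    finally show ?thesis
      using x y zG by (simp add: m_assoc centralizerD(1))
  qed
  then show "x \<otimes> y \<in> centralizer G S"
    using x y by (intro centralizerI) (auto dest: centralizerD(1))
next
  fix x assume x: "x \<in> centralizer G S"
  have "inv x \<otimes> y = y \<otimes> inv x" if y: "y \<in> S" for y
  proof -
    have yG: "y \<in> carrier G"
      using y S by blast
    have "inv x \<otimes> y = inv x \<otimes> (y \<otimes> x) \<otimes> inv x"
      using x yG by (simp add: m_assoc centralizerD(1))
    also have "\<dots> = inv x \<otimes> (x \<otimes> y) \<otimes> inv x"
      using centralizerD(2)[OF x y] by simp
    finally show ?thesis
      using x yG by (simp add: centralizerD(1))
  qed
  then show "inv x \<in> centralizer G S"
    using x by (intro centralizerI) (auto dest: centralizerD(1))
qed (use S in \<open>auto simp: centralizer_def subset_iff\<close>)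

lemma subgroup_center: "subgroup (center G) G"
  using subgroup_centralizer[of "carrier G"] by (simp add: centralizer_carrier)

end

locale finite_group_prime = group G for G :: "('a, 'm) monoid_scheme" (structure) +
  fixes p :: nat
  assumes prime: "Factorial_Ring.prime p" and fin: "finite (carrier G)"

text \<open>Commutators enter only through exponents of \<open>c\<close>: \<open>commute_ex\<close>
  moves two elements past each other at the price of a power of \<open>c\<close>, and later
  identities reduce to computing natural exponents modulo \<open>p\<close>.\<close>

locale central_ext = finite_group_prime G p for G :: "('a, 'm) monoid_scheme" (structure) and p :: nat +
  fixes c :: 'a
  assumes p_gt_2: "p > 2"
    and c_in [simp, intro]: "c \<in> carrier G" and c_ne: "c \<noteq> \<one>" and c_pow_p: "c [^] p = \<one>"
    and c_central: "x \<in> carrier G \<Longrightarrow> c \<otimes> x = x \<otimes> c"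
    and commute_ex: "x \<in> carrier G \<Longrightarrow> y \<in> carrier G \<Longrightarrow> \<exists>i::nat. y \<otimes> x = x \<otimes> y \<otimes> c [^] i"
begin

lemma p_gt_1: "p > 1" and p_pos [simp]: "p > 0"
  using p_gt_2 by auto

lemma c_pow_central: "x \<in> carrier G \<Longrightarrow> c [^] (i::nat) \<otimes> x = x \<otimes> c [^] i"
  by (rule group_commutes_pow) (simp_all add: c_central)

lemma ord_c: "ord c = p"
proof -
  have "ord c dvd p"
    using c_pow_p pow_eq_id by auto
  moreover have "ord c \<noteq> 1"
    using c_ne ord_eq_1 by auto
  ultimately show ?thesis
    using prime prime_nat_iff by blast
qed

lemma c_pow_eq_one_iff: "c [^] (i::nat) = \<one> \<longleftrightarrow> p dvd i"
  using pow_eq_id[of c i] ord_c by auto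

lemma c_pow_eq_iff: "c [^] (i::nat) = c [^] (j::nat) \<longleftrightarrow> i mod p = j mod p"
proof -
  have *: "c [^] i = c [^] j \<longleftrightarrow> i mod p = j mod p" if "i \<le> j" for i j :: nat
  proof -
    have "c [^] j = c [^] i \<otimes> c [^] (j - i)"
      using that by (simp add: nat_pow_mult)
    then have "c [^] i = c [^] j \<longleftrightarrow> c [^] (j - i) = \<one>"
      by (simp only: \<open>c [^] j = c [^] i \<otimes> c [^] (j - i)\<close> l_cancel_one' nat_pow_closed c_in)
    also have "\<dots> \<longleftrightarrow> i mod p = j mod p"
      unfolding c_pow_eq_one_iff using mod_eq_dvd_iff_nat[OF that, of p] by metis
    finally show ?thesis .
  qed
  show ?thesis
    using *[of i j] *[of j i] by (metis nat_le_linear)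
qed

lemma c_pow_mod: "c [^] (i mod p) = c [^] i"
  by (simp add: c_pow_eq_iff)

lemma commute_pow:
  assumes "x \<in> carrier G" "y \<in> carrier G" "y \<otimes> x = x \<otimes> y \<otimes> c [^] (i::nat)"
  shows "y \<otimes> x [^] (n::nat) = x [^] n \<otimes> y \<otimes> c [^] (i * n)"
proof (induction n)
  case (Suc n)
  have "y \<otimes> x [^] Suc n = (y \<otimes> x [^] n) \<otimes> x"
    using assms by (simp add: m_assoc)
  also have "\<dots> = x [^] n \<otimes> y \<otimes> (c [^] (i * n) \<otimes> x)"
    unfolding Suc using assms(1,2) by (simp add: m_assoc)
  also have "\<dots> = x [^] n \<otimes> (y \<otimes> x) \<otimes> c [^] (i * n)"
    unfolding c_pow_central[OF assms(1)] using assms(1,2) by (simp add: m_assoc)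
  also have "\<dots> = x [^] Suc n \<otimes> y \<otimes> (c [^] i \<otimes> c [^] (i * n))"
    unfolding assms(3) using assms(1,2) by (simp add: m_assoc)
  finally show ?case
    by (simp add: nat_pow_mult)
qed (use assms in auto)

lemma pow_p_central:
  assumes "x \<in> carrier G" "y \<in> carrier G"
  shows "y \<otimes> x [^] p = x [^] p \<otimes> y"
proof -
  obtain i :: nat where "y \<otimes> x = x \<otimes> y \<otimes> c [^] i"
    using commute_ex assms by blast
  from commute_pow[OF assms this, of p] show ?thesis
    using assms c_pow_eq_one_iff[of "i * p"] by auto
qed

lemma commute_pow_left:
  assumes "x \<in> carrier G" "y \<in> carrier G" "y \<otimes> x = x \<otimes> y \<otimes> c [^] (i::nat)"
  shows "y [^] (n::nat) \<otimes> x = x \<otimes> y [^] n \<otimes> c [^] (i * n)"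
proof (induction n)
  case (Suc n)
  have "y [^] Suc n \<otimes> x = y [^] n \<otimes> (y \<otimes> x)"
    using assms(1,2) by (simp add: m_assoc)
  also have "\<dots> = (y [^] n \<otimes> x) \<otimes> y \<otimes> c [^] i"
    unfolding assms(3) using assms(1,2) by (simp add: m_assoc)
  also have "\<dots> = x \<otimes> y [^] n \<otimes> (c [^] (i * n) \<otimes> y) \<otimes> c [^] i"
    unfolding Suc using assms(1,2) by (simp add: m_assoc)
  also have "\<dots> = x \<otimes> y [^] Suc n \<otimes> (c [^] (i * n) \<otimes> c [^] i)"
    unfolding c_pow_central[OF assms(2)] using assms(1,2) by (simp add: m_assoc)
  finally show ?case
    by (simp add: nat_pow_mult add.commute)
qed (use assms in auto)

text \<open>Collecting the factors moves every \<open>y\<close> past the later occurrences of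
  \<open>x\<close>, and there are \<open>n * (n - 1) div 2\<close> such pairs.\<close>

lemma mult_pow:
  assumes "x \<in> carrier G" "y \<in> carrier G" "y \<otimes> x = x \<otimes> y \<otimes> c [^] (i::nat)"
  shows "(x \<otimes> y) [^] (n::nat) = x [^] n \<otimes> y [^] n \<otimes> c [^] (i * (n * (n - 1) div 2))"
proof (induction n)
  case (Suc n)
  define k where "k = i * (n * (n - 1) div 2)"
  have xy: "x \<otimes> y \<in> carrier G"
    using assms by simp
  have "(x \<otimes> y) [^] Suc n = x [^] n \<otimes> y [^] n \<otimes> (c [^] k \<otimes> (x \<otimes> y))"
    unfolding nat_pow_Suc Suc k_def using assms(1,2) by (simp add: m_assoc)
  also have "\<dots> = x [^] n \<otimes> (y [^] n \<otimes> x) \<otimes> y \<otimes> c [^] k"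
    unfolding c_pow_central[OF xy] using assms(1,2) by (simp add: m_assoc)
  also have "\<dots> = x [^] n \<otimes> x \<otimes> y [^] n \<otimes> (c [^] (i * n) \<otimes> y) \<otimes> c [^] k"
    unfolding commute_pow_left[OF assms] using assms(1,2) by (simp add: m_assoc)
  also have "\<dots> = x [^] Suc n \<otimes> y [^] Suc n \<otimes> c [^] (i * n + k)"
    unfolding c_pow_central[OF assms(2)] using assms(1,2) by (simp add: m_assoc nat_pow_mult)
  also have "i * n + k = i * (Suc n * (Suc n - 1) div 2)"
  proof -
    have "n + n * (n - 1) div 2 = Suc n * n div 2"
      by (cases n) auto
    then show ?thesis
      unfolding k_def by (simp flip: add_mult_distrib2)
  qed
  finally show ?case .
qed (use assms in auto)

text \<open>The number of pairs collected in a \<open>p\<close>-th power is a multiple of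
  \<open>p\<close> because \<open>p\<close> is odd.\<close>

lemma mult_pow_p:
  assumes "x \<in> carrier G" "y \<in> carrier G"
  shows "(x \<otimes> y) [^] p = x [^] p \<otimes> y [^] p"
proof -
  obtain i :: nat where "y \<otimes> x = x \<otimes> y \<otimes> c [^] i"
    using commute_ex assms by blast
  moreover have "p dvd p * (p - 1) div 2"
  proof -
    have "even (p - 1)"
      using prime p_gt_2 prime_odd_nat by auto
    then obtain k where "p - 1 = 2 * k"
      by blast
    then show ?thesis
      by simp
  qed
  ultimately show ?thesis
    using mult_pow[OF assms, of i p] assms c_pow_eq_one_iff[of "i * (p * (p - 1) div 2)"]
    by (simp del: One_nat_def)
qed

lemma mult_pow_p_mult:
  assumes "x \<in> carrier G" "y \<in> carrier G"
  shows "(x \<otimes> y) [^] (p * k :: nat) = x [^] (p * k) \<otimes> y [^] (p * k)"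
proof -
  have "(x \<otimes> y) [^] (p * k) = (x [^] p \<otimes> y [^] p) [^] k"
    using assms mult_pow_p by (simp flip: nat_pow_pow)
  also have "\<dots> = x [^] (p * k) \<otimes> y [^] (p * k)"
    using assms pow_p_central[of y "x [^] p"] pow_mult_distrib[of "x [^] p" "y [^] p" k]
    by (simp add: nat_pow_pow)
  finally show ?thesis .
qed

lemma pow_p_in_center: "x \<in> carrier G \<Longrightarrow> x [^] p \<in> center G"
  by (intro centerI) (simp_all add: pow_p_central)

lemma c_in_center: "c \<in> center G"
  by (intro centerI) (simp_all add: c_central)

end

section \<open>Sums over arrangements\<close>

definition diff_seq :: "(nat \<Rightarrow> int) \<Rightarrow> nat \<Rightarrow> int" where
  "diff_seq a j = a (Suc j) - a j"

text \<open>Here \<open>a j\<close> will be a coefficient at \<open>g \<otimes> c [^] j\<close>.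
  With E the shift, the condition is (E - 1)^k a = 0 modulo \<open>p\<close>. For a sequence of
  period \<open>p\<close> this amounts to divisibility by (c - 1)^(p - k) in the group algebra of
  <c>, so a smaller \<open>k\<close> means more factors c - 1.\<close>

definition diff_order :: "nat \<Rightarrow> nat \<Rightarrow> (nat \<Rightarrow> int) \<Rightarrow> bool" where
  "diff_order p k a \<longleftrightarrow> (\<forall>j. int p dvd (diff_seq ^^ k) a j)"

lemma diff_seq_funpow_sum:
  "(diff_seq ^^ k) (\<lambda>j. \<Sum>t\<in>A. a t j) = (\<lambda>j. \<Sum>t\<in>A. (diff_seq ^^ k) (a t) j)"
  by (induction k) (auto simp: diff_seq_def sum_subtractf)

lemma diff_seq_funpow_shift: "(diff_seq ^^ k) (\<lambda>j. a (j + i)) = (\<lambda>j. (diff_seq ^^ k) a (j + i))"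
  by (induction k) (auto simp: diff_seq_def)

lemma diff_seq_funpow_diff:
  "(diff_seq ^^ k) (\<lambda>j. a j - b j) = (\<lambda>j. (diff_seq ^^ k) a j - (diff_seq ^^ k) b j)"
  by (induction k) (auto simp: diff_seq_def)

lemma diff_order_sum: "(\<And>t. t \<in> A \<Longrightarrow> diff_order p k (a t)) \<Longrightarrow> diff_order p k (\<lambda>j. \<Sum>t\<in>A. a t j)"
  unfolding diff_order_def diff_seq_funpow_sum by (auto intro: dvd_sum)

text \<open>E^i - 1 is a multiple of E - 1: the difference over \<open>i\<close> steps telescopes
  into single steps, so every such difference uses up one order.\<close>

lemma diff_order_shift_diff:
  assumes "diff_order p (Suc k) a"
  shows "diff_order p k (\<lambda>j. a (j + i) - a j)"
proof -
  have "int p dvd (diff_seq ^^ k) a (j + i) - (diff_seq ^^ k) a j" for j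
  proof (induction i)
    case (Suc i)
    have "int p dvd (diff_seq ^^ k) a (Suc (j + i)) - (diff_seq ^^ k) a (j + i)"
      using assms unfolding diff_order_def by (simp add: diff_seq_def)
    from dvd_add[OF this Suc] show ?case
      by simp
  qed auto
  then show ?thesis
    unfolding diff_order_def diff_seq_funpow_diff diff_seq_funpow_shift by simp
qed

lemma diff_seq_funpow_eq:
  "(diff_seq ^^ k) a j = (\<Sum>i\<le>k. (-1) ^ (k + i) * int (k choose i) * a (j + i))"
proof (induction k arbitrary: j)
  case (Suc k)
  define f where "f = (\<lambda>i. (-1) ^ (k + i) * int (k choose i) * a (Suc j + i))"
  define g where "g = (\<lambda>i. (-1) ^ (k + i) * int (k choose i) * a (j + i))"
  have "(diff_seq ^^ Suc k) a j = (\<Sum>i\<le>k. f i) - (\<Sum>i\<le>k. g i)"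
    by (simp add: diff_seq_def Suc f_def g_def)
  also have "(\<Sum>i\<le>k. g i) = g 0 + (\<Sum>i\<le>k. g (Suc i))"
  proof -
    have "(\<Sum>i\<le>k. g i) = (\<Sum>i\<le>Suc k. g i)"
      by (simp add: g_def)
    then show ?thesis
      by (simp only: sum.atMost_Suc_shift)
  qed
  also have "(\<Sum>i\<le>k. f i) - (g 0 + (\<Sum>i\<le>k. g (Suc i))) = - g 0 + (\<Sum>i\<le>k. f i - g (Suc i))"
    by (simp add: sum_subtractf)
  also have "\<dots> = (\<Sum>i\<le>Suc k. (-1) ^ (Suc k + i) * int (Suc k choose i) * a (j + i))"
    unfolding sum.atMost_Suc_shift by (simp add: f_def g_def algebra_simps)
  finally show ?case .
qed simp

text \<open>Modulo an odd prime (E - 1)^p = E^p - 1, and E^p is the identity on sequences of period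
  \<open>p\<close>. This is the counterpart of (c - 1)^p = 0.\<close>

lemma diff_order_periodic:
  assumes "Factorial_Ring.prime p" "odd p" "\<And>j. a (j + p) = a j"
  shows "diff_order p p a"
  unfolding diff_order_def
proof
  fix j
  define F where "F = (\<lambda>i. (-1) ^ (p + i) * int (p choose i) * a (j + i))"
  have p: "p > 0"
    using assms(1) prime_gt_0_nat by blast
  have "(diff_seq ^^ p) a j = sum F {..p}"
    unfolding diff_seq_funpow_eq F_def ..
  also have "{..p} = insert 0 (insert p {0<..<p})"
    using p by auto
  also have "sum F \<dots> = F 0 + F p + sum F {0<..<p}"
    using p by simp
  \<comment> \<open>The two outer terms have opposite signs since \<open>p\<close> is odd, and equal
    values by periodicity.\<close>
  also have "F 0 + F p = 0"
    using assms(2,3) by (simp add: F_def)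
  also have "int p dvd 0 + sum F {0<..<p}"
  proof -
    have "int p dvd F i" if "i \<in> {0<..<p}" for i
    proof -
      have "p dvd p choose i"
        using that assms(1) by (intro dvd_choose_prime) auto
      then show ?thesis
        unfolding F_def by (intro dvd_mult2 dvd_mult) simp
    qed
    then show ?thesis
      by (auto intro: dvd_sum)
  qed
  finally show "int p dvd (diff_seq ^^ p) a j" .
qed

section \<open>Sums over the arrangements of a multiset\<close>

lemma sum_permutations_Cons:
  assumes "M \<noteq> {#}"
  shows "(\<Sum>xs\<in>permutations_of_multiset M. f xs)
    = (\<Sum>t\<in>set_mset M. \<Sum>xs\<in>permutations_of_multiset (M - {#t#}). f (t # xs))"
proof -
  have "(\<Sum>xs\<in>permutations_of_multiset M. f xs)
    = (\<Sum>t\<in>set_mset M. sum f ((#) t ` permutations_of_multiset (M - {#t#})))"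
    unfolding permutations_of_multiset_nonempty[OF assms]
    by (rule sum.UNION_disjoint) auto
  then show ?thesis
    by (simp add: sum.reindex)
qed

lemma sum_permutations_snoc:
  assumes "M \<noteq> {#}"
  shows "(\<Sum>xs\<in>permutations_of_multiset M. f xs)
    = (\<Sum>t\<in>set_mset M. \<Sum>xs\<in>permutations_of_multiset (M - {#t#}). f (xs @ [t]))"
proof -
  have rev: "(\<Sum>xs\<in>permutations_of_multiset M. g (rev xs)) = (\<Sum>xs\<in>permutations_of_multiset M. g xs)"
    for g and M :: "'a multiset"
    by (rule sum.reindex_bij_witness[of _ rev rev]) (auto simp: permutations_of_multiset_def)
  have "(\<Sum>xs\<in>permutations_of_multiset M. f xs) = (\<Sum>xs\<in>permutations_of_multiset M. f (rev xs))"
    by (rule rev[symmetric])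
  also have "\<dots> = (\<Sum>t\<in>set_mset M. \<Sum>xs\<in>permutations_of_multiset (M - {#t#}). f (rev xs @ [t]))"
    by (simp add: sum_permutations_Cons[OF assms])
  also have "\<dots> = (\<Sum>t\<in>set_mset M. \<Sum>xs\<in>permutations_of_multiset (M - {#t#}). f (xs @ [t]))"
    by (intro sum.cong refl rev)
  finally show ?thesis .
qed

text \<open>Double counting of the pairs of an arrangement of \<open>add_mset x M\<close> and a
  position that holds \<open>x\<close>. Each arrangement has \<open>Suc (count M x)\<close> such
  positions, and deleting the entry there leaves an arrangement of \<open>M\<close>.\<close>

lemma sum_permutations_insert:
  fixes f :: "'b list \<Rightarrow> int"
  shows "int (Suc (count M x)) * (\<Sum>ys\<in>permutations_of_multiset (add_mset x M). f ys)
    = (\<Sum>j\<le>size M. \<Sum>xs\<in>permutations_of_multiset M. f (take j xs @ x # drop j xs))"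
proof -
  let ?P = "permutations_of_multiset (add_mset x M)"
  define I where "I = (\<lambda>ys. {j. j < length ys \<and> ys ! j = x})"
  have I: "card (I ys) = Suc (count M x)" if "ys \<in> ?P" for ys
  proof -
    have "I ys = {j. j < length ys \<and> x = ys ! j}"
      by (auto simp: I_def)
    then have "card (I ys) = count (mset ys) x"
      by (simp add: count_mset count_list_eq_length_filter length_filter_conv_card)
    then show ?thesis
      using that by (simp add: permutations_of_multiset_def)
  qed
  have "int (Suc (count M x)) * sum f ?P = (\<Sum>ys\<in>?P. \<Sum>j\<in>I ys. f ys)"
    by (simp add: I sum_distrib_left)
  also have "\<dots> = (\<Sum>(ys, j)\<in>Sigma ?P I. f ys)"
    by (rule sum.Sigma) (auto simp: I_def)
  also have "\<dots> = (\<Sum>(j, xs)\<in>{..size M} \<times> permutations_of_multiset M. f (take j xs @ x # drop j xs))"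
  proof (rule sum.reindex_bij_witness[of _
        "\<lambda>(j, xs). (take j xs @ x # drop j xs, j)" "\<lambda>(ys, j). (j, take j ys @ drop (Suc j) ys)"])
    fix a assume a: "a \<in> Sigma ?P I"
    obtain ys j where [simp]: "a = (ys, j)"
      by (cases a)
    from a have ys: "mset ys = add_mset x M" and j: "j < length ys" "ys ! j = x"
      by (auto simp: permutations_of_multiset_def I_def)
    have eq: "take j ys @ x # drop (Suc j) ys = ys"
      using j id_take_nth_drop by metis
    have len: "length ys = Suc (size M)"
      using ys by (metis size_add_mset size_mset)
    show "(case case a of (ys, j) \<Rightarrow> (j, take j ys @ drop (Suc j) ys) of
            (j, xs) \<Rightarrow> (take j xs @ x # drop j xs, j)) = a"
      using j eq by simp
    have "add_mset x (mset (take j ys @ drop (Suc j) ys)) = mset (take j ys @ x # drop (Suc j) ys)"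
      by simp
    also have "\<dots> = add_mset x M"
      unfolding eq ys ..
    finally show "(case a of (ys, j) \<Rightarrow> (j, take j ys @ drop (Suc j) ys))
        \<in> {..size M} \<times> permutations_of_multiset M"
      using len j by (simp add: permutations_of_multiset_def)
    show "(case case a of (ys, j) \<Rightarrow> (j, take j ys @ drop (Suc j) ys) of
            (j, xs) \<Rightarrow> f (take j xs @ x # drop j xs)) = (case a of (ys, j) \<Rightarrow> f ys)"
      using j eq by simp
  next
    fix b assume b: "b \<in> {..size M} \<times> permutations_of_multiset M"
    obtain j xs where [simp]: "b = (j, xs)"
      by (cases b)
    from b have xs: "mset xs = M" and j: "j \<le> length xs"
      by (auto simp: permutations_of_multiset_def)
    show "(case case b of (j, xs) \<Rightarrow> (take j xs @ x # drop j xs, j) of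
            (ys, j) \<Rightarrow> (j, take j ys @ drop (Suc j) ys)) = b"
      using j by simp
    have "mset (take j xs) + mset (drop j xs) = mset xs"
      by (metis append_take_drop_id mset_append)
    then show "(case b of (j, xs) \<Rightarrow> (take j xs @ x # drop j xs, j)) \<in> Sigma ?P I"
      using j xs by (auto simp: permutations_of_multiset_def I_def nth_append)
  qed
  also have "\<dots> = (\<Sum>j\<le>size M. \<Sum>xs\<in>permutations_of_multiset M. f (take j xs @ x # drop j xs))"
    by (rule sum.Sigma[symmetric]) auto
  finally show ?thesis .
qed

text \<open>Pascal's rule together with p | C(p, j + 1) makes C(p - 1, j) alternate between 1 and -1
  modulo \<open>p\<close>. It serves to turn a plain sum over the \<open>p\<close> positions of one
  letter into an alternating binomial sum, which is an iterated commutator.\<close>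

lemma prime_dvd_alternating_choose:
  assumes "Factorial_Ring.prime p" "j < p"
  shows "int p dvd (-1) ^ j * int ((p - 1) choose j) - 1"
  using assms(2)
proof (induction j)
  case (Suc j)
  have "p choose Suc j = ((p - 1) choose j) + ((p - 1) choose Suc j)"
    using Suc.prems by (cases p) auto
  moreover have "p dvd p choose Suc j"
    using assms(1) Suc.prems by (intro dvd_choose_prime) auto
  ultimately have "int p dvd int ((p - 1) choose j) + int ((p - 1) choose Suc j)"
    by (metis int_dvd_int_iff of_nat_add)
  then have "int p dvd (-1) ^ j * (int ((p - 1) choose j) + int ((p - 1) choose Suc j))"
    by (rule dvd_mult)
  moreover have "int p dvd (-1) ^ j * int ((p - 1) choose j) - 1"
    using Suc by simp
  ultimately have "int p dvd ((-1) ^ j * int ((p - 1) choose j) - 1)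
      - (-1) ^ j * (int ((p - 1) choose j) + int ((p - 1) choose Suc j))"
    by (rule dvd_diff[rotated])
  also have "\<dots> = (-1) ^ Suc j * int ((p - 1) choose Suc j) - 1"
    by (simp add: distrib_left)
  finally show ?case .
qed simp

section \<open>Arrangements and iterated commutators in the group ring\<close>

definition list_prod :: "('a, 'm) monoid_scheme \<Rightarrow> 'a list \<Rightarrow> 'a" where
  "list_prod G xs = foldr (monoid.mult G) xs \<one>\<^bsub>G\<^esub>"

lemma list_prod_Nil [simp]: "list_prod G [] = \<one>\<^bsub>G\<^esub>"
  and list_prod_Cons [simp]: "list_prod G (x # xs) = x \<otimes>\<^bsub>G\<^esub> list_prod G xs"
  by (simp_all add: list_prod_def)

lemma (in monoid) list_prod_closed [simp, intro]:
  "set xs \<subseteq> carrier G \<Longrightarrow> list_prod G xs \<in> carrier G"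
  by (induction xs) auto

lemma (in monoid) list_prod_snoc:
  "set xs \<subseteq> carrier G \<Longrightarrow> x \<in> carrier G \<Longrightarrow> list_prod G (xs @ [x]) = list_prod G xs \<otimes> x"
  by (induction xs) (auto simp: m_assoc)

definition arrangements :: "('a, 'm) monoid_scheme \<Rightarrow> 'a multiset \<Rightarrow> 'a \<Rightarrow> int" where
  "arrangements G M g = (\<Sum>xs\<in>permutations_of_multiset M. of_bool (list_prod G xs = g))"

definition arrangements_ins :: "('a, 'm) monoid_scheme \<Rightarrow> 'a multiset \<Rightarrow> 'a \<Rightarrow> nat \<Rightarrow> 'a \<Rightarrow> int" where
  "arrangements_ins G M x j g =
    (\<Sum>xs\<in>permutations_of_multiset M. of_bool (list_prod G (take j xs @ x # drop j xs) = g))"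

text \<open>The coefficient of \<open>g\<close> in the sum of the iterated commutators [...[[x, y1],
  y2], ..., yn], with [a, b] = ab - ba, over the arrangements y1, ..., yn of \<open>M\<close>.
  Expanding such a commutator puts \<open>j\<close> of the letters to the left of \<open>x\<close>
  with the sign (-1)^j, and C(n, j) counts the choices that lead to the same word.\<close>

definition arrangements_bracket :: "('a, 'm) monoid_scheme \<Rightarrow> 'a multiset \<Rightarrow> 'a \<Rightarrow> 'a \<Rightarrow> int" where
  "arrangements_bracket G M x g =
    (\<Sum>j\<le>size M. (-1) ^ j * int (size M choose j) * arrangements_ins G M x j g)"

lemma arrangements_insert:
  "int (Suc (count M x)) * arrangements G (add_mset x M) g = (\<Sum>j\<le>size M. arrangements_ins G M x j g)"
  unfolding arrangements_def arrangements_ins_def by (rule sum_permutations_insert)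

text \<open>Pascal's rule and a shift of the index take one difference off, which will be the
  outermost commutator.\<close>

lemma alternating_binomial_Suc:
  fixes f :: "nat \<Rightarrow> int"
  shows "(\<Sum>j\<le>Suc n. (-1) ^ j * int (Suc n choose j) * f j)
    = (\<Sum>j\<le>n. (-1) ^ j * int (n choose j) * (f j - f (Suc j)))"
proof -
  have "(\<Sum>j\<le>Suc n. (-1) ^ j * int (Suc n choose j) * f j)
    = f 0 + (\<Sum>j\<le>n. (-1) ^ Suc j * int (n choose Suc j) * f (Suc j))
      - (\<Sum>j\<le>n. (-1) ^ j * int (n choose j) * f (Suc j))"
    unfolding sum.atMost_Suc_shift
    by (simp add: algebra_simps sum.distrib sum_negf sum_subtractf)
  also have "f 0 + (\<Sum>j\<le>n. (-1) ^ Suc j * int (n choose Suc j) * f (Suc j))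
    = (\<Sum>j\<le>Suc n. (-1) ^ j * int (n choose j) * f j)"
    unfolding sum.atMost_Suc_shift by simp
  also have "\<dots> = (\<Sum>j\<le>n. (-1) ^ j * int (n choose j) * f j)"
    by simp
  finally show ?thesis
    by (simp add: sum_subtractf right_diff_distrib)
qed

context group
begin

lemma arrangements_ins_Suc:
  assumes "set_mset M \<subseteq> carrier G" "x \<in> carrier G" "g \<in> carrier G" "M \<noteq> {#}"
  shows "arrangements_ins G M x (Suc j) g
    = (\<Sum>t\<in>set_mset M. arrangements_ins G (M - {#t#}) x j (inv t \<otimes> g))"
  unfolding arrangements_ins_def sum_permutations_Cons[OF assms(4)]
proof (intro sum.cong refl)
  fix t xs assume t: "t \<in> set_mset M" and "xs \<in> permutations_of_multiset (M - {#t#})"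
  then have "set_mset (mset xs) \<subseteq> set_mset M"
    by (auto simp: permutations_of_multiset_def dest: in_diffD)
  then have xs: "set xs \<subseteq> carrier G" and t: "t \<in> carrier G"
    using assms t by auto
  then have "set (take j xs @ x # drop j xs) \<subseteq> carrier G"
    using assms by (auto dest: in_set_takeD in_set_dropD)
  then have "list_prod G (take j xs @ x # drop j xs) \<in> carrier G"
    by blast
  then show "of_bool (list_prod G (take (Suc j) (t # xs) @ x # drop (Suc j) (t # xs)) = g) =
      (of_bool (list_prod G (take j xs @ x # drop j xs) = inv t \<otimes> g) :: int)"
    using t assms inv_solve_left[of _ t g] by (auto simp: of_bool_def)
qed

lemma arrangements_ins_snoc:
  assumes "set_mset M \<subseteq> carrier G" "x \<in> carrier G" "g \<in> carrier G" "j < size M"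
  shows "arrangements_ins G M x j g
    = (\<Sum>t\<in>set_mset M. arrangements_ins G (M - {#t#}) x j (g \<otimes> inv t))"
proof -
  have "M \<noteq> {#}"
    using assms by auto
  show ?thesis
    unfolding arrangements_ins_def sum_permutations_snoc[OF \<open>M \<noteq> {#}\<close>]
  proof (intro sum.cong refl)
    fix t xs assume t: "t \<in> set_mset M" and xs: "xs \<in> permutations_of_multiset (M - {#t#})"
    then have "set_mset (mset xs) \<subseteq> set_mset M"
      by (auto simp: permutations_of_multiset_def dest: in_diffD)
    then have xs': "set xs \<subseteq> carrier G" and t': "t \<in> carrier G"
      using assms t by auto
    have "length xs = size M - 1"
      using xs t by (metis length_finite_permutations_of_multiset size_Diff_singleton)
    then have j: "j \<le> length xs"
      using assms by auto
    have ys: "set (take j xs @ x # drop j xs) \<subseteq> carrier G"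
      using assms xs' by (auto dest: in_set_takeD in_set_dropD)
    then have *: "list_prod G (take j xs @ x # drop j xs) \<in> carrier G"
      by blast
    have "list_prod G (take j (xs @ [t]) @ x # drop j (xs @ [t]))
        = list_prod G ((take j xs @ x # drop j xs) @ [t])"
      using j by simp
    also have "\<dots> = list_prod G (take j xs @ x # drop j xs) \<otimes> t"
      using ys t' by (rule list_prod_snoc)
    finally show "of_bool (list_prod G (take j (xs @ [t]) @ x # drop j (xs @ [t])) = g) =
        (of_bool (list_prod G (take j xs @ x # drop j xs) = g \<otimes> inv t) :: int)"
      using t' assms inv_solve_right[of "list_prod G (take j xs @ x # drop j xs)" g t] *
      by (auto simp: of_bool_def)
  qed
qed

text \<open>The iterated commutators are sorted by their outermost letter \<open>t\<close>. If
  \<open>x\<close> has a position below \<open>size M\<close>, a letter can be split off at the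
  right end; if its position is a successor, one can be split off at the left end. These are the two
  terms of [B, t].\<close>

lemma arrangements_bracket_rec:
  assumes "set_mset M \<subseteq> carrier G" "x \<in> carrier G" "g \<in> carrier G" "M \<noteq> {#}"
  shows "arrangements_bracket G M x g
    = (\<Sum>t\<in>set_mset M. arrangements_bracket G (M - {#t#}) x (g \<otimes> inv t)
        - arrangements_bracket G (M - {#t#}) x (inv t \<otimes> g))"
proof -
  obtain n where n: "size M = Suc n"
    using assms(4) by (cases M) auto
  let ?A = "\<lambda>t. arrangements_ins G (M - {#t#}) x"
  have "arrangements_bracket G M x g = (\<Sum>j\<le>n. (-1) ^ j * int (n choose j) *
      (arrangements_ins G M x j g - arrangements_ins G M x (Suc j) g))"
    unfolding arrangements_bracket_def n by (rule alternating_binomial_Suc)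
  also have "\<dots> = (\<Sum>j\<le>n. \<Sum>t\<in>set_mset M. (-1) ^ j * int (n choose j) *
      (?A t j (g \<otimes> inv t) - ?A t j (inv t \<otimes> g)))"
    using arrangements_ins_Suc[OF assms] arrangements_ins_snoc[OF assms(1,2,3)] n
    by (intro sum.cong refl) (simp flip: sum_subtractf sum_distrib_left)
  also have "\<dots> = (\<Sum>t\<in>set_mset M. \<Sum>j\<le>n. (-1) ^ j * int (n choose j) *
      (?A t j (g \<otimes> inv t) - ?A t j (inv t \<otimes> g)))"
    by (rule sum.swap)
  also have "\<dots> = (\<Sum>t\<in>set_mset M. arrangements_bracket G (M - {#t#}) x (g \<otimes> inv t)
        - arrangements_bracket G (M - {#t#}) x (inv t \<otimes> g))"
    unfolding arrangements_bracket_def using n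
    by (intro sum.cong refl)
      (simp add: size_Diff_singleton right_diff_distrib sum_subtractf)
  finally show ?thesis .
qed

end

context central_ext
begin

lemma odd_p: "odd p"
  using prime p_gt_2 prime_odd_nat by auto

lemma conj_eq_mult_c_pow:
  assumes "g \<in> carrier G" "t \<in> carrier G"
  shows "\<exists>i::nat. t \<otimes> g \<otimes> inv t = g \<otimes> c [^] i"
proof -
  obtain i :: nat where i: "t \<otimes> g = g \<otimes> t \<otimes> c [^] i"
    using commute_ex assms by blast
  have "t \<otimes> g \<otimes> inv t = g \<otimes> t \<otimes> (c [^] i \<otimes> inv t)"
    unfolding i using assms by (simp add: m_assoc)
  also have "\<dots> = g \<otimes> (t \<otimes> inv t) \<otimes> c [^] i"
    using assms by (subst c_pow_central) (simp_all add: m_assoc)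
  finally show ?thesis
    using assms by auto
qed

text \<open>A commutator with \<open>t\<close> is a difference of two shifts along a coset of <c>,
  because conjugation by \<open>t\<close> multiplies by a power of \<open>c\<close>. So each letter
  of \<open>M\<close> lowers the order by one, starting from order \<open>p\<close> for the empty
  multiset, where only the period of \<open>c\<close> is available.\<close>

lemma arrangements_bracket_diff_order:
  assumes "set_mset M \<subseteq> carrier G" "x \<in> carrier G" "g \<in> carrier G" "size M \<le> p"
  shows "diff_order p (p - size M) (\<lambda>j. arrangements_bracket G M x (g \<otimes> c [^] j))"
  using assms
proof (induction "size M" arbitrary: M g)
  case 0
  have "c [^] (j + p) = c [^] j" for j :: nat
    by (simp add: c_pow_eq_iff)
  then show ?case
    using 0 prime odd_p by (simp add: diff_order_periodic)
next
  case (Suc n)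
  then have M: "M \<noteq> {#}"
    by auto
  let ?B = "\<lambda>t. arrangements_bracket G (M - {#t#}) x"
  have "diff_order p (p - size M) (\<lambda>j. ?B t (g \<otimes> c [^] j \<otimes> inv t) - ?B t (inv t \<otimes> (g \<otimes> c [^] j)))"
    if t: "t \<in># M" for t
  proof -
    have tc: "t \<in> carrier G"
      using Suc t by auto
    \<comment> \<open>Both terms of the commutator are read on the coset of \<open>h\<close>, one of
      them shifted by \<open>i\<close>.\<close>
    define h where "h = inv t \<otimes> g"
    have h: "h \<in> carrier G"
      using Suc tc by (simp add: h_def)
    obtain i :: nat where i: "t \<otimes> h \<otimes> inv t = h \<otimes> c [^] i"
      using conj_eq_mult_c_pow[OF h tc] by blast
    have 1: "g \<otimes> c [^] j \<otimes> inv t = h \<otimes> c [^] (j + i)" for j :: nat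
    proof -
      have "g \<otimes> c [^] j \<otimes> inv t = t \<otimes> h \<otimes> (c [^] j \<otimes> inv t)"
        using Suc tc by (simp add: h_def m_assoc)
      also have "\<dots> = (t \<otimes> h \<otimes> inv t) \<otimes> c [^] j"
        using h tc by (subst c_pow_central) (simp_all add: m_assoc)
      also have "\<dots> = h \<otimes> c [^] (j + i)"
        unfolding i using h by (simp add: m_assoc nat_pow_mult add.commute)
      finally show ?thesis .
    qed
    have 2: "inv t \<otimes> (g \<otimes> c [^] j) = h \<otimes> c [^] j" for j :: nat
      using Suc tc by (simp add: h_def m_assoc)
    have sz: "size (M - {#t#}) = n" "set_mset (M - {#t#}) \<subseteq> carrier G"
      using Suc t by (auto simp: size_Diff_singleton dest: in_diffD)
    then have "diff_order p (p - n) (\<lambda>j. ?B t (h \<otimes> c [^] j))"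
      using Suc.hyps(1)[of "M - {#t#}" h] Suc.prems h \<open>Suc n = size M\<close> by simp
    moreover have "p - n = Suc (p - size M)"
      using Suc by simp
    ultimately have "diff_order p (p - size M) (\<lambda>j. ?B t (h \<otimes> c [^] (j + i)) - ?B t (h \<otimes> c [^] j))"
      using diff_order_shift_diff[of p "p - size M" "\<lambda>j. ?B t (h \<otimes> c [^] j)" i] by simp
    then show ?thesis
      unfolding 1 2 .
  qed
  then have "diff_order p (p - size M) (\<lambda>j. \<Sum>t\<in>set_mset M.
      ?B t (g \<otimes> c [^] j \<otimes> inv t) - ?B t (inv t \<otimes> (g \<otimes> c [^] j)))"
    by (rule diff_order_sum)
  then show ?case
    using Suc.prems M by (simp add: arrangements_bracket_rec)
qed

text \<open>For p - 1 letters the signed binomial coefficients are all 1 modulo \<open>p\<close>, so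
  the bracket becomes the sum over all insertions of \<open>x\<close>.\<close>

lemma arrangements_cong_bracket:
  assumes "size M = p - 1"
  shows "int p dvd int (Suc (count M x)) * arrangements G (add_mset x M) g - arrangements_bracket G M x g"
proof -
  have "int p dvd (\<Sum>j\<le>size M. ((-1) ^ j * int (size M choose j) - 1) * arrangements_ins G M x j g)"
    unfolding assms using prime p_gt_2
    by (intro dvd_sum dvd_mult2 prime_dvd_alternating_choose) auto
  also have "\<dots> = arrangements_bracket G M x g - int (Suc (count M x)) * arrangements G (add_mset x M) g"
    unfolding arrangements_insert arrangements_bracket_def by (simp add: sum_subtractf left_diff_distrib)
  finally show ?thesis
    by (simp add: dvd_diff_commute)
qed

text \<open>Modulo \<open>p\<close>, summing a product of \<open>p\<close> elements over all arrangements is the same as summing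
  iterated commutators in the group algebra; each commutator contributes a factor \<open>c - 1\<close>.\<close>

lemma arrangements_mult_c:
  assumes M: "set_mset M \<subseteq> carrier G" "size M = p" "x \<in># M" "count M x < p"
    and g: "g \<in> carrier G"
  shows "int p dvd arrangements G M (g \<otimes> c) - arrangements G M g"
    and "(\<And>t. t \<in> carrier G \<Longrightarrow> t \<otimes> g = g \<otimes> t) \<Longrightarrow> int p dvd arrangements G M g"
proof -
  obtain M' where M': "M = add_mset x M'"
    using M(3) by (metis multi_member_split)
  have sz: "size M' = p - 1" "set_mset M' \<subseteq> carrier G" "x \<in> carrier G"
    using M by (auto simp: M')
  \<comment> \<open>The multiplicity of \<open>x\<close> in \<open>M\<close> lies strictly between 0
    and \<open>p\<close>, hence can be cancelled modulo \<open>p\<close>. This is where multisets of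
    \<open>p\<close> equal letters are excluded.\<close>
  have k: "coprime (int p) (int (Suc (count M' x)))"
  proof -
    have "\<not> p dvd Suc (count M' x)"
      using M(4) by (auto simp: M' dest: dvd_imp_le)
    then show ?thesis
      using prime prime_imp_coprime_nat coprime_int_iff by blast
  qed
  let ?k = "int (Suc (count M' x))"
  note * = arrangements_cong_bracket[OF sz(1), of x]
  \<comment> \<open>After p - 1 commutators a single difference annihilates the coefficients, and
    that is invariance under \<open>c\<close>.\<close>
  have "p - size M' = 1"
    using sz p_pos by linarith
  with arrangements_bracket_diff_order[OF sz(2,3) g]
  have "diff_order p 1 (\<lambda>j. arrangements_bracket G M' x (g \<otimes> c [^] j))"
    using sz by simp
  then have "int p dvd diff_seq (\<lambda>j. arrangements_bracket G M' x (g \<otimes> c [^] j)) 0"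
    by (simp add: diff_order_def)
  then have "int p dvd arrangements_bracket G M' x (g \<otimes> c) - arrangements_bracket G M' x g"
    using g by (simp add: diff_seq_def)
  from dvd_add[OF dvd_diff[OF *[of "g \<otimes> c"] *[of g]] this]
  have "int p dvd ?k * (arrangements G M (g \<otimes> c) - arrangements G M g)"
    unfolding M' by (simp add: algebra_simps)
  then show "int p dvd arrangements G M (g \<otimes> c) - arrangements G M g"
    using k coprime_dvd_mult_right_iff by blast
  assume cen: "\<And>t. t \<in> carrier G \<Longrightarrow> t \<otimes> g = g \<otimes> t"
  have "M' \<noteq> {#}"
    using sz p_gt_2 by auto
  \<comment> \<open>If \<open>g\<close> commutes with the outermost letter \<open>t\<close>, then
    \<open>g \<otimes> inv t\<close> and \<open>inv t \<otimes> g\<close> coincide and the two terms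
    of the commutator cancel.\<close>
  have "arrangements_bracket G M' x g = 0"
    unfolding arrangements_bracket_rec[OF sz(2,3) g \<open>M' \<noteq> {#}\<close>] using cen sz(2)
    by (intro sum.neutral) (auto simp: subset_iff)
  then have "int p dvd ?k * arrangements G M g"
    using *[of g] unfolding M' by simp
  then show "int p dvd arrangements G M g"
    using k coprime_dvd_mult_right_iff by blast
qed

end

section \<open>The group of normalized units\<close>

abbreviation unit_group :: "nat \<Rightarrow> ('a, 'm) monoid_scheme \<Rightarrow> ('a \<Rightarrow> int) monoid" where
  "unit_group p G \<equiv> normalized_units (residue_ring (int p)) G"

lemma finsum_residue_ring:
  assumes "p > 1" "finite A" "\<And>x. x \<in> A \<Longrightarrow> f x \<in> {0..int p - 1}"
  shows "finsum (residue_ring (int p)) f A = sum f A mod int p"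
proof -
  interpret R: residues "int p" "residue_ring (int p)"
    using assms by unfold_locales auto
  interpret C: cring "residue_ring (int p)"
    by (rule R.cring)
  show ?thesis
    using assms(2,3)
  proof (induction A rule: finite_induct)
    case empty
    show ?case
      by (simp add: R.res_zero_eq)
  next
    case (insert x A)
    then have "f \<in> A \<rightarrow> carrier (residue_ring (int p))" "f x \<in> carrier (residue_ring (int p))"
      by (auto simp: residue_ring_def)
    then have "finsum (residue_ring (int p)) f (insert x A) = f x \<oplus>\<^bsub>residue_ring (int p)\<^esub> (sum f A mod int p)"
      using insert by simp
    then show ?case
      using insert by (simp add: R.res_add_eq mod_add_right_eq)
  qed
qed

lemma residue_ring_zero_one: "\<zero>\<^bsub>residue_ring m\<^esub> = 0" "\<one>\<^bsub>residue_ring m\<^esub> = 1"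
  by (simp_all add: residue_ring_def)

section \<open>Convolution of integer coefficient functions\<close>

definition conv :: "('a, 'm) monoid_scheme \<Rightarrow> ('a \<Rightarrow> int) \<Rightarrow> ('a \<Rightarrow> int) \<Rightarrow> 'a \<Rightarrow> int" where
  "conv G u v g = (\<Sum>h\<in>carrier G. u h * v (inv\<^bsub>G\<^esub> h \<otimes>\<^bsub>G\<^esub> g))"

text \<open>Convolutions are computed over the integers and compared modulo \<open>p\<close>; only
  this map returns to the representatives from 0 to p - 1 that the carrier of the unit group
  consists of.\<close>

definition reduce :: "nat \<Rightarrow> ('a, 'm) monoid_scheme \<Rightarrow> ('a \<Rightarrow> int) \<Rightarrow> 'a \<Rightarrow> int" where
  "reduce p G u = (\<lambda>g\<in>carrier G. u g mod int p)"

definition point :: "('a, 'm) monoid_scheme \<Rightarrow> 'a \<Rightarrow> 'a \<Rightarrow> int" where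
  "point G x = (\<lambda>g\<in>carrier G. if g = x then 1 else 0)"

fun conv_pow :: "('a, 'm) monoid_scheme \<Rightarrow> ('a \<Rightarrow> int) \<Rightarrow> nat \<Rightarrow> 'a \<Rightarrow> int" where
  "conv_pow G u 0 = point G \<one>\<^bsub>G\<^esub>"
| "conv_pow G u (Suc n) = conv G (conv_pow G u n) u"

lemma (in finite_group_prime) prime_gt_1: "p > 1"
  using prime prime_gt_1_nat by blast

context group
begin

lemma conv_eq: "g \<in> carrier G \<Longrightarrow> conv G u v g = (\<Sum>h\<in>carrier G. u (g \<otimes> inv h) * v h)"
  unfolding conv_def
  by (rule sum.reindex_bij_witness[of _ "\<lambda>h. g \<otimes> inv h" "\<lambda>h. inv h \<otimes> g"])
    (auto simp: inv_mult_group m_assoc)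

lemma conv_assoc:
  assumes "g \<in> carrier G"
  shows "conv G (conv G u v) w g = conv G u (conv G v w) g"
proof -
  have "conv G (conv G u v) w g
      = (\<Sum>h\<in>carrier G. \<Sum>k\<in>carrier G. u k * (v (inv k \<otimes> h) * w (inv h \<otimes> g)))"
    by (simp add: conv_def sum_distrib_right mult.assoc)
  also have "\<dots> = (\<Sum>k\<in>carrier G. \<Sum>h\<in>carrier G. u k * (v (inv k \<otimes> h) * w (inv h \<otimes> g)))"
    by (rule sum.swap)
  also have "\<dots> = (\<Sum>k\<in>carrier G. u k * (\<Sum>h\<in>carrier G. v (inv k \<otimes> h) * w (inv h \<otimes> g)))"
    by (simp add: sum_distrib_left)
  also have "\<dots> = conv G u (conv G v w) g"
    unfolding conv_def
  proof (rule sum.cong[OF refl])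
    fix k assume "k \<in> carrier G"
    then have "(\<Sum>h\<in>carrier G. v (inv k \<otimes> h) * w (inv h \<otimes> g))
        = (\<Sum>h\<in>carrier G. v h * w (inv h \<otimes> (inv k \<otimes> g)))"
      using assms
      by (intro sum.reindex_bij_witness[of _ "\<lambda>h. k \<otimes> h" "\<lambda>h. inv k \<otimes> h"])
        (auto simp: inv_mult_group m_assoc)
    then show "u k * (\<Sum>h\<in>carrier G. v (inv k \<otimes> h) * w (inv h \<otimes> g))
        = u k * (\<Sum>h\<in>carrier G. v h * w (inv h \<otimes> (inv k \<otimes> g)))"
      by simp
  qed
  finally show ?thesis .
qed

lemma conv_cong_mod:
  assumes "\<And>g. g \<in> carrier G \<Longrightarrow> [u g = u' g] (mod m)" "\<And>g. g \<in> carrier G \<Longrightarrow> [v g = v' g] (mod m)"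
    "g \<in> carrier G"
  shows "[conv G u v g = conv G u' v' g] (mod m)"
  unfolding conv_def using assms by (intro cong_sum cong_mult) auto

lemma conv_cong:
  assumes "\<And>g. g \<in> carrier G \<Longrightarrow> u g = u' g" "\<And>g. g \<in> carrier G \<Longrightarrow> v g = v' g" "g \<in> carrier G"
  shows "conv G u v g = conv G u' v' g"
  unfolding conv_def using assms by (intro sum.cong) auto

lemma conv_add_left: "conv G (\<lambda>g. u g + u' g) v g = conv G u v g + conv G u' v g"
  and conv_add_right: "conv G u (\<lambda>g. v g + v' g) g = conv G u v g + conv G u v' g"
  and conv_scale_left: "conv G (\<lambda>g. k * u g) v g = k * conv G u v g"
  by (simp_all add: conv_def algebra_simps sum.distrib sum_distrib_left)

end

context finite_group_prime
begin

abbreviation "V \<equiv> unit_group p G"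

lemma conv_point_left: "x \<in> carrier G \<Longrightarrow> g \<in> carrier G \<Longrightarrow> conv G (point G x) v g = v (inv x \<otimes> g)"
  unfolding conv_def point_def using fin by (simp add: if_distrib[of "\<lambda>a. a * _"] cong: if_cong)

lemma conv_point_right: "x \<in> carrier G \<Longrightarrow> g \<in> carrier G \<Longrightarrow> conv G v (point G x) g = v (g \<otimes> inv x)"
  unfolding point_def using fin by (simp add: conv_eq if_distrib[of "\<lambda>a. _ * a"] cong: if_cong)

lemma sum_conv: "(\<Sum>g\<in>carrier G. conv G u v g) = (\<Sum>g\<in>carrier G. u g) * (\<Sum>g\<in>carrier G. v g)"
proof -
  have "(\<Sum>g\<in>carrier G. conv G u v g) = (\<Sum>h\<in>carrier G. \<Sum>g\<in>carrier G. u h * v (inv h \<otimes> g))"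
    unfolding conv_def by (rule sum.swap)
  also have "\<dots> = (\<Sum>h\<in>carrier G. \<Sum>g\<in>carrier G. u h * v g)"
  proof (rule sum.cong[OF refl])
    fix h assume h: "h \<in> carrier G"
    show "(\<Sum>g\<in>carrier G. u h * v (inv h \<otimes> g)) = (\<Sum>g\<in>carrier G. u h * v g)"
      using h by (intro sum.reindex_bij_witness[of _ "\<lambda>g. h \<otimes> g" "\<lambda>g. inv h \<otimes> g"]) auto
  qed
  finally show ?thesis
    by (simp add: sum_product)
qed

lemma carrier_V: "carrier V = {u \<in> carrier G \<rightarrow>\<^sub>E {0..int p - 1}. [(\<Sum>g\<in>carrier G. u g) = 1] (mod int p)}"
proof -
  have "finsum (residue_ring (int p)) u (carrier G) = sum u (carrier G) mod int p"
    if "u \<in> carrier G \<rightarrow>\<^sub>E {0..int p - 1}" for u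
    using that prime_gt_1 fin by (intro finsum_residue_ring) (auto simp: PiE_iff)
  then show ?thesis
    using prime_gt_1
    by (auto simp: normalized_units_def group_algebra_def residue_ring_def cong_def)
qed

lemma V_range: "u \<in> carrier V \<Longrightarrow> g \<in> carrier G \<Longrightarrow> 0 \<le> u g \<and> u g < int p"
  by (fastforce simp: carrier_V PiE_iff)

lemma one_V: "\<one>\<^bsub>V\<^esub> = point G \<one>"
  by (simp add: normalized_units_def group_algebra_def residue_ring_zero_one point_def cong: if_cong)

lemma mult_V:
  assumes "u \<in> carrier V" "v \<in> carrier V"
  shows "u \<otimes>\<^bsub>V\<^esub> v = reduce p G (conv G u v)"
proof -
  have "finsum (residue_ring (int p)) (\<lambda>h. u h * v (inv h \<otimes> g) mod int p) (carrier G)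
      = conv G u v g mod int p" if "g \<in> carrier G" for g
    unfolding conv_def using prime_gt_1 fin
    by (subst finsum_residue_ring) (auto simp: mod_sum_eq)
  then show ?thesis
    by (auto simp: normalized_units_def group_algebra_def residue_ring_def reduce_def)
qed

lemma reduce_cong:
  "(\<And>g. g \<in> carrier G \<Longrightarrow> [u g = v g] (mod int p)) \<Longrightarrow> reduce p G u = reduce p G v"
  by (auto simp: reduce_def cong_def)

lemma reduce_apply: "g \<in> carrier G \<Longrightarrow> [reduce p G u g = u g] (mod int p)"
  by (simp add: reduce_def cong_def)

lemma reduce_in_V:
  assumes "[(\<Sum>g\<in>carrier G. u g) = 1] (mod int p)"
  shows "reduce p G u \<in> carrier V"
proof -
  have "[(\<Sum>g\<in>carrier G. reduce p G u g) = (\<Sum>g\<in>carrier G. u g)] (mod int p)"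
    by (intro cong_sum reduce_apply)
  then show ?thesis
    using assms cong_trans prime_gt_1 by (auto simp: carrier_V reduce_def)
qed

lemma reduce_V: "u \<in> carrier V \<Longrightarrow> reduce p G u = u"
  by (rule ext) (auto simp: reduce_def carrier_V PiE_iff extensional_def)

lemma V_eqI:
  assumes "u \<in> carrier V" "v \<in> carrier V" "\<And>g. g \<in> carrier G \<Longrightarrow> [u g = v g] (mod int p)"
  shows "u = v"
  using reduce_cong[of u v] reduce_V assms by metis

lemma sum_V: "u \<in> carrier V \<Longrightarrow> [(\<Sum>g\<in>carrier G. u g) = 1] (mod int p)"
  by (simp add: carrier_V)

lemma point_in_V [simp, intro]: "x \<in> carrier G \<Longrightarrow> point G x \<in> carrier V"
  using fin prime_gt_1 by (auto simp: carrier_V point_def)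

lemma mult_V_closed: "u \<in> carrier V \<Longrightarrow> v \<in> carrier V \<Longrightarrow> u \<otimes>\<^bsub>V\<^esub> v \<in> carrier V"
  using cong_mult[OF sum_V sum_V, of u v] by (simp add: mult_V reduce_in_V sum_conv)

lemma mult_V_apply:
  "u \<in> carrier V \<Longrightarrow> v \<in> carrier V \<Longrightarrow> g \<in> carrier G \<Longrightarrow> [(u \<otimes>\<^bsub>V\<^esub> v) g = conv G u v g] (mod int p)"
  by (simp add: mult_V reduce_apply)

lemma monoid_V: "monoid V"
proof
  show one: "\<one>\<^bsub>V\<^esub> \<in> carrier V"
    by (simp add: one_V)
  fix u assume u: "u \<in> carrier V"
  show "\<one>\<^bsub>V\<^esub> \<otimes>\<^bsub>V\<^esub> u = u"
    using u one mult_V_apply[OF one u]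
    by (intro V_eqI) (auto simp: mult_V_closed one_V conv_point_left)
  show "u \<otimes>\<^bsub>V\<^esub> \<one>\<^bsub>V\<^esub> = u"
    using u one mult_V_apply[OF u one]
    by (intro V_eqI) (auto simp: mult_V_closed one_V conv_point_right)
  fix v assume v: "v \<in> carrier V"
  show uv: "u \<otimes>\<^bsub>V\<^esub> v \<in> carrier V"
    using u v by (rule mult_V_closed)
  fix w assume w: "w \<in> carrier V"
  have vw: "v \<otimes>\<^bsub>V\<^esub> w \<in> carrier V"
    using v w by (rule mult_V_closed)
  show "u \<otimes>\<^bsub>V\<^esub> v \<otimes>\<^bsub>V\<^esub> w = u \<otimes>\<^bsub>V\<^esub> (v \<otimes>\<^bsub>V\<^esub> w)"
  proof (rule V_eqI)
    fix g assume g: "g \<in> carrier G"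
    have "[(u \<otimes>\<^bsub>V\<^esub> v \<otimes>\<^bsub>V\<^esub> w) g = conv G (u \<otimes>\<^bsub>V\<^esub> v) w g] (mod int p)"
      using uv w g by (rule mult_V_apply)
    also have "[conv G (u \<otimes>\<^bsub>V\<^esub> v) w g = conv G (conv G u v) w g] (mod int p)"
      using u v g by (intro conv_cong_mod mult_V_apply) auto
    also have "conv G (conv G u v) w g = conv G u (conv G v w) g"
      using g by (rule conv_assoc)
    also have "[\<dots> = conv G u (v \<otimes>\<^bsub>V\<^esub> w) g] (mod int p)"
      using v w g by (intro conv_cong_mod cong_sym[OF mult_V_apply]) auto
    also have "[conv G u (v \<otimes>\<^bsub>V\<^esub> w) g = (u \<otimes>\<^bsub>V\<^esub> (v \<otimes>\<^bsub>V\<^esub> w)) g] (mod int p)"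
      using u vw g by (rule cong_sym[OF mult_V_apply])
    finally show "[(u \<otimes>\<^bsub>V\<^esub> v \<otimes>\<^bsub>V\<^esub> w) g = (u \<otimes>\<^bsub>V\<^esub> (v \<otimes>\<^bsub>V\<^esub> w)) g] (mod int p)" .
  qed (use u v w uv vw in \<open>auto simp: mult_V_closed\<close>)
qed

sublocale V: monoid V
  by (rule monoid_V)

lemma finite_V: "finite (carrier V)"
  unfolding carrier_V using finite_PiE[of "carrier G" "\<lambda>_. {0..int p - 1}"] fin by auto

lemma pow_V: "u \<in> carrier V \<Longrightarrow> u [^]\<^bsub>V\<^esub> n = reduce p G (conv_pow G u n)"
proof (induction n)
  case 0
  then show ?case
    using reduce_V[of "point G \<one>"] by (simp add: one_V)
next
  case (Suc n)
  have "reduce p G (conv_pow G u n) \<in> carrier V"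
    using Suc V.nat_pow_closed by metis
  then show ?case
    using Suc
    by (simp add: mult_V) (intro reduce_cong conv_cong_mod reduce_apply cong_refl)
qed

lemma pow_V_apply:
  "u \<in> carrier V \<Longrightarrow> g \<in> carrier G \<Longrightarrow> [(u [^]\<^bsub>V\<^esub> n) g = conv_pow G u n g] (mod int p)"
  by (simp add: pow_V reduce_apply)

lemma mult_point:
  assumes "x \<in> carrier G" "y \<in> carrier G"
  shows "point G x \<otimes>\<^bsub>V\<^esub> point G y = point G (x \<otimes> y)"
proof (rule V_eqI)
  fix g assume g: "g \<in> carrier G"
  have "conv G (point G x) (point G y) g = point G y (inv x \<otimes> g)"
    using assms g by (simp add: conv_point_left)
  also have "\<dots> = point G (x \<otimes> y) g"
    using assms g inv_solve_left[of y x g] by (auto simp: point_def)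
  finally have "conv G (point G x) (point G y) g = point G (x \<otimes> y) g" .
  then show "[(point G x \<otimes>\<^bsub>V\<^esub> point G y) g = point G (x \<otimes> y) g] (mod int p)"
    using mult_V_apply[of "point G x" "point G y" g] assms g by simp
qed (use assms in auto)

lemma pow_point: "x \<in> carrier G \<Longrightarrow> point G x [^]\<^bsub>V\<^esub> (n::nat) = point G (x [^] n)"
  by (induction n) (auto simp: one_V mult_point)

lemma point_inj:
  assumes "x \<in> carrier G" "y \<in> carrier G" "point G x = point G y"
  shows "x = y"
proof -
  have "point G x x = point G y x"
    using assms by simp
  then show ?thesis
    using assms(1) by (simp add: point_def split: if_splits)
qed

lemma conv_pow_eq_sum_lists:
  assumes "g \<in> carrier G"
  shows "conv_pow G u n g = (\<Sum>xs | set xs \<subseteq> carrier G \<and> length xs = n.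
    prod_list (map u xs) * of_bool (list_prod G xs = g))"
  using assms
proof (induction n arbitrary: g)
  case 0
  have "{xs. set xs \<subseteq> carrier G \<and> length xs = 0} = {[]}"
    by auto
  then show ?case
    using 0 by (simp add: point_def)
next
  case (Suc n)
  let ?L = "\<lambda>n. {xs. set xs \<subseteq> carrier G \<and> length xs = n}"
  let ?f = "\<lambda>xs g. prod_list (map u xs) * of_bool (list_prod G xs = g)"
  have "conv_pow G u (Suc n) g = (\<Sum>h\<in>carrier G. conv_pow G u n (g \<otimes> inv h) * u h)"
    using Suc by (simp add: conv_eq)
  also have "\<dots> = (\<Sum>h\<in>carrier G. \<Sum>xs\<in>?L n. ?f xs (g \<otimes> inv h) * u h)"
    using Suc by (simp add: sum_distrib_right)
  also have "\<dots> = (\<Sum>h\<in>carrier G. \<Sum>xs\<in>?L n. ?f (xs @ [h]) g)"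
  proof (intro sum.cong refl)
    fix h xs assume h: "h \<in> carrier G" and xs: "xs \<in> ?L n"
    then have "list_prod G xs \<in> carrier G"
      by auto
    then have "list_prod G xs = g \<otimes> inv h \<longleftrightarrow> list_prod G (xs @ [h]) = g"
      using h xs Suc inv_solve_right[of "list_prod G xs" g h] by (auto simp: list_prod_snoc)
    then show "?f xs (g \<otimes> inv h) * u h = ?f (xs @ [h]) g"
      by simp
  qed
  also have "\<dots> = (\<Sum>(h, xs)\<in>carrier G \<times> ?L n. ?f (xs @ [h]) g)"
    by (rule sum.cartesian_product)
  also have "\<dots> = (\<Sum>xs\<in>?L (Suc n). ?f xs g)"
  proof (rule sum.reindex_bij_witness[of _ "\<lambda>xs. (last xs, butlast xs)" "\<lambda>(h, xs). xs @ [h]"])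
    fix xs assume "xs \<in> ?L (Suc n)"
    then have "xs \<noteq> []"
      by auto
    then show "(case (last xs, butlast xs) of (h, xs) \<Rightarrow> xs @ [h]) = xs"
      by simp
    show "(last xs, butlast xs) \<in> carrier G \<times> ?L n"
      using \<open>xs \<in> ?L (Suc n)\<close> \<open>xs \<noteq> []\<close> by (auto dest: in_set_butlastD)
  qed auto
  finally show ?case .
qed

end

section \<open>The p-th power of an element of the group algebra\<close>

lemma fermat_int:
  fixes a :: int
  assumes "Factorial_Ring.prime p"
  shows "[a ^ p = a] (mod int p)"
proof (cases "int p dvd a")
  case True
  then have "int p dvd a ^ p"
    using assms prime_gt_0_nat dvd_power dvd_trans by blast
  then show ?thesis
    using True by (simp add: cong_def mod_eq_0_iff_dvd)
next
  case False
  define b where "b = nat (a mod int p)"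
  have p: "p > 0"
    using assms prime_gt_0_nat by blast
  have b: "[a = int b] (mod int p)"
    using p by (simp add: b_def cong_def)
  then have "\<not> p dvd b"
    using False cong_dvd_iff int_dvd_int_iff by blast
  then have "[b ^ (p - 1) = 1] (mod p)"
    using assms fermat_theorem by blast
  then have "[b ^ (p - 1) * b = 1 * b] (mod p)"
    by (rule cong_scalar_right)
  then have "[b ^ p = b] (mod p)"
    using p by (simp flip: power_Suc2)
  then have "[int b ^ p = int b] (mod int p)"
    by (metis cong_int_iff of_nat_power)
  then show ?thesis
    using b cong_pow cong_sym cong_trans by metis
qed

definition nonconstant :: "('a, 'm) monoid_scheme \<Rightarrow> nat \<Rightarrow> 'a multiset set" where
  "nonconstant G n = {M. set_mset M \<subseteq> carrier G \<and> size M = n \<and> (\<forall>x\<in>#M. count M x < n)}"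

definition excess :: "('a, 'm) monoid_scheme \<Rightarrow> nat \<Rightarrow> ('a \<Rightarrow> int) \<Rightarrow> 'a \<Rightarrow> int" where
  "excess G n u g = (\<Sum>M\<in>nonconstant G n. prod_mset (image_mset u M) * arrangements G M g)"

lemma permutations_replicate_mset: "permutations_of_multiset (replicate_mset n x) = {replicate n x}"
proof -
  have "xs = replicate n x" if "mset xs = replicate_mset n x" for xs
  proof -
    have "set xs \<subseteq> {x}" "length xs = n"
      using that by (metis set_mset_mset set_mset_replicate_mset_subset empty_subsetI order_refl)
        (metis that size_mset size_replicate_mset)
    then show ?thesis
      by (metis replicate_eqI singletonD subsetD)
  qed
  then show ?thesis
    by (auto simp: permutations_of_multiset_def)
qed

lemma (in monoid) list_prod_replicate: "x \<in> carrier G \<Longrightarrow> list_prod G (replicate n x) = x [^] n"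
proof (induction n)
  case (Suc n)
  then show ?case
    using nat_pow_Suc2[of x n] by simp
qed simp

text \<open>The words of length \<open>p\<close> are grouped by their multisets of letters. A
  constant word in \<open>x\<close> contributes \<open>u x ^ p\<close>, which is \<open>u x\<close>
  modulo \<open>p\<close> by Fermat, and the remaining words form the excess.\<close>

lemma (in finite_group_prime) conv_pow_prime:
  assumes g: "g \<in> carrier G"
  shows "[conv_pow G u p g = (\<Sum>x | x \<in> carrier G \<and> x [^] p = g. u x) + excess G p u g] (mod int p)"
proof -
  let ?L = "{xs. set xs \<subseteq> carrier G \<and> length xs = p}"
  let ?f = "\<lambda>xs. prod_list (map u xs) * of_bool (list_prod G xs = g) :: int"
  let ?h = "\<lambda>M. prod_mset (image_mset u M) * arrangements G M g"
  have finL: "finite ?L"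
    using finite_lists_length_eq[OF fin] by simp
  have p: "p > 0"
    using prime_gt_1 by simp
  have image: "mset ` ?L = {M. set_mset M \<subseteq> carrier G \<and> size M = p}"
    by (auto simp: image_iff) (metis ex_mset set_mset_mset size_mset)
  have "{M. set_mset M \<subseteq> carrier G \<and> size M = p} = nonconstant G p \<union> replicate_mset p ` carrier G"
  proof (intro Set.set_eqI iffI)
    fix M assume M: "M \<in> {M. set_mset M \<subseteq> carrier G \<and> size M = p}"
    show "M \<in> nonconstant G p \<union> replicate_mset p ` carrier G"
    proof (cases "\<forall>x\<in>#M. count M x < p")
      case False
      then obtain x where x: "x \<in># M" "p \<le> count M x"
        by auto
      then have "replicate_mset p x \<subseteq># M"
        by (simp add: count_le_replicate_mset_subset_eq)
      moreover have "\<not> replicate_mset p x \<subset># M"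
        using M mset_subset_size[of "replicate_mset p x" M] by auto
      ultimately have "M = replicate_mset p x"
        using subset_mset.le_imp_less_or_eq by metis
      then show ?thesis
        using M x by auto
    qed (use M in \<open>auto simp: nonconstant_def\<close>)
  qed (use p in \<open>auto simp: nonconstant_def\<close>)
  then have L: "mset ` ?L = nonconstant G p \<union> replicate_mset p ` carrier G"
    using image by simp
  have "conv_pow G u p g = sum ?f ?L"
    by (rule conv_pow_eq_sum_lists[OF g])
  also have "\<dots> = (\<Sum>M\<in>mset ` ?L. sum ?f {xs. xs \<in> ?L \<and> mset xs = M})"
    by (rule sum.image_gen[OF finL])
  also have "\<dots> = (\<Sum>M\<in>mset ` ?L. ?h M)"
  proof (rule sum.cong[OF refl])
    fix M assume M: "M \<in> mset ` ?L"
    then have "{xs. xs \<in> ?L \<and> mset xs = M} = permutations_of_multiset M"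
      unfolding image by (auto simp: permutations_of_multiset_def)
    moreover have "prod_list (map u xs) = prod_mset (image_mset u M)"
      if "xs \<in> permutations_of_multiset M" for xs
      using that by (metis mset_map permutations_of_multisetD prod_mset_prod_list)
    ultimately show "sum ?f {xs. xs \<in> ?L \<and> mset xs = M} = ?h M"
      by (simp add: arrangements_def sum_distrib_left)
  qed
  also have "\<dots> = excess G p u g + (\<Sum>M\<in>replicate_mset p ` carrier G. ?h M)"
    unfolding L excess_def
  proof (rule sum.union_disjoint)
    show "finite (nonconstant G p)" "finite (replicate_mset p ` carrier G)"
      using finite_imageI[OF finL, of mset] unfolding L finite_Un by blast+
    show "nonconstant G p \<inter> replicate_mset p ` carrier G = {}"
      using p by (auto simp: nonconstant_def)
  qed
  also have "(\<Sum>M\<in>replicate_mset p ` carrier G. ?h M) = (\<Sum>x\<in>carrier G. ?h (replicate_mset p x))"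
    by (rule sum.reindex[unfolded o_def])
      (use p in \<open>auto simp: inj_on_def replicate_mset_eq_iff\<close>)
  also have "\<dots> = (\<Sum>x\<in>carrier G. if x [^] p = g then u x ^ p else 0)"
    by (intro sum.cong refl)
      (auto simp: arrangements_def permutations_replicate_mset list_prod_replicate)
  also have "\<dots> = (\<Sum>x | x \<in> carrier G \<and> x [^] p = g. u x ^ p)"
    using fin by (simp add: sum.inter_filter)
  also have "[excess G p u g + \<dots> = excess G p u g + (\<Sum>x | x \<in> carrier G \<and> x [^] p = g. u x)] (mod int p)"
    by (intro cong_add cong_sum fermat_int prime cong_refl)
  finally show ?thesis
    by (simp add: add.commute)
qed

text \<open>The coordinate at \<open>q\<close> has weight 1, so the congruence determines it from
  the others, which are free. The weights are there for central units, which are described by one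
  value per conjugacy class, weighted by the size of the class.\<close>

lemma card_affine_functions:
  assumes "p > 0" "finite Q" "q \<in> Q" "w q = 1"
  shows "card {f \<in> Q \<rightarrow>\<^sub>E {0..int p - 1}. [(\<Sum>x\<in>Q. w x * f x) = 1] (mod int p)} = p ^ (card Q - 1)"
proof -
  let ?R = "{0..int p - 1}"
  let ?S = "{f \<in> Q \<rightarrow>\<^sub>E ?R. [(\<Sum>x\<in>Q. w x * f x) = 1] (mod int p)}"
  define ext where "ext = (\<lambda>f. f(q := (1 - (\<Sum>x\<in>Q - {q}. w x * f x)) mod int p))"
  have sum_Q: "(\<Sum>x\<in>Q. w x * f x) = f q + (\<Sum>x\<in>Q - {q}. w x * f x)" for f
    using assms by (simp add: sum.remove)
  have "bij_betw (\<lambda>f. restrict f (Q - {q})) ?S ((Q - {q}) \<rightarrow>\<^sub>E ?R)"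
  proof (rule bij_betw_byWitness[where f' = ext])
    show "\<forall>f\<in>?S. ext (restrict f (Q - {q})) = f"
    proof
      fix f assume f: "f \<in> ?S"
      let ?s = "\<Sum>x\<in>Q - {q}. w x * f x"
      have "[f q + ?s = 1] (mod int p)"
        using f by (simp add: sum_Q)
      then have "[f q = 1 - ?s] (mod int p)"
        by (simp add: cong_iff_dvd_diff algebra_simps)
      moreover have "0 \<le> f q" "f q < int p"
        using f assms by (fastforce simp: PiE_iff)+
      ultimately have "(1 - ?s) mod int p = f q"
        by (simp add: cong_def)
      moreover have "(\<Sum>x\<in>Q - {q}. w x * restrict f (Q - {q}) x) = ?s"
        by simp
      ultimately show "ext (restrict f (Q - {q})) = f"
        using f unfolding ext_def by (intro ext) (auto simp: PiE_iff extensional_def)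
    qed
    show "\<forall>f\<in>(Q - {q}) \<rightarrow>\<^sub>E ?R. restrict (ext f) (Q - {q}) = f"
      by (auto simp: ext_def PiE_iff extensional_def fun_eq_iff)
    show "(\<lambda>f. restrict f (Q - {q})) ` ?S \<subseteq> (Q - {q}) \<rightarrow>\<^sub>E ?R"
      by (auto simp: PiE_iff split: if_splits)
    show "ext ` ((Q - {q}) \<rightarrow>\<^sub>E ?R) \<subseteq> ?S"
    proof clarify
      fix f assume f: "f \<in> (Q - {q}) \<rightarrow>\<^sub>E ?R"
      have "(\<Sum>x\<in>Q - {q}. w x * ext f x) = (\<Sum>x\<in>Q - {q}. w x * f x)"
        by (intro sum.cong) (auto simp: ext_def)
      then have "(\<Sum>x\<in>Q. w x * ext f x) = (1 - (\<Sum>x\<in>Q - {q}. w x * f x)) mod int p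
          + (\<Sum>x\<in>Q - {q}. w x * f x)"
        unfolding sum_Q by (simp add: ext_def)
      then have "[(\<Sum>x\<in>Q. w x * ext f x) = 1] (mod int p)"
        by (simp add: cong_def mod_add_left_eq)
      moreover have "ext f \<in> Q \<rightarrow>\<^sub>E ?R"
        using f assms unfolding ext_def
        by (auto simp: PiE_iff extensional_def)
      ultimately show "ext f \<in> Q \<rightarrow>\<^sub>E ?R \<and> [(\<Sum>x\<in>Q. w x * ext f x) = 1] (mod int p)"
        by blast
    qed
  qed
  then have "card ?S = card ((Q - {q}) \<rightarrow>\<^sub>E ?R)"
    by (rule bij_betw_same_card)
  also have "\<dots> = p ^ (card Q - 1)"
    using assms by (simp add: card_PiE)
  finally show ?thesis .
qed

lemma (in finite_group_prime) card_V: "card (carrier V) = p ^ (card (carrier G) - 1)"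
proof -
  have "card {f \<in> carrier G \<rightarrow>\<^sub>E {0..int p - 1}. [(\<Sum>x\<in>carrier G. 1 * f x) = 1] (mod int p)}
      = p ^ (card (carrier G) - 1)"
    using fin prime_gt_1 by (intro card_affine_functions[of p _ \<one>]) auto
  then show ?thesis
    by (simp add: carrier_V)
qed

context central_ext
begin

lemma nonconstant_ex:
  assumes "M \<in> nonconstant G p"
  obtains x where "x \<in># M" "count M x < p" "set_mset M \<subseteq> carrier G" "size M = p"
proof -
  have "M \<noteq> {#}"
    using assms p_gt_2 by (auto simp: nonconstant_def)
  then show ?thesis
    using assms that by (auto simp: nonconstant_def)
qed

lemma excess_mult_c:
  assumes "g \<in> carrier G"
  shows "[excess G p u (g \<otimes> c) = excess G p u g] (mod int p)"
  unfolding excess_def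
proof (intro cong_sum cong_mult cong_refl)
  fix M assume "M \<in> nonconstant G p"
  then obtain x where "x \<in># M" "count M x < p" "set_mset M \<subseteq> carrier G" "size M = p"
    by (rule nonconstant_ex)
  then show "[arrangements G M (g \<otimes> c) = arrangements G M g] (mod int p)"
    using arrangements_mult_c(1)[of M x g] assms by (simp add: cong_iff_dvd_diff)
qed

lemma excess_center:
  assumes "g \<in> center G"
  shows "[excess G p u g = 0] (mod int p)"
proof -
  have "int p dvd arrangements G M g" if M: "M \<in> nonconstant G p" for M
  proof -
    obtain x where "x \<in># M" "count M x < p" "set_mset M \<subseteq> carrier G" "size M = p"
      using M by (rule nonconstant_ex)
    then show ?thesis
      using arrangements_mult_c(2)[of M x g] centerD[OF assms] by simp
  qed
  then have "int p dvd excess G p u g"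
    unfolding excess_def by (intro dvd_sum dvd_mult) auto
  then show ?thesis
    by (simp add: cong_0_iff)
qed

section \<open>Cosets of the subgroup generated by c\<close>

lemma mult_c_center_iff:
  assumes "g \<in> carrier G"
  shows "g \<otimes> c \<in> center G \<longleftrightarrow> g \<in> center G"
proof
  assume "g \<otimes> c \<in> center G"
  then have "g \<otimes> c \<otimes> inv c \<in> center G"
    using c_in_center subgroup_center subgroup.m_closed subgroup.m_inv_closed by metis
  then show "g \<in> center G"
    using assms by (simp add: m_assoc)
next
  assume "g \<in> center G"
  then show "g \<otimes> c \<in> center G"
    using c_in_center subgroup_center subgroup.m_closed by metis
qed

lemma mult_c_pow_center_iff: "g \<in> carrier G \<Longrightarrow> g \<otimes> c [^] (i::nat) \<in> center G \<longleftrightarrow> g \<in> center G"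
proof (induction i)
  case (Suc i)
  then show ?case
    using mult_c_center_iff[of "g \<otimes> c [^] i"] by (simp add: m_assoc)
qed simp

definition ccoset :: "'a \<Rightarrow> 'a set" where
  "ccoset g = (\<lambda>i. g \<otimes> c [^] i) ` {..<p}"

lemma card_ccoset: "g \<in> carrier G \<Longrightarrow> card (ccoset g) = p"
  unfolding ccoset_def by (subst card_image) (auto simp: inj_on_def c_pow_eq_iff)

lemma ccoset_memI: "g \<in> carrier G \<Longrightarrow> g \<otimes> c [^] (i::nat) \<in> ccoset g"
  unfolding ccoset_def by (rule image_eqI[of _ _ "i mod p"]) (auto simp: c_pow_mod)

lemma ccoset_self: "g \<in> carrier G \<Longrightarrow> g \<in> ccoset g"
  using ccoset_memI[of g 0] by simp

lemma ccoset_mult_subset: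
  assumes "g \<in> carrier G"
  shows "ccoset (g \<otimes> c [^] (i::nat)) \<subseteq> ccoset g"
  using assms ccoset_memI[of g] by (auto simp: ccoset_def m_assoc nat_pow_mult)

lemma ccoset_eq_iff:
  assumes "g \<in> carrier G" "h \<in> carrier G"
  shows "ccoset h = ccoset g \<longleftrightarrow> h \<in> ccoset g"
proof
  assume "h \<in> ccoset g"
  then obtain i where i: "i < p" "h = g \<otimes> c [^] i"
    by (auto simp: ccoset_def)
  have "h \<otimes> c [^] (p - i) = g"
    unfolding i(2) using i(1) assms(1) c_pow_p by (simp add: m_assoc nat_pow_mult)
  then show "ccoset h = ccoset g"
    using ccoset_mult_subset[OF assms(1), of i] ccoset_mult_subset[OF assms(2), of "p - i"] i(2)
    by auto
qed (use ccoset_self assms in auto)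

text \<open>\<open>S\<close> is a union of cosets of <c>, each of them has \<open>p\<close>
  elements, and \<open>f\<close> is constant on each.\<close>

lemma dvd_sum_c_invariant:
  assumes S: "S \<subseteq> carrier G" "\<And>g. g \<in> S \<Longrightarrow> g \<otimes> c \<in> S"
    and f: "\<And>g. g \<in> S \<Longrightarrow> f (g \<otimes> c) = f g"
  shows "int p dvd (\<Sum>g\<in>S. f g)"
proof -
  have pow: "g \<otimes> c [^] i \<in> S \<and> f (g \<otimes> c [^] i) = f g" if "g \<in> S" for g and i :: nat
  proof (induction i)
    case (Suc i)
    then show ?case
      using S(1) S(2)[of "g \<otimes> c [^] i"] f[of "g \<otimes> c [^] i"] that by (auto simp: m_assoc subset_iff)
  qed (use that S in auto)
  have "finite S"
    using S fin finite_subset by blast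
  then have "(\<Sum>g\<in>S. f g) = (\<Sum>q\<in>ccoset ` S. sum f {g. g \<in> S \<and> ccoset g = q})"
    by (rule sum.image_gen)
  also have "int p dvd \<dots>"
  proof (rule dvd_sum)
    fix q assume "q \<in> ccoset ` S"
    then obtain h where h: "h \<in> S" "q = ccoset h"
      by auto
    have sub: "ccoset h \<subseteq> S"
      using pow h by (auto simp: ccoset_def)
    have "g \<in> S \<and> ccoset g = q \<longleftrightarrow> g \<in> ccoset h" for g
      using h S(1) ccoset_eq_iff[of h g] sub by blast
    then have "{g. g \<in> S \<and> ccoset g = q} = ccoset h"
      by blast
    moreover have "f g = f h" if "g \<in> ccoset h" for g
      using that pow h by (auto simp: ccoset_def)
    ultimately have "sum f {g. g \<in> S \<and> ccoset g = q} = int p * f h"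
      using h S by (simp add: card_ccoset subset_iff)
    then show "int p dvd sum f {g. g \<in> S \<and> ccoset g = q}"
      by simp
  qed
  finally show ?thesis .
qed

end

section \<open>The centre and the exponent of the group of normalized units\<close>

context central_ext
begin

lemma V_cong_eq:
  assumes "u \<in> carrier V" "g \<in> carrier G" "h \<in> carrier G" "[u g = u h] (mod int p)"
  shows "u g = u h"
  using assms V_range[of u g] V_range[of u h] by (auto simp: cong_def)

lemma conjugation_invariant:
  assumes u: "\<And>g. g \<in> carrier G - center G \<Longrightarrow> u (g \<otimes> c) = u g"
    and g: "g \<in> carrier G" and t: "t \<in> carrier G"
  shows "u (t \<otimes> g \<otimes> inv t) = u g"
proof (cases "g \<in> center G")
  case True
  then have "t \<otimes> g = g \<otimes> t"
    using centerD(2) t by metis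
  then show ?thesis
    using g t by (simp add: m_assoc)
next
  case False
  obtain i :: nat where i: "t \<otimes> g \<otimes> inv t = g \<otimes> c [^] i"
    using conj_eq_mult_c_pow[OF g t] by blast
  have "u (g \<otimes> c [^] i) = u g" for i :: nat
  proof (induction i)
    case (Suc i)
    have "g \<otimes> c [^] i \<in> carrier G - center G"
      using g False by (simp add: mult_c_pow_center_iff)
    then show ?case
      using u[of "g \<otimes> c [^] i"] Suc g by (simp add: m_assoc)
  qed (use g in simp)
  then show ?thesis
    unfolding i .
qed

text \<open>A unit is central iff it is constant on conjugacy classes, and the class of a noncentral
  element is its whole coset of <c>.\<close>

lemma center_V_iff:
  assumes u: "u \<in> carrier V"
  shows "u \<in> center V \<longleftrightarrow> (\<forall>g\<in>carrier G - center G. u (g \<otimes> c) = u g)"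
proof
  assume uc: "u \<in> center V"
  have conj: "u (t \<otimes> g \<otimes> inv t) = u g" if g: "g \<in> carrier G" and t: "t \<in> carrier G" for g t
  proof -
    have gt: "t \<otimes> g \<in> carrier G"
      using g t by simp
    \<comment> \<open>Invariance under conjugation comes from comparing the coefficients of the two
      products of \<open>u\<close> with the group element \<open>t\<close> at
      \<open>t \<otimes> g\<close>.\<close>
    have "[u (t \<otimes> g \<otimes> inv t) = conv G u (point G t) (t \<otimes> g)] (mod int p)"
      using t g by (simp add: conv_point_right)
    also have "[conv G u (point G t) (t \<otimes> g) = (u \<otimes>\<^bsub>V\<^esub> point G t) (t \<otimes> g)] (mod int p)"
      using u t gt by (intro cong_sym[OF mult_V_apply]) auto
    also have "u \<otimes>\<^bsub>V\<^esub> point G t = point G t \<otimes>\<^bsub>V\<^esub> u"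
      using centerD(2)[OF uc] t by simp
    also have "[(point G t \<otimes>\<^bsub>V\<^esub> u) (t \<otimes> g) = conv G (point G t) u (t \<otimes> g)] (mod int p)"
      using u t gt by (intro mult_V_apply) auto
    also have "conv G (point G t) u (t \<otimes> g) = u g"
      using t g by (simp add: conv_point_left)
    finally show ?thesis
      using V_cong_eq[OF u _ g] t g by simp
  qed
  show "\<forall>g\<in>carrier G - center G. u (g \<otimes> c) = u g"
  proof
    fix g assume "g \<in> carrier G - center G"
    then have g: "g \<in> carrier G" "g \<notin> center G"
      by auto
    then obtain t where t: "t \<in> carrier G" "g \<otimes> t \<noteq> t \<otimes> g"
      using centerI by metis
    obtain i :: nat where i: "t \<otimes> g \<otimes> inv t = g \<otimes> c [^] i"
      using conj_eq_mult_c_pow[OF g(1) t(1)] by blast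
    have "\<not> p dvd i"
    proof
      assume "p dvd i"
      then have "t \<otimes> g \<otimes> inv t = g"
        using i g by (simp add: c_pow_eq_one_iff)
      then have "t \<otimes> g \<otimes> inv t \<otimes> t = g \<otimes> t"
        by simp
      then show False
        using t g by (simp add: m_assoc)
    qed
    then have "coprime i p"
      using prime coprime_commute prime_imp_coprime_nat by blast
    \<comment> \<open>One conjugation by \<open>t\<close> shifts by \<open>c [^] i\<close>;
      repeating it \<open>j\<close> times shifts by \<open>c [^] (i * j)\<close>, which is
      \<open>c\<close>.\<close>
    then obtain j where j: "[i * j = 1] (mod p)"
      using cong_solve_coprime_nat by fastforce
    have "u (g \<otimes> c [^] (i * j)) = u g" for j
    proof (induction j)
      case (Suc j)
      have "t \<otimes> (g \<otimes> c [^] (i * j)) \<otimes> inv t = t \<otimes> g \<otimes> (c [^] (i * j) \<otimes> inv t)"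
        using t g by (simp add: m_assoc)
      also have "\<dots> = t \<otimes> g \<otimes> inv t \<otimes> c [^] (i * j)"
        using t g by (subst c_pow_central) (simp_all add: m_assoc)
      also have "\<dots> = g \<otimes> c [^] (i * Suc j)"
        unfolding i using g by (simp add: m_assoc nat_pow_mult)
      finally show ?case
        using conj[of "g \<otimes> c [^] (i * j)" t] Suc t g by simp
    qed (use g in simp)
    moreover have "c [^] (i * j) = c"
      using j c_pow_eq_iff[of "i * j" 1] by (simp add: cong_def)
    ultimately show "u (g \<otimes> c) = u g"
      by metis
  qed
next
  assume "\<forall>g\<in>carrier G - center G. u (g \<otimes> c) = u g"
  then have conj: "u (t \<otimes> g \<otimes> inv t) = u g" if "g \<in> carrier G" "t \<in> carrier G" for g t
    using conjugation_invariant that by blast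
  show "u \<in> center V"
  proof (rule centerI[OF u])
    fix v assume v: "v \<in> carrier V"
    show "u \<otimes>\<^bsub>V\<^esub> v = v \<otimes>\<^bsub>V\<^esub> u"
      unfolding mult_V[OF u v] mult_V[OF v u]
    proof (rule reduce_cong)
      fix g assume g: "g \<in> carrier G"
      have "conv G u v g = (\<Sum>h\<in>carrier G. u (g \<otimes> inv h) * v h)"
        using g by (rule conv_eq)
      also have "\<dots> = (\<Sum>h\<in>carrier G. v h * u (inv h \<otimes> g))"
      proof (rule sum.cong[OF refl])
        fix h assume h: "h \<in> carrier G"
        have "h \<otimes> (inv h \<otimes> g) \<otimes> inv h = g \<otimes> inv h"
          using g h by simp
        then show "u (g \<otimes> inv h) * v h = v h * u (inv h \<otimes> g)"
          using conj[of "inv h \<otimes> g" h] g h by simp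
      qed
      finally show "[conv G u v g = conv G v u g] (mod int p)"
        by (simp add: conv_def)
    qed
  qed
qed

text \<open>\<open>k\<close> is the number of conjugacy classes of \<open>G\<close>: a central unit
  has one value per class, subject to one condition on the sum. The classes are the single central
  elements and the noncentral cosets of <c>; an extra weight p - 1 on the central ones makes all of
  them weigh \<open>p\<close>.\<close>

lemma card_center_V:
  obtains k where "card (center V) = p ^ (k - 1)" "k \<ge> 1"
    "p * k = card (carrier G) + (p - 1) * card (center G)"
proof -
  define orb where "orb = (\<lambda>g. if g \<in> center G then {g} else ccoset g)"
  let ?Q = "orb ` carrier G"
  have orb_eq: "orb h = orb g \<longleftrightarrow> h \<in> orb g" if "g \<in> carrier G" "h \<in> carrier G" for g h
  proof (cases "g \<in> center G \<or> h \<in> center G")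
    case True
    have "h' \<notin> center G" if "g' \<notin> center G" "g' \<in> carrier G" "h' \<in> ccoset g'" for g' h'
      using that by (auto simp: ccoset_def mult_c_pow_center_iff)
    then show ?thesis
      using True that ccoset_self[of g] ccoset_self[of h] unfolding orb_def by auto
  qed (use that ccoset_eq_iff in \<open>auto simp: orb_def\<close>)
  have orb_self: "g \<in> orb g" if "g \<in> carrier G" for g
    using that by (simp add: orb_def ccoset_self)
  have orb_sub: "orb g \<subseteq> carrier G" if "g \<in> carrier G" for g
    using that by (auto simp: orb_def ccoset_def)
  have fiber: "{g. g \<in> carrier G \<and> orb g = q} = q" if q: "q \<in> ?Q" for q
    using that orb_eq orb_sub by blast
  have finQ: "finite ?Q"
    using fin by simp
  have Z: "center G \<subseteq> carrier G" "\<one> \<in> center G"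
    by (auto dest: centerD(1) intro: subgroup.one_closed[OF subgroup_center])
  have card_orb: "p = card q + (if q \<in> orb ` center G then p - 1 else 0)" if q: "q \<in> ?Q" for q
  proof -
    obtain g where g: "g \<in> carrier G" "q = orb g"
      using q by auto
    then show ?thesis
    proof (cases "g \<in> center G")
      case False
      have "q \<notin> orb ` center G"
      proof
        assume "q \<in> orb ` center G"
        then obtain z where "z \<in> center G" "orb g = orb z"
          using g by auto
        then have "g \<in> orb z"
          using orb_self g by blast
        then show False
          using \<open>z \<in> center G\<close> False by (simp add: orb_def)
      qed
      then show ?thesis
        using False g by (simp add: orb_def card_ccoset)
    qed (use p_gt_2 in \<open>auto simp: orb_def\<close>)
  qed
  have "p * card ?Q = (\<Sum>q\<in>?Q. p)"
    by simp
  also have "\<dots> = (\<Sum>q\<in>?Q. card q + (if q \<in> orb ` center G then p - 1 else 0))"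
    by (intro sum.cong refl card_orb)
  also have "\<dots> = (\<Sum>q\<in>?Q. card q) + (\<Sum>q\<in>?Q. if q \<in> orb ` center G then p - 1 else 0)"
    by (rule sum.distrib)
  also have "(\<Sum>q\<in>?Q. if q \<in> orb ` center G then p - 1 else 0) = (\<Sum>q\<in>?Q \<inter> orb ` center G. p - 1)"
    by (rule sum.inter_restrict[OF finQ, symmetric])
  also have "?Q \<inter> orb ` center G = orb ` center G"
    using Z by auto
  also have "(\<Sum>q\<in>orb ` center G. p - 1) = (p - 1) * card (center G)"
  proof -
    have "inj_on orb (center G)"
      by (auto simp: inj_on_def orb_def)
    then show ?thesis
      by (simp add: card_image)
  qed
  also have "(\<Sum>q\<in>?Q. card q) = card (carrier G)"
  proof -
    have "card (carrier G) = (\<Sum>g\<in>carrier G. 1)"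
      by simp
    also have "\<dots> = (\<Sum>q\<in>?Q. card {g. g \<in> carrier G \<and> orb g = q})"
      using sum.image_gen[OF fin, of "\<lambda>_. 1 :: nat" orb] by simp
    finally show ?thesis
      using fiber by simp
  qed
  finally have k: "p * card ?Q = card (carrier G) + (p - 1) * card (center G)" .
  let ?S = "{f \<in> ?Q \<rightarrow>\<^sub>E {0..int p - 1}. [(\<Sum>q\<in>?Q. int (card q) * f q) = 1] (mod int p)}"
  \<comment> \<open>The class of the neutral element supplies the coordinate of weight 1.\<close>
  have "orb \<one> = {\<one>}" "orb \<one> \<in> ?Q"
    using Z by (auto simp: orb_def)
  then have card_S: "card ?S = p ^ (card ?Q - 1)"
    using finQ by (intro card_affine_functions[of p ?Q "orb \<one>"]) auto
  define pick where "pick = (\<lambda>q. SOME g. g \<in> carrier G \<and> orb g = q)"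
  have bij: "bij_betw (\<lambda>f. \<lambda>g\<in>carrier G. f (orb g)) ?S (center V)"
  proof (rule bij_betw_byWitness[where f' = "\<lambda>u. \<lambda>q\<in>?Q. u (pick q)"])
    have some: "pick q \<in> carrier G \<and> orb (pick q) = q" if "q \<in> ?Q" for q
      unfolding pick_def using that by (intro someI_ex[of "\<lambda>g. g \<in> carrier G \<and> orb g = q"]) auto
    have sum_orb: "(\<Sum>g\<in>carrier G. f (orb g)) = (\<Sum>q\<in>?Q. int (card q) * f q)" for f :: "'a set \<Rightarrow> int"
    proof -
      have "(\<Sum>g\<in>carrier G. f (orb g)) = (\<Sum>q\<in>?Q. \<Sum>g | g \<in> carrier G \<and> orb g = q. f (orb g))"
        by (rule sum.image_gen[OF fin])
      also have "\<dots> = (\<Sum>q\<in>?Q. \<Sum>g | g \<in> carrier G \<and> orb g = q. f q)"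
        by (intro sum.cong) auto
      also have "\<dots> = (\<Sum>q\<in>?Q. int (card q) * f q)"
        using fiber by simp
      finally show ?thesis .
    qed
    have const: "u h = u g" if u: "u \<in> center V" and "g \<in> carrier G" "h \<in> carrier G" "orb h = orb g" for u g h
    proof -
      have "h \<in> orb g"
        using orb_eq that by blast
      show ?thesis
      proof (cases "g \<in> center G")
        case False
        then obtain i :: nat where i: "h = g \<otimes> c [^] i"
          using \<open>h \<in> orb g\<close> by (auto simp: orb_def ccoset_def)
        have "u (g \<otimes> c [^] i) = u g" for i :: nat
        proof (induction i)
          case (Suc i)
          have "g \<otimes> c [^] i \<in> carrier G - center G"
            using that(2) False by (simp add: mult_c_pow_center_iff)
          then have "u (g \<otimes> c [^] i \<otimes> c) = u (g \<otimes> c [^] i)"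
            using u center_V_iff[OF centerD(1)[OF u]] by blast
          then show ?case
            using Suc that(2) by (simp add: m_assoc)
        qed (use that(2) in simp)
        then show ?thesis
          using i by simp
      qed (use \<open>h \<in> orb g\<close> in \<open>simp add: orb_def\<close>)
    qed
    have pick: "u (pick (orb g)) = u g" if "u \<in> center V" "g \<in> carrier G" for u g
      using const[OF that] some[of "orb g"] that(2) by blast
    show "\<forall>f\<in>?S. (\<lambda>q\<in>?Q. (\<lambda>g\<in>carrier G. f (orb g)) (pick q)) = f"
    proof
      fix f assume f: "f \<in> ?S"
      show "(\<lambda>q\<in>?Q. (\<lambda>g\<in>carrier G. f (orb g)) (pick q)) = f"
      proof
        fix q show "(\<lambda>q\<in>?Q. (\<lambda>g\<in>carrier G. f (orb g)) (pick q)) q = f q"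
          using f some[of q] by (cases "q \<in> ?Q") (auto simp: PiE_iff extensional_def)
      qed
    qed
    show "\<forall>u\<in>center V. (\<lambda>g\<in>carrier G. (\<lambda>q\<in>?Q. u (pick q)) (orb g)) = u"
    proof (intro ballI ext)
      fix u g assume u: "u \<in> center V"
      show "(\<lambda>g\<in>carrier G. (\<lambda>q\<in>?Q. u (pick q)) (orb g)) g = u g"
      proof (cases "g \<in> carrier G")
        case True
        then show ?thesis
          using pick[OF u True] by simp
      next
        case False
        then show ?thesis
          using centerD(1)[OF u] by (auto simp: carrier_V PiE_iff extensional_def)
      qed
    qed
    show "(\<lambda>f. \<lambda>g\<in>carrier G. f (orb g)) ` ?S \<subseteq> center V"
    proof clarify
      fix f assume f: "f \<in> ?Q \<rightarrow>\<^sub>E {0..int p - 1}" "[(\<Sum>q\<in>?Q. int (card q) * f q) = 1] (mod int p)"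
      let ?u = "\<lambda>g\<in>carrier G. f (orb g)"
      have "(\<Sum>g\<in>carrier G. ?u g) = (\<Sum>g\<in>carrier G. f (orb g))"
        by simp
      then have u: "?u \<in> carrier V"
        using f sum_orb[of f] unfolding carrier_V by (auto simp: PiE_iff)
      have "orb (g \<otimes> c) = orb g" if "g \<in> carrier G - center G" for g
        using that orb_eq[of g "g \<otimes> c"] ccoset_memI[of g 1] by (simp add: orb_def)
      then show "?u \<in> center V"
        using center_V_iff[OF u] by simp
    qed
    show "(\<lambda>u. \<lambda>q\<in>?Q. u (pick q)) ` center V \<subseteq> ?S"
    proof clarify
      fix u assume u: "u \<in> center V"
      let ?f = "\<lambda>q\<in>?Q. u (pick q)"
      have uV: "u \<in> carrier V"
        using u by (rule centerD(1))
      have "(\<Sum>g\<in>carrier G. ?f (orb g)) = (\<Sum>g\<in>carrier G. u g)"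
        using pick[OF u] by (intro sum.cong) auto
      then have "[(\<Sum>q\<in>?Q. int (card q) * ?f q) = 1] (mod int p)"
        using sum_V[OF uV] sum_orb[of ?f] by simp
      moreover have "?f \<in> ?Q \<rightarrow>\<^sub>E {0..int p - 1}"
        using some V_range[OF uV] by fastforce
      ultimately show "?f \<in> ?Q \<rightarrow>\<^sub>E {0..int p - 1} \<and> [(\<Sum>q\<in>?Q. int (card q) * ?f q) = 1] (mod int p)"
        by blast
    qed
  qed
  have "card (center V) = p ^ (card ?Q - 1)"
    using bij_betw_same_card[OF bij] card_S by simp
  moreover have "card ?Q > 0"
    using finQ \<open>orb \<one> \<in> ?Q\<close> unfolding card_gt_0_iff by blast
  ultimately show ?thesis
    using that[of "card ?Q"] k by simp
qed

section \<open>Powers of units and of central units\<close>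

text \<open>Functions invariant under \<open>c\<close> are multiples of the sum of all powers of
  \<open>c\<close>, and the square of that sum is \<open>p\<close> times the sum.\<close>

lemma conv_c_invariant_eq_0:
  assumes e: "\<And>g. g \<in> carrier G \<Longrightarrow> e (g \<otimes> c) = e g"
    and e': "\<And>g. g \<in> carrier G \<Longrightarrow> e' (g \<otimes> c) = e' g" and g: "g \<in> carrier G"
  shows "[conv G e e' g = 0] (mod int p)"
  unfolding conv_def cong_0_iff
proof (rule dvd_sum_c_invariant)
  fix h assume h: "h \<in> carrier G"
  have "inv h \<otimes> g = inv (h \<otimes> c) \<otimes> g \<otimes> c"
  proof -
    have "inv (h \<otimes> c) \<otimes> g \<otimes> c = inv c \<otimes> (inv h \<otimes> g \<otimes> c)"
      using g h by (simp add: inv_mult_group m_assoc)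
    also have "\<dots> = inv c \<otimes> (c \<otimes> (inv h \<otimes> g))"
      using g h c_central[of "inv h \<otimes> g"] by simp
    finally show ?thesis
      using g h by simp
  qed
  then have "e' (inv h \<otimes> g) = e' (inv (h \<otimes> c) \<otimes> g)"
    using e'[of "inv (h \<otimes> c) \<otimes> g"] g h by simp
  then show "e (h \<otimes> c) * e' (inv (h \<otimes> c) \<otimes> g) = e h * e' (inv h \<otimes> g)"
    using e h by simp
qed auto

text \<open>The binomial formula for commuting \<open>a\<close> and \<open>e\<close>, cut off after
  the linear term because \<open>e\<close> has square zero modulo \<open>p\<close>. For the exponent
  \<open>p\<close> the linear term disappears as well.\<close>

lemma conv_pow_central_plus_invariant:
  assumes a: "\<And>g. g \<in> carrier G - center G \<Longrightarrow> a g = 0"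
    and e: "\<And>g. g \<in> carrier G \<Longrightarrow> e (g \<otimes> c) = e g"
    and g: "g \<in> carrier G"
  shows "[conv_pow G (\<lambda>g. a g + e g) (Suc n) g
    = conv_pow G a (Suc n) g + int (Suc n) * conv G (conv_pow G a n) e g] (mod int p)"
  using g
proof (induction n arbitrary: g)
  case 0
  then show ?case
    by (simp add: conv_add_right)
next
  case (Suc n)
  define P where "P = conv_pow G a (Suc n)"
  define Q where "Q = conv G (conv_pow G a n) e"
  have Q: "Q (g \<otimes> c) = Q g" if "g \<in> carrier G" for g
    unfolding Q_def conv_def using that e by (intro sum.cong) (simp_all flip: m_assoc)
  \<comment> \<open>\<open>a\<close> is supported on the centre, hence commutes with every element
    of the group algebra.\<close>
  have comm: "conv G e a g = conv G a e g" if g: "g \<in> carrier G" for g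
  proof -
    have eq: "a h * e (inv h \<otimes> g) = e (g \<otimes> inv h) * a h" if h: "h \<in> carrier G" for h
    proof (cases "h \<in> center G")
      case True
      then have "inv h \<in> center G"
        using subgroup.m_inv_closed[OF subgroup_center] by blast
      then have "inv h \<otimes> g = g \<otimes> inv h"
        using g by (rule centerD(2))
      then show ?thesis
        by simp
    qed (use a h in simp)
    then show ?thesis
      unfolding conv_eq[OF g, of e a] conv_def[of G a e] by (intro sum.cong refl eq[symmetric])
  qed
  have "[conv_pow G (\<lambda>g. a g + e g) (Suc (Suc n)) g
      = conv G (\<lambda>g. P g + int (Suc n) * Q g) (\<lambda>g. a g + e g) g] (mod int p)"
    unfolding conv_pow.simps(2)[of G _ "Suc n"] P_def Q_def using Suc
    by (intro conv_cong_mod) auto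
  also have "conv G (\<lambda>g. P g + int (Suc n) * Q g) (\<lambda>g. a g + e g) g
      = conv G P a g + conv G P e g + int (Suc n) * conv G Q a g + int (Suc n) * conv G Q e g"
    by (simp add: conv_add_left conv_add_right conv_scale_left algebra_simps)
  also have "conv G Q a g = conv G P e g"
  proof -
    have "conv G Q a g = conv G (conv_pow G a n) (conv G e a) g"
      unfolding Q_def using Suc by (simp add: conv_assoc)
    also have "\<dots> = conv G (conv_pow G a n) (conv G a e) g"
      by (rule conv_cong[OF refl comm Suc.prems])
    also have "\<dots> = conv G P e g"
      unfolding P_def using Suc by (simp add: conv_assoc)
    finally show ?thesis .
  qed
  also have "[conv G P a g + conv G P e g + int (Suc n) * conv G P e g + int (Suc n) * conv G Q e g
      = conv G P a g + conv G P e g + int (Suc n) * conv G P e g + int (Suc n) * 0] (mod int p)"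
    using Suc Q e by (intro cong_add cong_mult conv_c_invariant_eq_0 cong_refl) auto
  also have "conv G P a g + conv G P e g + int (Suc n) * conv G P e g + int (Suc n) * 0
      = conv_pow G a (Suc (Suc n)) g + int (Suc (Suc n)) * conv G P e g"
    by (simp add: P_def algebra_simps)
  finally show ?case
    unfolding P_def .
qed

text \<open>Words in central letters have central products, so there is nothing to count at a
  noncentral \<open>g\<close>; at a central \<open>g\<close> the excess vanishes for every
  \<open>a\<close>.\<close>

lemma excess_eq_0_of_central_support:
  assumes a: "\<And>g. g \<in> carrier G - center G \<Longrightarrow> a g = 0" and g: "g \<in> carrier G"
  shows "[excess G p a g = 0] (mod int p)"
proof (cases "g \<in> center G")
  case True
  then show ?thesis
    by (rule excess_center)
next
  case False
  have "prod_mset (image_mset a M) * arrangements G M g = 0" if M: "M \<in> nonconstant G p" for M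
  proof (cases "set_mset M \<subseteq> center G")
    case True
    have "list_prod G xs \<in> center G" if "set xs \<subseteq> center G" for xs
      using that
      by (induction xs) (auto intro: subgroup.one_closed[OF subgroup_center] subgroup.m_closed[OF subgroup_center])
    then have "list_prod G xs \<noteq> g" if "xs \<in> permutations_of_multiset M" for xs
      using that True False by (metis permutations_of_multisetD set_mset_mset)
    then show ?thesis
      by (simp add: arrangements_def)
  next
    case False
    then obtain x where "x \<in># M" "x \<in> carrier G - center G"
      using M by (auto simp: nonconstant_def)
    then have "0 \<in># image_mset a M"
      using a by force
    then show ?thesis
      using prod_mset_zero_iff by auto
  qed
  then have "excess G p a g = 0"
    unfolding excess_def by (intro sum.neutral) auto
  then show ?thesis
    by simp
qed

lemma pow_p_V_apply:
  assumes "u \<in> carrier V" "g \<in> carrier G"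
  shows "[(u [^]\<^bsub>V\<^esub> p) g = (\<Sum>x | x \<in> carrier G \<and> x [^] p = g. u x) + excess G p u g] (mod int p)"
  using pow_V_apply[OF assms] conv_pow_prime[OF assms(2)] cong_trans by blast

lemma pow_p_V_apply_center:
  assumes "u \<in> carrier V" "g \<in> center G"
  shows "[(u [^]\<^bsub>V\<^esub> p) g = (\<Sum>x | x \<in> carrier G \<and> x [^] p = g. u x)] (mod int p)"
  using cong_trans[OF pow_p_V_apply[OF assms(1) centerD(1)[OF assms(2)]]
      cong_add[OF cong_refl excess_center[OF assms(2)]]]
  by simp

text \<open>The \<open>p\<close>-th powers in \<open>G\<close> are central, so at a noncentral
  \<open>g\<close> only the excess is left, and that is invariant under \<open>c\<close>.\<close>

lemma pow_p_V_in_center: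
  assumes u: "u \<in> carrier V"
  shows "u [^]\<^bsub>V\<^esub> p \<in> center V"
proof -
  have up: "u [^]\<^bsub>V\<^esub> p \<in> carrier V"
    using u by simp
  have val: "[(u [^]\<^bsub>V\<^esub> p) g = excess G p u g] (mod int p)" if g: "g \<in> carrier G" "g \<notin> center G" for g
  proof -
    have "{x. x \<in> carrier G \<and> x [^] p = g} = {}"
      using pow_p_in_center g by auto
    from pow_p_V_apply[OF u g(1), unfolded this] show ?thesis
      by simp
  qed
  have "(u [^]\<^bsub>V\<^esub> p) (g \<otimes> c) = (u [^]\<^bsub>V\<^esub> p) g" if g: "g \<in> carrier G" "g \<notin> center G" for g
  proof (rule V_cong_eq[OF up])
    have "[(u [^]\<^bsub>V\<^esub> p) (g \<otimes> c) = excess G p u (g \<otimes> c)] (mod int p)"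
      using g by (intro val) (auto simp: mult_c_center_iff)
    also have "[excess G p u (g \<otimes> c) = excess G p u g] (mod int p)"
      using g by (intro excess_mult_c)
    also have "[excess G p u g = (u [^]\<^bsub>V\<^esub> p) g] (mod int p)"
      using g by (intro cong_sym[OF val])
    finally show "[(u [^]\<^bsub>V\<^esub> p) (g \<otimes> c) = (u [^]\<^bsub>V\<^esub> p) g] (mod int p)" .
  qed (use g in auto)
  then show ?thesis
    using center_V_iff[OF up] by blast
qed

lemma sum_noncentral:
  assumes u: "u \<in> center V" and P: "\<And>g. g \<in> carrier G \<Longrightarrow> P (g \<otimes> c) = P g"
  shows "[(\<Sum>x | x \<in> carrier G \<and> P x. u x) = (\<Sum>x | x \<in> center G \<and> P x. u x)] (mod int p)"
proof -
  have "{x. x \<in> carrier G \<and> P x}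
      = {x. x \<in> center G \<and> P x} \<union> {x. x \<in> carrier G - center G \<and> P x}"
    by (auto dest: centerD(1))
  moreover have "finite {x. x \<in> center G \<and> P x}" "finite {x. x \<in> carrier G - center G \<and> P x}"
    using fin centerD(1)[of _ G] by (auto intro: finite_subset[OF _ fin])
  ultimately have "(\<Sum>x | x \<in> carrier G \<and> P x. u x) = (\<Sum>x | x \<in> center G \<and> P x. u x)
      + (\<Sum>x | x \<in> carrier G - center G \<and> P x. u x)"
    by (subst sum.union_disjoint[symmetric]) auto
  moreover have "int p dvd (\<Sum>x | x \<in> carrier G - center G \<and> P x. u x)"
    using u center_V_iff[OF centerD(1)[OF u]] P
    by (intro dvd_sum_c_invariant) (auto simp: mult_c_center_iff)
  ultimately show ?thesis
    by (simp add: cong_iff_dvd_diff)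
qed

text \<open>A central unit is the sum of a part \<open>a\<close> on the centre of \<open>G\<close>
  and a part \<open>e\<close> invariant under \<open>c\<close>. The \<open>p\<close>-th power loses
  \<open>e\<close>, and \<open>a\<close> has no excess.\<close>

lemma pow_p_center_V_apply:
  assumes u: "u \<in> center V" and g: "g \<in> carrier G"
  shows "[(u [^]\<^bsub>V\<^esub> p) g = (\<Sum>z | z \<in> center G \<and> z [^] p = g. u z)] (mod int p)"
proof -
  define a where "a = (\<lambda>g. if g \<in> center G then u g else 0)"
  define e where "e = (\<lambda>g. if g \<in> center G then 0 else u g)"
  have uV: "u \<in> carrier V"
    using u by (rule centerD(1))
  have e: "e (g \<otimes> c) = e g" if "g \<in> carrier G" for g
    using u center_V_iff[OF uV] that by (simp add: e_def mult_c_center_iff)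
  have "[(u [^]\<^bsub>V\<^esub> p) g = conv_pow G u p g] (mod int p)"
    using uV g by (rule pow_V_apply)
  also have "conv_pow G u p g = conv_pow G (\<lambda>g. a g + e g) p g"
    by (rule arg_cong[of _ _ "\<lambda>u. conv_pow G u p g"]) (auto simp: a_def e_def)
  also have "[conv_pow G (\<lambda>g. a g + e g) p g
      = conv_pow G a p g + int p * conv G (conv_pow G a (p - 1)) e g] (mod int p)"
    using conv_pow_central_plus_invariant[of a e g "p - 1"] e g by (simp add: a_def)
  also have "[conv_pow G a p g + int p * conv G (conv_pow G a (p - 1)) e g = conv_pow G a p g] (mod int p)"
    by (simp add: cong_def)
  also have "[conv_pow G a p g = (\<Sum>x | x \<in> carrier G \<and> x [^] p = g. a x) + excess G p a g] (mod int p)"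
    using g by (rule conv_pow_prime)
  also have "[(\<Sum>x | x \<in> carrier G \<and> x [^] p = g. a x) + excess G p a g
      = (\<Sum>x | x \<in> carrier G \<and> x [^] p = g. a x) + 0] (mod int p)"
    using g by (intro cong_add cong_refl excess_eq_0_of_central_support) (simp_all add: a_def)
  also have "(\<Sum>x | x \<in> carrier G \<and> x [^] p = g. a x) + 0 = (\<Sum>z | z \<in> center G \<and> z [^] p = g. u z)"
    by (simp, rule sum.mono_neutral_cong_right) (use fin in \<open>auto simp: a_def dest: centerD(1)\<close>)
  finally show ?thesis .
qed

text \<open>The \<open>p\<close>-th powers of central units are central again, so the formula for
  \<open>p\<close> iterates. The induction cannot start at the exponent 1, where noncentral
  coefficients of \<open>u\<close> may be nonzero.\<close>

lemma pow_prime_power_center_V_apply: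
  assumes u: "u \<in> center V" and g: "g \<in> carrier G"
  shows "[(u [^]\<^bsub>V\<^esub> (p ^ Suc k)) g = (\<Sum>z | z \<in> center G \<and> z [^] (p ^ Suc k) = g. u z)] (mod int p)"
  using g
proof (induction k arbitrary: g)
  case 0
  then show ?case
    using pow_p_center_V_apply[OF u] by simp
next
  case (Suc k)
  let ?w = "u [^]\<^bsub>V\<^esub> (p ^ Suc k)"
  let ?Z = "\<lambda>g. {z. z \<in> center G \<and> z [^] p = g}"
  let ?Y = "\<lambda>z. {y. y \<in> center G \<and> y [^] (p ^ Suc k) = z}"
  have uV: "u \<in> carrier V"
    using u by (rule centerD(1))
  have w: "?w \<in> center V"
    using pow_p_V_in_center[of "u [^]\<^bsub>V\<^esub> (p ^ k)"] uV by (simp add: V.nat_pow_pow mult.commute)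
  have finZ: "finite (center G)"
    using fin by (rule finite_subset[rotated]) (auto dest: centerD(1))
  have pc: "y [^] (n::nat) \<in> center G" if "y \<in> center G" for y n
    using that by (induction n)
      (auto intro: subgroup.one_closed[OF subgroup_center] subgroup.m_closed[OF subgroup_center])
  have "(u [^]\<^bsub>V\<^esub> (p ^ Suc (Suc k))) g = (?w [^]\<^bsub>V\<^esub> p) g"
    using uV by (simp add: V.nat_pow_pow mult.commute)
  also have "[(?w [^]\<^bsub>V\<^esub> p) g = (\<Sum>z\<in>?Z g. ?w z)] (mod int p)"
    using w Suc.prems by (rule pow_p_center_V_apply)
  also have "[(\<Sum>z\<in>?Z g. ?w z) = (\<Sum>z\<in>?Z g. \<Sum>y\<in>?Y z. u y)] (mod int p)"
    by (intro cong_sum Suc.IH) (auto dest: centerD(1))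
  also have "(\<Sum>z\<in>?Z g. \<Sum>y\<in>?Y z. u y) = (\<Sum>y\<in>(\<Union>z\<in>?Z g. ?Y z). u y)"
    using finZ by (intro sum.UNION_disjoint[symmetric]) auto
  also have "(\<Union>z\<in>?Z g. ?Y z) = {z. z \<in> center G \<and> z [^] (p ^ Suc (Suc k)) = g}"
    using pc by (auto simp: nat_pow_pow mult.commute centerD(1))
  finally show ?case .
qed

text \<open>All central coefficients are collected at the neutral element. They sum to 1, because
  the noncentral coefficients are constant along cosets of <c> and contribute 0 modulo
  \<open>p\<close>.\<close>

lemma center_V_exponent:
  assumes exp: "\<And>z. z \<in> center G \<Longrightarrow> z [^] (p ^ Suc k) = \<one>" and u: "u \<in> center V"
  shows "u [^]\<^bsub>V\<^esub> (p ^ Suc k) = \<one>\<^bsub>V\<^esub>"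
proof (rule V_eqI)
  fix g assume g: "g \<in> carrier G"
  show "[(u [^]\<^bsub>V\<^esub> (p ^ Suc k)) g = \<one>\<^bsub>V\<^esub> g] (mod int p)"
  proof (cases "g = \<one>")
    case True
    have "[(u [^]\<^bsub>V\<^esub> (p ^ Suc k)) g = (\<Sum>z | z \<in> center G \<and> True. u z)] (mod int p)"
      using pow_prime_power_center_V_apply[OF u g, of k] exp True by (simp cong: conj_cong)
    also have "[(\<Sum>z | z \<in> center G \<and> True. u z) = (\<Sum>z | z \<in> carrier G \<and> True. u z)] (mod int p)"
      by (rule cong_sym[OF sum_noncentral[OF u]]) simp
    also have "[(\<Sum>z | z \<in> carrier G \<and> True. u z) = 1] (mod int p)"
      using sum_V[OF centerD(1)[OF u]] by simp
    finally show ?thesis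
      using True by (simp add: one_V point_def)
  next
    case False
    then have "{z. z \<in> center G \<and> z [^] (p ^ Suc k) = g} = {}"
      using exp by auto
    from pow_prime_power_center_V_apply[OF u g, of k, unfolded this] show ?thesis
      using False g by (simp add: one_V point_def)
  qed
qed (use centerD(1)[OF u] in auto)

text \<open>The first \<open>p\<close>-th power makes \<open>u\<close> central in \<open>V\<close>.
  From then on only its coefficients on the centre of \<open>G\<close> matter, and there the excess
  vanishes. This needs a second \<open>p\<close>-th power, hence the two successors.\<close>

lemma V_exponent:
  assumes exp: "\<And>x. x \<in> carrier G \<Longrightarrow> x [^] (p ^ Suc (Suc k)) = \<one>" and u: "u \<in> carrier V"
  shows "u [^]\<^bsub>V\<^esub> (p ^ Suc (Suc k)) = \<one>\<^bsub>V\<^esub>"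
proof (rule V_eqI)
  fix g assume g: "g \<in> carrier G"
  let ?v = "u [^]\<^bsub>V\<^esub> p"
  let ?Z = "{z. z \<in> center G \<and> z [^] (p ^ Suc k) = g}"
  let ?X = "\<lambda>z. {x. x \<in> carrier G \<and> x [^] p = z}"
  have finZ: "finite (center G)"
    using fin by (rule finite_subset[rotated]) (auto dest: centerD(1))
  have "(u [^]\<^bsub>V\<^esub> (p ^ Suc (Suc k))) g = (?v [^]\<^bsub>V\<^esub> (p ^ Suc k)) g"
    using u by (simp add: V.nat_pow_pow)
  also have "[(?v [^]\<^bsub>V\<^esub> (p ^ Suc k)) g = (\<Sum>z\<in>?Z. ?v z)] (mod int p)"
    using pow_p_V_in_center[OF u] g by (rule pow_prime_power_center_V_apply)
  also have "[(\<Sum>z\<in>?Z. ?v z) = (\<Sum>z\<in>?Z. \<Sum>x\<in>?X z. u x)] (mod int p)"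
    using u by (intro cong_sum pow_p_V_apply_center) auto
  also have "(\<Sum>z\<in>?Z. \<Sum>x\<in>?X z. u x) = (\<Sum>x\<in>(\<Union>z\<in>?Z. ?X z). u x)"
    using finZ fin by (intro sum.UNION_disjoint[symmetric]) auto
  also have "(\<Union>z\<in>?Z. ?X z) = {x. x \<in> carrier G \<and> x [^] (p ^ Suc (Suc k)) = g}"
    using pow_p_in_center by (auto simp: nat_pow_pow)
  also have "\<dots> = (if g = \<one> then carrier G else {})"
    using exp by auto
  also have "[(\<Sum>x\<in>(if g = \<one> then carrier G else {}). u x) = \<one>\<^bsub>V\<^esub> g] (mod int p)"
    using sum_V[OF u] g by (simp add: one_V point_def)
  finally show "[(u [^]\<^bsub>V\<^esub> (p ^ Suc (Suc k))) g = \<one>\<^bsub>V\<^esub> g] (mod int p)" .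
qed (use u in auto)

end

section \<open>Isomorphic unit groups and twisted groups\<close>

lemma iso_monoid_invariants:
  assumes M: "monoid M" and N: "monoid N" and "M \<cong> N"
  shows "card (carrier M) = card (carrier N)"
    and "card (center M) = card (center N)"
    and "card {x \<in> carrier M. x [^]\<^bsub>M\<^esub> (n::nat) = \<one>\<^bsub>M\<^esub>} = card {x \<in> carrier N. x [^]\<^bsub>N\<^esub> n = \<one>\<^bsub>N\<^esub>}"
    and "(\<forall>x\<in>center M. x [^]\<^bsub>M\<^esub> n = \<one>\<^bsub>M\<^esub>) \<longleftrightarrow> (\<forall>x\<in>center N. x [^]\<^bsub>N\<^esub> n = \<one>\<^bsub>N\<^esub>)"
proof -
  interpret M: monoid M by fact
  interpret N: monoid N by fact
  obtain f where f: "f \<in> iso M N"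
    using assms(3) by (auto simp: is_iso_def)
  then have hom: "f \<in> hom M N" and bij: "bij_betw f (carrier M) (carrier N)"
    by (auto simp: iso_def)
  have closed: "f x \<in> carrier N" if "x \<in> carrier M" for x
    using bij that by (auto simp: bij_betw_def)
  have mult: "f (x \<otimes>\<^bsub>M\<^esub> y) = f x \<otimes>\<^bsub>N\<^esub> f y" if "x \<in> carrier M" "y \<in> carrier M" for x y
    using hom that by (auto simp: hom_def)
  \<comment> \<open>Both structures are only given as monoids, so the image of the neutral element
    is identified through surjectivity instead of cancellation.\<close>
  have one: "f \<one>\<^bsub>M\<^esub> = \<one>\<^bsub>N\<^esub>"
  proof -
    obtain e where e: "e \<in> carrier M" "f e = \<one>\<^bsub>N\<^esub>"
      using bij N.one_closed unfolding bij_betw_def by (metis imageE)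
    have "f \<one>\<^bsub>M\<^esub> = f \<one>\<^bsub>M\<^esub> \<otimes>\<^bsub>N\<^esub> f e"
      using e closed by simp
    also have "\<dots> = f e"
      using e mult[of "\<one>\<^bsub>M\<^esub>" e] by simp
    finally show ?thesis
      using e by simp
  qed
  have pow: "f (x [^]\<^bsub>M\<^esub> k) = f x [^]\<^bsub>N\<^esub> k" if "x \<in> carrier M" for x and k :: nat
    using that by (induction k) (simp_all add: one mult)
  have inj: "f x = f y \<longleftrightarrow> x = y" if "x \<in> carrier M" "y \<in> carrier M" for x y
    using bij that by (auto simp: bij_betw_def inj_on_def)
  have pow_one: "f x [^]\<^bsub>N\<^esub> n = \<one>\<^bsub>N\<^esub> \<longleftrightarrow> x [^]\<^bsub>M\<^esub> n = \<one>\<^bsub>M\<^esub>" if "x \<in> carrier M" for x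
    using that inj[of "x [^]\<^bsub>M\<^esub> n" "\<one>\<^bsub>M\<^esub>"] by (simp add: pow one)
  have surj: "\<exists>x\<in>carrier M. y = f x" if "y \<in> carrier N" for y
    using bij that by (auto simp: bij_betw_def)
  have center: "f x \<in> center N \<longleftrightarrow> x \<in> center M" if x: "x \<in> carrier M" for x
  proof -
    have comm: "f x \<otimes>\<^bsub>N\<^esub> f y = f y \<otimes>\<^bsub>N\<^esub> f x \<longleftrightarrow> x \<otimes>\<^bsub>M\<^esub> y = y \<otimes>\<^bsub>M\<^esub> x" if "y \<in> carrier M" for y
      using that x inj[of "x \<otimes>\<^bsub>M\<^esub> y" "y \<otimes>\<^bsub>M\<^esub> x"] by (simp add: mult)
    have "f x \<in> center N \<longleftrightarrow> (\<forall>y\<in>carrier N. f x \<otimes>\<^bsub>N\<^esub> y = y \<otimes>\<^bsub>N\<^esub> f x)"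
      using x closed unfolding center_def by blast
    also have "\<dots> \<longleftrightarrow> (\<forall>y\<in>carrier M. f x \<otimes>\<^bsub>N\<^esub> f y = f y \<otimes>\<^bsub>N\<^esub> f x)"
      using surj closed by blast
    also have "\<dots> \<longleftrightarrow> x \<in> center M"
      using x comm unfolding center_def by blast
    finally show ?thesis .
  qed
  show "card (carrier M) = card (carrier N)"
    using bij by (rule bij_betw_same_card)
  have "bij_betw f (center M) (center N)"
    unfolding bij_betw_def
  proof
    show "inj_on f (center M)"
      using bij_betw_imp_inj_on[OF bij] by (rule inj_on_subset) (auto simp: center_def)
    show "f ` center M = center N"
    proof (intro equalityI subsetI)
      fix y assume y: "y \<in> center N"
      then obtain x where "x \<in> carrier M" "y = f x"
        using surj[OF centerD(1)[OF y]] by blast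
      then show "y \<in> f ` center M"
        using y center[of x] by simp
    next
      fix y assume "y \<in> f ` center M"
      then obtain x where "x \<in> center M" "y = f x"
        by auto
      then show "y \<in> center N"
        using center[OF centerD(1)] by simp
    qed
  qed
  then show "card (center M) = card (center N)"
    by (rule bij_betw_same_card)
  have "bij_betw f {x \<in> carrier M. x [^]\<^bsub>M\<^esub> n = \<one>\<^bsub>M\<^esub>} {x \<in> carrier N. x [^]\<^bsub>N\<^esub> n = \<one>\<^bsub>N\<^esub>}"
    unfolding bij_betw_def
  proof
    show "inj_on f {x \<in> carrier M. x [^]\<^bsub>M\<^esub> n = \<one>\<^bsub>M\<^esub>}"
      using bij_betw_imp_inj_on[OF bij] by (rule inj_on_subset) blast
    show "f ` {x \<in> carrier M. x [^]\<^bsub>M\<^esub> n = \<one>\<^bsub>M\<^esub>} = {x \<in> carrier N. x [^]\<^bsub>N\<^esub> n = \<one>\<^bsub>N\<^esub>}"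
      using pow_one surj closed by auto blast
  qed
  then show "card {x \<in> carrier M. x [^]\<^bsub>M\<^esub> n = \<one>\<^bsub>M\<^esub>} = card {x \<in> carrier N. x [^]\<^bsub>N\<^esub> n = \<one>\<^bsub>N\<^esub>}"
    by (rule bij_betw_same_card)
  have "center N = f ` center M"
    using \<open>bij_betw f (center M) (center N)\<close> by (simp add: bij_betw_def)
  then show "(\<forall>x\<in>center M. x [^]\<^bsub>M\<^esub> n = \<one>\<^bsub>M\<^esub>) \<longleftrightarrow> (\<forall>x\<in>center N. x [^]\<^bsub>N\<^esub> n = \<one>\<^bsub>N\<^esub>)"
    using pow_one by (auto dest: centerD(1))
qed

lemma unit_group_iso:
  assumes G: "finite_group_prime G p" and H: "finite_group_prime H p" and "G \<cong> H"
  shows "unit_group p G \<cong> unit_group p H"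
proof -
  interpret G: finite_group_prime G p by fact
  interpret H: finite_group_prime H p by fact
  have "H \<cong> G"
    using assms(3) G.iso_sym by blast
  then obtain f where f: "f \<in> iso H G"
    by (auto simp: is_iso_def)
  then have hom: "f \<in> hom H G" and bij: "bij_betw f (carrier H) (carrier G)"
    by (auto simp: iso_def)
  interpret f: group_hom H G f
    by (unfold_locales) (rule hom)
  define g where "g = inv_into (carrier H) f"
  have gf: "g (f h) = h" if "h \<in> carrier H" for h
    using bij that by (simp add: g_def bij_betw_def)
  have fg: "f (g x) = x" "g x \<in> carrier H" if "x \<in> carrier G" for x
    using bij that by (auto simp: g_def bij_betw_def f_inv_into_f inv_into_into)
  \<comment> \<open>Coefficient functions are pulled back, which is why the group isomorphism was
    taken from \<open>H\<close> to \<open>G\<close>.\<close>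
  define F where "F = (\<lambda>u. \<lambda>h\<in>carrier H. u (f h) :: int)"
  have sum_f: "(\<Sum>h\<in>carrier H. k (f h)) = (\<Sum>x\<in>carrier G. k x)" for k :: "'a \<Rightarrow> int"
    using bij by (rule sum.reindex_bij_betw)
  have F: "F u \<in> carrier H.V" if "u \<in> carrier G.V" for u
    using that sum_f[of u] unfolding G.carrier_V H.carrier_V F_def by (auto simp: PiE_iff)
  have "F \<in> iso G.V H.V"
  proof (rule isoI)
    show "F \<in> hom G.V H.V"
    proof (rule homI)
      fix u v assume u: "u \<in> carrier G.V" and v: "v \<in> carrier G.V"
      show "F (u \<otimes>\<^bsub>G.V\<^esub> v) = F u \<otimes>\<^bsub>H.V\<^esub> F v"
      proof (rule H.V_eqI)
        fix h assume h: "h \<in> carrier H"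
        have "conv H (F u) (F v) h = (\<Sum>k\<in>carrier H. u (f k) * v (inv\<^bsub>G\<^esub> f k \<otimes>\<^bsub>G\<^esub> f h))"
          unfolding conv_def F_def using h by (intro sum.cong) auto
        also have "\<dots> = conv G u v (f h)"
          unfolding conv_def by (rule sum_f)
        finally have "[(F u \<otimes>\<^bsub>H.V\<^esub> F v) h = conv G u v (f h)] (mod int p)"
          using H.mult_V_apply[OF F[OF u] F[OF v] h] by simp
        moreover have "[F (u \<otimes>\<^bsub>G.V\<^esub> v) h = conv G u v (f h)] (mod int p)"
          using G.mult_V_apply[OF u v, of "f h"] h by (simp add: F_def)
        ultimately show "[F (u \<otimes>\<^bsub>G.V\<^esub> v) h = (F u \<otimes>\<^bsub>H.V\<^esub> F v) h] (mod int p)"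
          using cong_sym cong_trans by blast
      qed (use u v F in \<open>auto simp: G.mult_V_closed H.mult_V_closed\<close>)
    qed (rule F)
    show "bij_betw F (carrier G.V) (carrier H.V)"
    proof (rule bij_betw_byWitness[where f' = "\<lambda>v. \<lambda>x\<in>carrier G. v (g x)"])
      show "\<forall>u\<in>carrier G.V. (\<lambda>x\<in>carrier G. F u (g x)) = u"
        using fg by (auto simp: G.carrier_V F_def PiE_iff extensional_def fun_eq_iff)
      show "\<forall>v\<in>carrier H.V. F (\<lambda>x\<in>carrier G. v (g x)) = v"
        using gf by (auto simp: H.carrier_V F_def PiE_iff extensional_def fun_eq_iff)
      show "F ` carrier G.V \<subseteq> carrier H.V"
        using F by blast
      show "(\<lambda>v. \<lambda>x\<in>carrier G. v (g x)) ` carrier H.V \<subseteq> carrier G.V"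
      proof clarify
        fix v assume v: "v \<in> carrier H.V"
        have "(\<Sum>x\<in>carrier G. v (g x)) = (\<Sum>h\<in>carrier H. v h)"
          using sum_f[of "\<lambda>x. v (g x)"] gf by simp
        then show "(\<lambda>x\<in>carrier G. v (g x)) \<in> carrier G.V"
          using v fg(2) unfolding G.carrier_V H.carrier_V by (auto simp: PiE_iff)
      qed
    qed
  qed
  then show ?thesis
    by (auto simp: is_iso_def)
qed

text \<open>Dividing every product by \<open>c\<close> whenever the exponents \<open>i\<close> in \<open>x\<^sup>p = c\<^sup>i\<close> produce a carry turns
  \<open>G\<close> into a group of exponent \<open>p\<close> with the same commutators.\<close>

locale twist = central_ext G p c for G :: "('a, 'm) monoid_scheme" (structure) and p c +
  assumes pow_p_c: "x \<in> carrier G \<Longrightarrow> \<exists>i::nat. x [^] p = c [^] i"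
begin

text \<open>The \<open>p\<close>-th power map read as a homomorphism to Z/p. The representative
  below \<open>p\<close> is part of the construction, since the carry in a sum of two values depends
  on it.\<close>

definition lam :: "'a \<Rightarrow> nat" where
  "lam x = (SOME i. i < p \<and> x [^] p = c [^] i)"

lemma lam: "x \<in> carrier G \<Longrightarrow> lam x < p \<and> x [^] p = c [^] lam x"
proof -
  assume "x \<in> carrier G"
  then obtain i :: nat where "x [^] p = c [^] i"
    using pow_p_c by blast
  then have "i mod p < p \<and> x [^] p = c [^] (i mod p)"
    by (simp add: c_pow_mod)
  then show ?thesis
    unfolding lam_def by (rule someI)
qed

lemma lam_eqI: "x \<in> carrier G \<Longrightarrow> x [^] p = c [^] (i::nat) \<Longrightarrow> lam x = i mod p"
  using lam[of x] c_pow_eq_iff[of "lam x" i] by simp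

lemma lam_c_pow [simp]: "lam (c [^] (i::nat)) = 0"
  using lam_eqI[of "c [^] i" 0] c_pow_eq_one_iff[of "i * p"] by (simp add: nat_pow_pow)

lemma lam_mult: "x \<in> carrier G \<Longrightarrow> y \<in> carrier G \<Longrightarrow> lam (x \<otimes> y) = (lam x + lam y) mod p"
  using lam[of x] lam[of y] by (intro lam_eqI) (simp_all add: mult_pow_p nat_pow_mult)

lemma lam_mult_c_pow: "x \<in> carrier G \<Longrightarrow> lam (x \<otimes> c [^] (i::nat)) = lam x"
  using lam[of x] by (simp add: lam_mult)

text \<open>The carry is the standard cocycle of the extension Z/p^2 of Z/p by Z/p, pulled back
  along \<open>lam\<close>. Multiplying by \<open>c [^] ((p - 1) * i)\<close> is dividing by
  \<open>c [^] i\<close>.\<close>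

definition K :: "'a monoid" where
  "K = \<lparr>carrier = carrier G,
    monoid.mult = \<lambda>x y. x \<otimes> y \<otimes> c [^] ((p - 1) * ((lam x + lam y) div p)), one = \<one>\<rparr>"

lemma carrier_K [simp]: "carrier K = carrier G" and one_K [simp]: "\<one>\<^bsub>K\<^esub> = \<one>"
  by (simp_all add: K_def)

lemma mult_K: "x \<otimes>\<^bsub>K\<^esub> y = x \<otimes> y \<otimes> c [^] ((p - 1) * ((lam x + lam y) div p))"
  by (simp add: K_def)

lemma lam_mult_K: "x \<in> carrier G \<Longrightarrow> y \<in> carrier G \<Longrightarrow> lam (x \<otimes>\<^bsub>K\<^esub> y) = (lam x + lam y) mod p"
  by (simp add: mult_K lam_mult_c_pow lam_mult)

lemma mult_K_closed: "x \<in> carrier G \<Longrightarrow> y \<in> carrier G \<Longrightarrow> x \<otimes>\<^bsub>K\<^esub> y \<in> carrier G"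
  by (simp add: mult_K)

lemma lam_one [simp]: "lam \<one> = 0"
  using lam_c_pow[of 0] by simp

text \<open>The cocycle identity behind associativity: the carries of two successive additions add
  up to the carry of the total.\<close>

lemma carry_assoc: "(a + b) div n + ((a + b) mod n + d) div n = (a + b + d) div n" for a b d n :: nat
proof (cases "n = 0")
  case False
  have "a + b + d = ((a + b) mod n + d) + n * ((a + b) div n)"
    by simp
  then show ?thesis
    using False by (metis div_mult_self2 add.commute)
qed simp

lemma group_K: "group K"
proof (rule groupI)
  fix x y z assume xyz: "x \<in> carrier K" "y \<in> carrier K" "z \<in> carrier K"
  have "x \<otimes>\<^bsub>K\<^esub> y \<otimes>\<^bsub>K\<^esub> z = x \<otimes> y \<otimes> (c [^] ((p - 1) * ((lam x + lam y) div p)) \<otimes> z)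
      \<otimes> c [^] ((p - 1) * (((lam x + lam y) mod p + lam z) div p))"
    using xyz by (simp add: mult_K[of "x \<otimes>\<^bsub>K\<^esub> y"] mult_K_closed lam_mult_K)
      (simp add: mult_K m_assoc)
  also have "\<dots> = x \<otimes> y \<otimes> z \<otimes> (c [^] ((p - 1) * ((lam x + lam y) div p))
      \<otimes> c [^] ((p - 1) * (((lam x + lam y) mod p + lam z) div p)))"
    using xyz c_pow_central[of z] by (simp add: m_assoc)
  also have "\<dots> = x \<otimes> y \<otimes> z \<otimes> c [^] ((p - 1) * ((lam x + lam y + lam z) div p))"
    by (simp add: nat_pow_mult carry_assoc flip: distrib_left)
  finally have 1: "x \<otimes>\<^bsub>K\<^esub> y \<otimes>\<^bsub>K\<^esub> z = x \<otimes> y \<otimes> z \<otimes> c [^] ((p - 1) * ((lam x + lam y + lam z) div p))" .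
  have "x \<otimes>\<^bsub>K\<^esub> (y \<otimes>\<^bsub>K\<^esub> z) = x \<otimes> y \<otimes> z \<otimes> (c [^] ((p - 1) * ((lam y + lam z) div p))
      \<otimes> c [^] ((p - 1) * (((lam y + lam z) mod p + lam x) div p)))"
    using xyz by (simp add: mult_K[of x] mult_K_closed lam_mult_K add.commute)
      (simp add: mult_K m_assoc add.commute)
  also have "\<dots> = x \<otimes> y \<otimes> z \<otimes> c [^] ((p - 1) * ((lam y + lam z + lam x) div p))"
    by (simp add: nat_pow_mult carry_assoc flip: distrib_left)
  finally show "x \<otimes>\<^bsub>K\<^esub> y \<otimes>\<^bsub>K\<^esub> z = x \<otimes>\<^bsub>K\<^esub> (y \<otimes>\<^bsub>K\<^esub> z)"
    unfolding 1 by (simp add: add_ac)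
next
  fix x assume x: "x \<in> carrier K"
  then have "lam x < p"
    using lam by simp
  then show "\<one>\<^bsub>K\<^esub> \<otimes>\<^bsub>K\<^esub> x = x"
    using x by (simp add: mult_K)
  \<comment> \<open>With respect to the new multiplication \<open>inv x\<close> misses the neutral
    element by \<open>c [^] e\<close>. The further exponent (p - 1) * e completes this to p *
    e.\<close>
  define e where "e = (p - 1) * ((lam (inv x) + lam x) div p)"
  have "inv x \<otimes> c [^] ((p - 1) * e) \<otimes>\<^bsub>K\<^esub> x = inv x \<otimes> (c [^] ((p - 1) * e) \<otimes> x) \<otimes> c [^] e"
    using x by (simp add: mult_K lam_mult_c_pow e_def m_assoc)
  also have "\<dots> = inv x \<otimes> x \<otimes> (c [^] ((p - 1) * e) \<otimes> c [^] e)"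
    using x c_pow_central[of x] by (simp add: m_assoc)
  also have "\<dots> = c [^] (p * e)"
  proof -
    have "(p - 1) * e + e = p * e"
      using p_pos by (cases p) auto
    then show ?thesis
      using x by (simp add: nat_pow_mult)
  qed
  also have "\<dots> = \<one>"
    by (simp add: c_pow_eq_one_iff)
  finally show "\<exists>y\<in>carrier K. y \<otimes>\<^bsub>K\<^esub> x = \<one>\<^bsub>K\<^esub>"
    using x by (intro bexI[of _ "inv x \<otimes> c [^] ((p - 1) * e)"]) auto
qed (auto simp: mult_K_closed)

sublocale K: group K
  by (rule group_K)

lemma c_pow_K: "c [^]\<^bsub>K\<^esub> (i::nat) = c [^] i"
proof (induction i)
  case (Suc i)
  then show ?case
    using lam_c_pow[of i] lam_c_pow[of 1] p_pos by (simp add: mult_K)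
qed simp

lemma mult_K_c_pow: "x \<in> carrier G \<Longrightarrow> x \<otimes>\<^bsub>K\<^esub> c [^] (i::nat) = x \<otimes> c [^] i"
  using lam[of x] by (simp add: mult_K)

text \<open>The cocycle is symmetric, so the twist changes neither commutators nor the
  centre.\<close>

lemma mult_K_commute_iff:
  assumes "x \<in> carrier G" "y \<in> carrier G"
  shows "x \<otimes>\<^bsub>K\<^esub> y = y \<otimes>\<^bsub>K\<^esub> x \<longleftrightarrow> x \<otimes> y = y \<otimes> x"
  using assms by (simp add: mult_K add.commute[of "lam y"])

lemma center_K: "center K = center G"
  using mult_K_commute_iff by (auto simp: center_def)

lemma central_ext_K: "central_ext K p c"
proof
  show "c [^]\<^bsub>K\<^esub> p = \<one>\<^bsub>K\<^esub>"
    by (simp add: c_pow_K c_pow_p)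
  fix x assume x: "x \<in> carrier K"
  then show "c \<otimes>\<^bsub>K\<^esub> x = x \<otimes>\<^bsub>K\<^esub> c"
    by (simp add: mult_K_commute_iff c_central)
  fix y assume y: "y \<in> carrier K"
  obtain i :: nat where i: "y \<otimes> x = x \<otimes> y \<otimes> c [^] i"
    using commute_ex x y by auto
  let ?e = "(p - 1) * ((lam x + lam y) div p)"
  have "y \<otimes>\<^bsub>K\<^esub> x = x \<otimes> y \<otimes> (c [^] i \<otimes> c [^] ?e)"
    unfolding mult_K i using x y by (simp add: m_assoc add.commute)
  also have "\<dots> = x \<otimes>\<^bsub>K\<^esub> y \<otimes> c [^] i"
    using x y by (simp add: mult_K m_assoc nat_pow_mult add.commute)
  also have "\<dots> = x \<otimes>\<^bsub>K\<^esub> y \<otimes>\<^bsub>K\<^esub> c [^]\<^bsub>K\<^esub> i"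
    using x y by (simp add: c_pow_K mult_K_c_pow mult_K_closed)
  finally show "\<exists>i::nat. y \<otimes>\<^bsub>K\<^esub> x = x \<otimes>\<^bsub>K\<^esub> y \<otimes>\<^bsub>K\<^esub> c [^]\<^bsub>K\<^esub> i"
    by blast
qed (use prime p_gt_2 fin c_ne in auto)

sublocale K: central_ext K p c
  by (rule central_ext_K)

text \<open>The total carry of a word depends on the sum of the values of \<open>lam\<close> and not
  on the order of the letters. This makes the twist compatible with sums over arrangements.\<close>

lemma list_prod_K:
  assumes "set xs \<subseteq> carrier G"
  shows "list_prod K xs = list_prod G xs \<otimes> c [^] ((p - 1) * (sum_list (map lam xs) div p))
    \<and> lam (list_prod K xs) = sum_list (map lam xs) mod p"
  using assms
proof (induction xs)
  case (Cons x xs)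
  define s where "s = sum_list (map lam xs)"
  define L where "L = list_prod G xs"
  have x: "x \<in> carrier G" and L: "L \<in> carrier G"
    using Cons by (auto simp: L_def)
  have IH: "list_prod K xs = L \<otimes> c [^] ((p - 1) * (s div p))" "lam (list_prod K xs) = s mod p"
    using Cons.IH Cons.prems unfolding s_def L_def by auto
  have K: "list_prod K xs \<in> carrier G"
    using K.list_prod_closed[of xs] Cons.prems by simp
  have "list_prod K (x # xs) = x \<otimes> (L \<otimes> c [^] ((p - 1) * (s div p))) \<otimes> c [^] ((p - 1) * ((lam x + s mod p) div p))"
    by (simp add: mult_K IH(2)) (simp add: IH(1))
  also have "\<dots> = x \<otimes> L \<otimes> c [^] ((p - 1) * (s div p + (lam x + s mod p) div p))"
    using x L by (simp add: m_assoc nat_pow_mult distrib_left)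
  also have "s div p + (lam x + s mod p) div p = (lam x + s) div p"
    using carry_assoc[of 0 s p "lam x"] by (simp add: add.commute)
  finally have "list_prod K (x # xs) = x \<otimes> L \<otimes> c [^] ((p - 1) * ((lam x + s) div p))" .
  moreover have "lam (list_prod K (x # xs)) = (lam x + s) mod p"
    using x K by (simp add: lam_mult_K IH(2) mod_add_right_eq)
  ultimately show ?case
    by (simp add: s_def L_def)
qed simp

text \<open>Adding up \<open>p\<close> copies of \<open>lam x\<close> produces \<open>lam x\<close>
  carries in total, just enough to cancel \<open>c [^] lam x\<close>.\<close>

lemma pow_K:
  assumes "x \<in> carrier G"
  shows "x [^]\<^bsub>K\<^esub> p = \<one>"
proof -
  have "x [^]\<^bsub>K\<^esub> p = list_prod K (replicate p x)"
    using assms by (simp add: K.list_prod_replicate)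
  also have "\<dots> = x [^] p \<otimes> c [^] ((p - 1) * (p * lam x div p))"
    using assms list_prod_K[of "replicate p x"] list_prod_replicate[of x p]
    by (simp add: sum_list_replicate set_replicate_conv_if)
  also have "\<dots> = c [^] (lam x + (p - 1) * lam x)"
    using lam[OF assms] by (simp add: nat_pow_mult)
  also have "lam x + (p - 1) * lam x = p * lam x"
    using p_pos by (cases p) auto
  finally show ?thesis
    by (simp add: c_pow_eq_one_iff)
qed

text \<open>All arrangements of \<open>M\<close> have the same total carry \<open>k\<close>, so the
  twisted count at \<open>g\<close> is the original count at \<open>g \<otimes> c [^] k\<close>, and
  modulo \<open>p\<close> such a shift does not matter.\<close>

lemma arrangements_K:
  assumes M: "M \<in> nonconstant G p" and g: "g \<in> carrier G"
  shows "[arrangements K M g = arrangements G M g] (mod int p)"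
proof -
  define k where "k = sum_mset (image_mset lam M) div p"
  have "arrangements K M g = arrangements G M (g \<otimes> c [^] k)"
    unfolding arrangements_def
  proof (rule sum.cong[OF refl])
    fix xs assume xs: "xs \<in> permutations_of_multiset M"
    then have "set_mset (mset xs) \<subseteq> carrier G"
      using M permutations_of_multisetD by (fastforce simp: nonconstant_def)
    then have sub: "set xs \<subseteq> carrier G"
      by simp
    then have L: "list_prod G xs \<in> carrier G"
      by blast
    have "sum_list (map lam xs) = sum_mset (image_mset lam M)"
      using xs by (metis mset_map permutations_of_multisetD sum_mset_sum_list)
    then have eq: "list_prod K xs = list_prod G xs \<otimes> c [^] ((p - 1) * k)"
      using list_prod_K[OF sub] by (simp add: k_def)
    have "(p - 1) * k + k = p * k" "k + (p - 1) * k = p * k"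
      using p_pos by (cases p; simp)+
    then have one: "c [^] ((p - 1) * k) \<otimes> c [^] k = \<one>" "c [^] k \<otimes> c [^] ((p - 1) * k) = \<one>"
      by (simp_all only: nat_pow_mult c_pow_eq_one_iff c_in dvd_triv_left)
    have "list_prod K xs = g \<longleftrightarrow> list_prod G xs = g \<otimes> c [^] k"
    proof
      assume h: "list_prod K xs = g"
      have "g \<otimes> c [^] k = list_prod G xs \<otimes> (c [^] ((p - 1) * k) \<otimes> c [^] k)"
        unfolding h[symmetric] eq using L by (simp add: m_assoc)
      from this[unfolded one] show "list_prod G xs = g \<otimes> c [^] k"
        using L by simp
    next
      assume "list_prod G xs = g \<otimes> c [^] k"
      then have "list_prod K xs = g \<otimes> (c [^] k \<otimes> c [^] ((p - 1) * k))"
        using g by (simp add: eq m_assoc)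
      from this[unfolded one] show "list_prod K xs = g"
        using g by simp
    qed
    then show "(of_bool (list_prod K xs = g) :: int) = of_bool (list_prod G xs = g \<otimes> c [^] k)"
      by simp
  qed
  also have "[arrangements G M (g \<otimes> c [^] k) = arrangements G M g] (mod int p)" for k :: nat
  proof (induction k)
    case (Suc k)
    obtain x where "x \<in># M" "count M x < p" "set_mset M \<subseteq> carrier G" "size M = p"
      using M by (rule nonconstant_ex)
    then have "[arrangements G M (g \<otimes> c [^] k \<otimes> c) = arrangements G M (g \<otimes> c [^] k)] (mod int p)"
      using arrangements_mult_c(1)[of M x "g \<otimes> c [^] k"] g by (simp add: cong_iff_dvd_diff)
    then show ?case
      using cong_trans Suc g by (simp add: m_assoc) blast
  qed (use g in simp)
  finally show ?thesis .
qed

lemma excess_K: "g \<in> carrier G \<Longrightarrow> [excess K p u g = excess G p u g] (mod int p)"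
  unfolding excess_def nonconstant_def[of K] carrier_K nonconstant_def[symmetric]
  by (intro cong_sum cong_mult cong_refl arrangements_K)

lemma carrier_V_K: "carrier K.V = carrier V"
  by (simp add: carrier_V K.carrier_V)

lemma one_V_K: "\<one>\<^bsub>K.V\<^esub> = \<one>\<^bsub>V\<^esub>"
  by (simp add: one_V K.one_V point_def)

text \<open>Off the centre the coefficients of the \<open>p\<close>-th power are the excess, so the
  excess vanishes everywhere when this power is 1. In the twisted group the excess is the same, and
  all coefficients of \<open>u\<close> are collected at the neutral element, where they sum to
  1.\<close>

lemma pow_p_K_eq_one:
  assumes u: "u \<in> carrier V" and one: "u [^]\<^bsub>V\<^esub> p = \<one>\<^bsub>V\<^esub>"
  shows "u [^]\<^bsub>K.V\<^esub> p = \<one>\<^bsub>K.V\<^esub>"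
proof (rule K.V_eqI)
  have uK: "u \<in> carrier K.V"
    using u by (simp add: carrier_V_K)
  then show "u [^]\<^bsub>K.V\<^esub> p \<in> carrier K.V"
    by simp
  fix g assume g: "g \<in> carrier K"
  then have g': "g \<in> carrier G"
    by simp
  have excess: "[excess G p u g = 0] (mod int p)"
  proof (cases "g \<in> center G")
    case False
    then have "{x. x \<in> carrier G \<and> x [^] p = g} = {}"
      using pow_p_in_center by auto
    from pow_p_V_apply[OF u g', unfolded this one]
    have "[\<one>\<^bsub>V\<^esub> g = excess G p u g] (mod int p)"
      by simp
    moreover have "g \<noteq> \<one>"
      using False subgroup.one_closed[OF subgroup_center] by blast
    ultimately show ?thesis
      using g' by (simp add: one_V point_def cong_sym)
  qed (rule excess_center)
  have "[(u [^]\<^bsub>K.V\<^esub> p) g = (\<Sum>x | x \<in> carrier K \<and> x [^]\<^bsub>K\<^esub> p = g. u x) + excess K p u g] (mod int p)"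
    using uK g by (rule K.pow_p_V_apply)
  also have "{x. x \<in> carrier K \<and> x [^]\<^bsub>K\<^esub> p = g} = (if g = \<one> then carrier G else {})"
    by (auto simp: pow_K)
  also have "[(\<Sum>x\<in>(if g = \<one> then carrier G else {}). u x) + excess K p u g = \<one>\<^bsub>K.V\<^esub> g + 0] (mod int p)"
    using sum_V[OF u] g' cong_trans[OF excess_K excess]
    by (intro cong_add) (auto simp: one_V_K one_V point_def)
  finally show "[(u [^]\<^bsub>K.V\<^esub> p) g = \<one>\<^bsub>K.V\<^esub> g] (mod int p)"
    by simp
qed simp

text \<open>Solutions over \<open>G\<close> remain solutions over \<open>K\<close>, and the group
  element \<open>x\<close> itself is a new one.\<close>

lemma card_pow_p_less:
  assumes x: "x \<in> carrier G" "x [^] p \<noteq> \<one>"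
  shows "card {u \<in> carrier V. u [^]\<^bsub>V\<^esub> p = \<one>\<^bsub>V\<^esub>} < card {u \<in> carrier K.V. u [^]\<^bsub>K.V\<^esub> p = \<one>\<^bsub>K.V\<^esub>}"
proof (rule psubset_card_mono)
  have "point G x = point K x"
    by (simp add: point_def)
  moreover have "point K x [^]\<^bsub>K.V\<^esub> p = \<one>\<^bsub>K.V\<^esub>"
    using x by (simp add: K.pow_point pow_K K.one_V)
  moreover have "point G x [^]\<^bsub>V\<^esub> p \<noteq> \<one>\<^bsub>V\<^esub>"
    using x point_inj[of "x [^] p" \<one>] by (auto simp: pow_point one_V)
  ultimately have "point G x \<in> {u \<in> carrier K.V. u [^]\<^bsub>K.V\<^esub> p = \<one>\<^bsub>K.V\<^esub>}"
    "point G x \<notin> {u \<in> carrier V. u [^]\<^bsub>V\<^esub> p = \<one>\<^bsub>V\<^esub>}"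
    using point_in_V[OF x(1)] by (auto simp: carrier_V_K)
  then show "{u \<in> carrier V. u [^]\<^bsub>V\<^esub> p = \<one>\<^bsub>V\<^esub>} \<subset> {u \<in> carrier K.V. u [^]\<^bsub>K.V\<^esub> p = \<one>\<^bsub>K.V\<^esub>}"
    using pow_p_K_eq_one by (auto simp: carrier_V_K)
qed (use K.finite_V in simp)

end

section \<open>Extension of partial isomorphisms\<close>

text \<open>If \<open>g\<close> normalizes \<open>S\<close> in a finite group, this is the subgroup
  generated by \<open>S\<close> and \<open>g\<close>; natural exponents suffice there.\<close>

definition adjoin :: "('a, 'm) monoid_scheme \<Rightarrow> 'a set \<Rightarrow> 'a \<Rightarrow> 'a set" where
  "adjoin G S g = {g [^]\<^bsub>G\<^esub> i \<otimes>\<^bsub>G\<^esub> s | (i::nat) s. s \<in> S}"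

lemma adjoinI: "s \<in> S \<Longrightarrow> g [^]\<^bsub>G\<^esub> (i::nat) \<otimes>\<^bsub>G\<^esub> s \<in> adjoin G S g"
  by (auto simp: adjoin_def)

lemma adjoinE:
  assumes "x \<in> adjoin G S g"
  obtains i :: nat and s where "s \<in> S" "x = g [^]\<^bsub>G\<^esub> i \<otimes>\<^bsub>G\<^esub> s"
  using assms by (auto simp: adjoin_def)

context group
begin

lemma finite_subgroupI:
  assumes fin: "finite (carrier G)" and S: "S \<subseteq> carrier G" "S \<noteq> {}"
    and closed: "\<And>x y. x \<in> S \<Longrightarrow> y \<in> S \<Longrightarrow> x \<otimes> y \<in> S"
  shows "subgroup S G"
proof -
  have pow: "x [^] Suc n \<in> S" if "x \<in> S" for x n
    using that closed S by (induction n) (auto simp: subset_iff)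
  have ord: "order G > 0"
    using fin by (simp add: order_gt_0_iff_finite)
  have one: "\<one> \<in> S"
  proof -
    obtain x where x: "x \<in> S"
      using S by blast
    then have "x [^] order G = \<one>"
      using S pow_order_eq_1 by blast
    then show ?thesis
      using pow[OF x, of "order G - 1"] ord by simp
  qed
  show ?thesis
  proof (rule subgroupI)
    fix x assume x: "x \<in> S"
    then have xG: "x \<in> carrier G"
      using S by blast
    have "x [^] (order G - 1) \<otimes> x = x [^] Suc (order G - 1)"
      by simp
    also have "\<dots> = \<one>"
      using ord pow_order_eq_1[OF xG] by simp
    finally have "inv x = x [^] (order G - 1)"
      using xG by (intro inv_equality) auto
    moreover have "x [^] (order G - 1) \<in> S"
      using pow[OF x] one by (cases "order G - 1") simp_all
    ultimately show "inv x \<in> S"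
      by simp
  qed (use S closed in auto)
qed

lemma subgroup_pow_closed: "subgroup S G \<Longrightarrow> x \<in> S \<Longrightarrow> x [^] (n::nat) \<in> S"
  by (induction n) (auto intro: subgroup.one_closed subgroup.m_closed)

lemma conj_pow_ex:
  assumes S: "S \<subseteq> carrier G" and g: "g \<in> carrier G"
    and norm: "\<And>s. s \<in> S \<Longrightarrow> \<exists>s'\<in>S. s \<otimes> g = g \<otimes> s'" and s: "s \<in> S"
  shows "\<exists>s'\<in>S. s \<otimes> g [^] (j::nat) = g [^] j \<otimes> s'"
proof (induction j)
  case 0
  then show ?case
    using s S by (intro bexI[of _ s]) auto
next
  case (Suc j)
  then obtain s' where s': "s' \<in> S" "s \<otimes> g [^] j = g [^] j \<otimes> s'"
    by blast
  then obtain s'' where s'': "s'' \<in> S" "s' \<otimes> g = g \<otimes> s''"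
    using norm by blast
  have "s \<otimes> g [^] Suc j = g [^] j \<otimes> (s' \<otimes> g)"
    using s s' S g by (simp add: subset_iff flip: m_assoc)
  also have "\<dots> = g [^] Suc j \<otimes> s''"
    using s'' S g by (simp add: subset_iff m_assoc)
  finally show ?case
    using s'' by blast
qed

lemma subgroup_adjoin:
  assumes fin: "finite (carrier G)" and S: "subgroup S G" and g: "g \<in> carrier G"
    and norm: "\<And>s. s \<in> S \<Longrightarrow> \<exists>s'\<in>S. s \<otimes> g = g \<otimes> s'"
  shows "subgroup (adjoin G S g) G"
proof (rule finite_subgroupI[OF fin])
  have sub: "S \<subseteq> carrier G"
    using S by (rule subgroup.subset)
  then show "adjoin G S g \<subseteq> carrier G"
    using g by (auto simp: adjoin_def)
  show "adjoin G S g \<noteq> {}"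
    using subgroup.one_closed[OF S] adjoinI by fast
  fix x y assume "x \<in> adjoin G S g" "y \<in> adjoin G S g"
  then obtain i j :: nat and s t where s: "s \<in> S" "x = g [^] i \<otimes> s" and t: "t \<in> S" "y = g [^] j \<otimes> t"
    by (auto elim!: adjoinE)
  obtain s' where s': "s' \<in> S" "s \<otimes> g [^] j = g [^] j \<otimes> s'"
    using conj_pow_ex[OF sub g norm s(1)] by blast
  have G: "s \<in> carrier G" "t \<in> carrier G" "s' \<in> carrier G"
    using s t s' sub by auto
  have "x \<otimes> y = g [^] i \<otimes> (s \<otimes> g [^] j) \<otimes> t"
    using G g by (simp add: s t m_assoc)
  also have "\<dots> = g [^] (i + j) \<otimes> (s' \<otimes> t)"
    unfolding s' using G g by (simp add: m_assoc flip: nat_pow_mult)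
  finally show "x \<otimes> y \<in> adjoin G S g"
    using adjoinI[of "s' \<otimes> t" S] subgroup.m_closed[OF S s'(1) t(1)] by simp
qed

lemma subset_adjoin: "S \<subseteq> carrier G \<Longrightarrow> S \<subseteq> adjoin G S g"
  using adjoinI[of _ S G g 0] by (auto simp: subset_iff)

lemma mem_adjoin: "subgroup S G \<Longrightarrow> g \<in> carrier G \<Longrightarrow> g \<in> adjoin G S g"
  using adjoinI[of \<one> S G g 1] by (auto dest: subgroup.one_closed)

lemma adjoin_subset: "subgroup T G \<Longrightarrow> S \<subseteq> T \<Longrightarrow> g \<in> T \<Longrightarrow> adjoin G S g \<subseteq> T"
  using subgroup_pow_closed by (auto simp: adjoin_def intro!: subgroup.m_closed)

lemma dvd_of_pow_mem:
  assumes S: "subgroup S G" and g: "g \<in> carrier G" and n: "n > 0" "g [^] n \<in> S"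
    and min: "\<And>i::nat. 0 < i \<Longrightarrow> i < n \<Longrightarrow> g [^] i \<notin> S" and d: "g [^] (d::nat) \<in> S"
  shows "n dvd d"
proof -
  have "g [^] d = (g [^] n) [^] (d div n) \<otimes> g [^] (d mod n)"
    using g by (simp add: nat_pow_pow nat_pow_mult)
  then have "g [^] (d mod n) = inv ((g [^] n) [^] (d div n)) \<otimes> g [^] d"
    using g by simp
  also have "\<dots> \<in> S"
    using S d by (intro subgroup.m_closed subgroup.m_inv_closed subgroup_pow_closed[OF S n(2)])
  finally have "d mod n = 0"
    using min[of "d mod n"] n by fastforce
  then show ?thesis
    by blast
qed

text \<open>\<open>n\<close> is the order of \<open>g\<close> modulo \<open>S\<close>, so each
  element is \<open>g [^] i \<otimes> s\<close> with a unique \<open>i\<close> below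
  \<open>n\<close> and a unique \<open>s\<close>.\<close>

lemma card_adjoin:
  assumes S: "subgroup S G" and g: "g \<in> carrier G" and n: "n > 0" "g [^] n \<in> S"
    and min: "\<And>i::nat. 0 < i \<Longrightarrow> i < n \<Longrightarrow> g [^] i \<notin> S"
  shows "card (adjoin G S g) = n * card S"
proof -
  let ?f = "\<lambda>(i, s). g [^] (i::nat) \<otimes> s"
  have sub: "\<And>s. s \<in> S \<Longrightarrow> s \<in> carrier G"
    using subgroup.subset[OF S] by blast
  have le: "i = j" if "i \<le> j" "j < n" "s \<in> S" "t \<in> S" "g [^] i \<otimes> s = g [^] j \<otimes> t" for i j :: nat and s t
  proof (rule ccontr)
    assume "i \<noteq> j"
    have "g [^] j = g [^] i \<otimes> g [^] (j - i)"
      using that g by (simp add: nat_pow_mult)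
    then have "g [^] i \<otimes> s = g [^] i \<otimes> (g [^] (j - i) \<otimes> t)"
      using that g sub by (simp add: m_assoc)
    then have "s = g [^] (j - i) \<otimes> t"
      using that g sub by simp
    then have "g [^] (j - i) = s \<otimes> inv t"
      using that g sub by (simp add: m_assoc)
    then have "g [^] (j - i) \<in> S"
      using that S by (simp add: subgroup.m_closed subgroup.m_inv_closed)
    then show False
      using min[of "j - i"] that \<open>i \<noteq> j\<close> by simp
  qed
  have "inj_on ?f ({..<n} \<times> S)"
  proof (rule inj_onI, clarify)
    fix i s j t assume *: "i < n" "s \<in> S" "j < n" "t \<in> S" "g [^] i \<otimes> s = g [^] j \<otimes> t"
    then have "i = j"
      using le[of i j s t] le[of j i t s] by (metis nat_le_linear)
    then show "i = j \<and> s = t"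
      using * g sub by simp
  qed
  moreover have "?f ` ({..<n} \<times> S) = adjoin G S g"
  proof (intro equalityI subsetI)
    fix x assume "x \<in> adjoin G S g"
    then obtain i :: nat and s where s: "s \<in> S" "x = g [^] i \<otimes> s"
      by (rule adjoinE)
    have "g [^] i = g [^] (i mod n) \<otimes> (g [^] n) [^] (i div n)"
      using g by (simp add: nat_pow_pow nat_pow_mult)
    then have "x = g [^] (i mod n) \<otimes> ((g [^] n) [^] (i div n) \<otimes> s)"
      using g s sub by (simp add: m_assoc)
    moreover have "(g [^] n) [^] (i div n) \<otimes> s \<in> S"
      using S s by (intro subgroup.m_closed subgroup_pow_closed[OF S n(2)])
    ultimately show "x \<in> ?f ` ({..<n} \<times> S)"
      using n by (intro image_eqI[of _ _ "(i mod n, (g [^] n) [^] (i div n) \<otimes> s)"]) auto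
  qed (auto intro: adjoinI)
  ultimately have "card (adjoin G S g) = card ({..<n} \<times> S)"
    by (metis card_image)
  then show ?thesis
    by (simp add: card_cartesian_product)
qed

text \<open>By Bezout, \<open>x\<close> is a quotient of a power of \<open>x [^] i\<close> by a
  power of \<open>x [^] n\<close>.\<close>

lemma mem_of_coprime_pow_mem:
  assumes S: "subgroup S G" and x: "x \<in> carrier G" "x [^] (n::nat) \<in> S" "x [^] (i::nat) \<in> S"
    and "coprime i n"
  shows "x \<in> S"
proof (cases "i = 0")
  case True
  then show ?thesis
    using assms by simp
next
  case False
  obtain a b where ab: "i * a = n * b + 1"
    using bezout_nat[of i n] False assms by auto
  have "(x [^] i) [^] a = (x [^] n) [^] b \<otimes> x"
    using x ab by (simp add: nat_pow_pow nat_pow_mult)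
  then have "x = inv ((x [^] n) [^] b) \<otimes> (x [^] i) [^] a"
    using x by simp
  also have "\<dots> \<in> S"
    using S
    by (intro subgroup.m_closed subgroup.m_inv_closed subgroup_pow_closed[OF S x(2)] subgroup_pow_closed[OF S x(3)])
  finally show ?thesis .
qed

end

definition partial_iso ::
  "('a, 'm) monoid_scheme \<Rightarrow> ('b, 'n) monoid_scheme \<Rightarrow> 'a set \<Rightarrow> 'b set \<Rightarrow> ('a \<Rightarrow> 'b) \<Rightarrow> bool" where
  "partial_iso G H S T f \<longleftrightarrow> subgroup S G \<and> subgroup T H \<and> bij_betw f S T \<and>
     (\<forall>x\<in>S. \<forall>y\<in>S. f (x \<otimes>\<^bsub>G\<^esub> y) = f x \<otimes>\<^bsub>H\<^esub> f y)"

locale group_pair = G: group G + H: group H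
  for G :: "('a, 'm) monoid_scheme" and H :: "('b, 'n) monoid_scheme"
begin

lemma partial_isoD:
  assumes "partial_iso G H S T f"
  shows "subgroup S G" "subgroup T H" "bij_betw f S T"
    "x \<in> S \<Longrightarrow> y \<in> S \<Longrightarrow> f (x \<otimes>\<^bsub>G\<^esub> y) = f x \<otimes>\<^bsub>H\<^esub> f y"
    "x \<in> S \<Longrightarrow> f x \<in> T" "x \<in> S \<Longrightarrow> x \<in> carrier G" "x \<in> S \<Longrightarrow> f x \<in> carrier H"
  using assms subgroup.subset[of S G] subgroup.subset[of T H]
  by (auto simp: partial_iso_def bij_betw_def)

lemma partial_iso_pow:
  assumes f: "partial_iso G H S T f" and x: "x \<in> S"
  shows "f (x [^]\<^bsub>G\<^esub> (n::nat)) = f x [^]\<^bsub>H\<^esub> n"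
proof (induction n)
  case 0
  have "\<one>\<^bsub>G\<^esub> \<in> S"
    using partial_isoD(1)[OF f] by (rule subgroup.one_closed)
  then have "f \<one>\<^bsub>G\<^esub> \<otimes>\<^bsub>H\<^esub> f \<one>\<^bsub>G\<^esub> = f \<one>\<^bsub>G\<^esub>" "f \<one>\<^bsub>G\<^esub> \<in> carrier H"
    using partial_isoD(4)[OF f, of "\<one>\<^bsub>G\<^esub>" "\<one>\<^bsub>G\<^esub>"] partial_isoD(7)[OF f] by auto
  then show ?case
    by simp
next
  case (Suc n)
  then show ?case
    using partial_isoD(4)[OF f] x G.subgroup_pow_closed[OF partial_isoD(1)[OF f] x] by simp
qed

text \<open>One direction makes the extended map well defined, the other makes it injective. Both
  rest on \<open>g\<close> and \<open>h\<close> having the same order \<open>n\<close> modulo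
  \<open>S\<close> and \<open>T\<close>, with corresponding \<open>n\<close>-th powers.\<close>

lemma extension_well_defined:
  assumes f: "partial_iso G H S T f" and g: "g \<in> carrier G" and h: "h \<in> carrier H"
    and n: "n > 0" "g [^]\<^bsub>G\<^esub> n \<in> S" "f (g [^]\<^bsub>G\<^esub> n) = h [^]\<^bsub>H\<^esub> n"
    and min: "\<And>i::nat. 0 < i \<Longrightarrow> i < n \<Longrightarrow> g [^]\<^bsub>G\<^esub> i \<notin> S \<and> h [^]\<^bsub>H\<^esub> i \<notin> T"
    and s: "s \<in> S" and t: "t \<in> S"
  shows "g [^]\<^bsub>G\<^esub> (i::nat) \<otimes>\<^bsub>G\<^esub> s = g [^]\<^bsub>G\<^esub> (j::nat) \<otimes>\<^bsub>G\<^esub> t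
    \<longleftrightarrow> h [^]\<^bsub>H\<^esub> i \<otimes>\<^bsub>H\<^esub> f s = h [^]\<^bsub>H\<^esub> j \<otimes>\<^bsub>H\<^esub> f t"
proof -
  have S: "subgroup S G" and T: "subgroup T H" and inj: "inj_on f S"
    using partial_isoD[OF f] by (auto simp: bij_betw_def)
  have le: "g [^]\<^bsub>G\<^esub> i \<otimes>\<^bsub>G\<^esub> s = g [^]\<^bsub>G\<^esub> j \<otimes>\<^bsub>G\<^esub> t
      \<longleftrightarrow> h [^]\<^bsub>H\<^esub> i \<otimes>\<^bsub>H\<^esub> f s = h [^]\<^bsub>H\<^esub> j \<otimes>\<^bsub>H\<^esub> f t"
    if "i \<le> j" and s: "s \<in> S" and t: "t \<in> S" for i j :: nat and s t
  proof -
    define d where "d = j - i"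
    have j: "j = i + d"
      using that by (simp add: d_def)
    have mem: "s \<in> carrier G" "t \<in> carrier G" "f s \<in> carrier H" "f t \<in> carrier H"
      using partial_isoD[OF f] s t by auto
    have 1: "g [^]\<^bsub>G\<^esub> i \<otimes>\<^bsub>G\<^esub> s = g [^]\<^bsub>G\<^esub> j \<otimes>\<^bsub>G\<^esub> t \<longleftrightarrow> s = g [^]\<^bsub>G\<^esub> d \<otimes>\<^bsub>G\<^esub> t"
      unfolding j using mem g by (simp add: G.m_assoc flip: G.nat_pow_mult)
    have 2: "h [^]\<^bsub>H\<^esub> i \<otimes>\<^bsub>H\<^esub> f s = h [^]\<^bsub>H\<^esub> j \<otimes>\<^bsub>H\<^esub> f t \<longleftrightarrow> f s = h [^]\<^bsub>H\<^esub> d \<otimes>\<^bsub>H\<^esub> f t"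
      unfolding j using mem h by (simp add: H.m_assoc flip: H.nat_pow_mult)
    show ?thesis
    proof (cases "n dvd d")
      case True
      then obtain q where q: "d = n * q"
        by blast
      have gd: "g [^]\<^bsub>G\<^esub> d \<in> S" "f (g [^]\<^bsub>G\<^esub> d) = h [^]\<^bsub>H\<^esub> d"
        using partial_iso_pow[OF f n(2), of q] G.subgroup_pow_closed[OF S n(2), of q] g h n
        by (simp_all add: q G.nat_pow_pow H.nat_pow_pow)
      then have "f (g [^]\<^bsub>G\<^esub> d \<otimes>\<^bsub>G\<^esub> t) = h [^]\<^bsub>H\<^esub> d \<otimes>\<^bsub>H\<^esub> f t"
        using partial_isoD(4)[OF f gd(1) t] by simp
      moreover have "g [^]\<^bsub>G\<^esub> d \<otimes>\<^bsub>G\<^esub> t \<in> S"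
        using S gd(1) t by (rule subgroup.m_closed)
      ultimately show ?thesis
        unfolding 1 2 using inj s by (metis inj_on_eq_iff)
    next
      case False
      have "s \<noteq> g [^]\<^bsub>G\<^esub> d \<otimes>\<^bsub>G\<^esub> t"
      proof
        assume "s = g [^]\<^bsub>G\<^esub> d \<otimes>\<^bsub>G\<^esub> t"
        then have "g [^]\<^bsub>G\<^esub> d = s \<otimes>\<^bsub>G\<^esub> inv\<^bsub>G\<^esub> t"
          using mem g by (simp add: G.m_assoc)
        also have "\<dots> \<in> S"
          using S s t by (intro subgroup.m_closed subgroup.m_inv_closed)
        finally show False
          using G.dvd_of_pow_mem[OF S g n(1,2)] min False by blast
      qed
      moreover have "f s \<noteq> h [^]\<^bsub>H\<^esub> d \<otimes>\<^bsub>H\<^esub> f t"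
      proof
        assume "f s = h [^]\<^bsub>H\<^esub> d \<otimes>\<^bsub>H\<^esub> f t"
        then have "h [^]\<^bsub>H\<^esub> d = f s \<otimes>\<^bsub>H\<^esub> inv\<^bsub>H\<^esub> f t"
          using mem h by (simp add: H.m_assoc)
        also have "\<dots> \<in> T"
          using T s t partial_isoD(5)[OF f] by (intro subgroup.m_closed subgroup.m_inv_closed)
        finally have "h [^]\<^bsub>H\<^esub> d \<in> T" .
        moreover have "h [^]\<^bsub>H\<^esub> n \<in> T"
          using n partial_isoD(5)[OF f n(2)] by simp
        ultimately show False
          using H.dvd_of_pow_mem[OF T h n(1)] min False by blast
      qed
      ultimately show ?thesis
        unfolding 1 2 by simp
    qed
  qed
  show ?thesis
  proof (cases "i \<le> j")
    case False
    then show ?thesis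
      using le[of j i t s] s t by (simp add: eq_commute)
  qed (use le s t in blast)
qed

text \<open>A cyclic extension of \<open>S\<close> is determined by the \<open>n\<close>-th power of
  the new generator and by its conjugation action. The conditions \<open>n\<close> and
  \<open>norm\<close> say that \<open>f\<close> matches these data in the two groups.\<close>

lemma partial_iso_extend:
  assumes f: "partial_iso G H S T f" and fin: "finite (carrier G)" "finite (carrier H)"
    and g: "g \<in> carrier G" and h: "h \<in> carrier H"
    and n: "n > 0" "g [^]\<^bsub>G\<^esub> n \<in> S" "f (g [^]\<^bsub>G\<^esub> n) = h [^]\<^bsub>H\<^esub> n"
    and min: "\<And>i::nat. 0 < i \<Longrightarrow> i < n \<Longrightarrow> g [^]\<^bsub>G\<^esub> i \<notin> S \<and> h [^]\<^bsub>H\<^esub> i \<notin> T"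
    and norm: "\<And>s. s \<in> S \<Longrightarrow> \<exists>s'\<in>S. s \<otimes>\<^bsub>G\<^esub> g = g \<otimes>\<^bsub>G\<^esub> s' \<and> f s \<otimes>\<^bsub>H\<^esub> h = h \<otimes>\<^bsub>H\<^esub> f s'"
  shows "\<exists>f'. partial_iso G H (adjoin G S g) (adjoin H T h) f' \<and>
    (\<forall>i::nat. \<forall>s\<in>S. f' (g [^]\<^bsub>G\<^esub> i \<otimes>\<^bsub>G\<^esub> s) = h [^]\<^bsub>H\<^esub> i \<otimes>\<^bsub>H\<^esub> f s)"
proof -
  have S: "subgroup S G" and T: "subgroup T H" and bij: "bij_betw f S T"
    using partial_isoD[OF f] by auto
  note wd = extension_well_defined[OF f g h n min]
  \<comment> \<open>The value is defined from any representation of the argument; \<open>wd\<close>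
    shows that the choice does not matter.\<close>
  define f' where "f' = (\<lambda>x. THE y. \<exists>(i::nat). \<exists>s\<in>S. x = g [^]\<^bsub>G\<^esub> i \<otimes>\<^bsub>G\<^esub> s \<and> y = h [^]\<^bsub>H\<^esub> i \<otimes>\<^bsub>H\<^esub> f s)"
  have f': "f' (g [^]\<^bsub>G\<^esub> i \<otimes>\<^bsub>G\<^esub> s) = h [^]\<^bsub>H\<^esub> i \<otimes>\<^bsub>H\<^esub> f s" if s: "s \<in> S" for i :: nat and s
    unfolding f'_def
  proof (rule the_equality)
    show "\<exists>j::nat. \<exists>t\<in>S. g [^]\<^bsub>G\<^esub> i \<otimes>\<^bsub>G\<^esub> s = g [^]\<^bsub>G\<^esub> j \<otimes>\<^bsub>G\<^esub> t \<and> h [^]\<^bsub>H\<^esub> i \<otimes>\<^bsub>H\<^esub> f s = h [^]\<^bsub>H\<^esub> j \<otimes>\<^bsub>H\<^esub> f t"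
      using s by blast
    fix y assume "\<exists>j::nat. \<exists>t\<in>S. g [^]\<^bsub>G\<^esub> i \<otimes>\<^bsub>G\<^esub> s = g [^]\<^bsub>G\<^esub> j \<otimes>\<^bsub>G\<^esub> t \<and> y = h [^]\<^bsub>H\<^esub> j \<otimes>\<^bsub>H\<^esub> f t"
    then show "y = h [^]\<^bsub>H\<^esub> i \<otimes>\<^bsub>H\<^esub> f s"
      using wd s by metis
  qed
  have memT: "\<exists>s\<in>S. t = f s" if "t \<in> T" for t
    using bij that by (auto simp: bij_betw_def)
  have norm_H: "\<exists>t'\<in>T. t \<otimes>\<^bsub>H\<^esub> h = h \<otimes>\<^bsub>H\<^esub> t'" if "t \<in> T" for t
    using memT[OF that] norm partial_isoD(5)[OF f] by blast
  have "partial_iso G H (adjoin G S g) (adjoin H T h) f'"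
    unfolding partial_iso_def
  proof (intro conjI ballI)
    show "subgroup (adjoin G S g) G"
      using norm by (intro G.subgroup_adjoin fin S g) blast
    show "subgroup (adjoin H T h) H"
      using norm_H by (intro H.subgroup_adjoin fin T h) blast
    show "bij_betw f' (adjoin G S g) (adjoin H T h)"
      unfolding bij_betw_def
    proof
      show "inj_on f' (adjoin G S g)"
      proof (rule inj_onI)
        fix x y assume "x \<in> adjoin G S g" "y \<in> adjoin G S g" and eq: "f' x = f' y"
        then obtain i j :: nat and s t where "s \<in> S" "x = g [^]\<^bsub>G\<^esub> i \<otimes>\<^bsub>G\<^esub> s" "t \<in> S" "y = g [^]\<^bsub>G\<^esub> j \<otimes>\<^bsub>G\<^esub> t"
          by (auto elim!: adjoinE)
        then show "x = y"
          using eq f' wd[of s t i j] by simp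
      qed
      show "f' ` adjoin G S g = adjoin H T h"
      proof (intro equalityI subsetI)
        fix y assume "y \<in> f' ` adjoin G S g"
        then obtain i :: nat and s where "s \<in> S" "y = f' (g [^]\<^bsub>G\<^esub> i \<otimes>\<^bsub>G\<^esub> s)"
          by (auto elim!: adjoinE)
        then show "y \<in> adjoin H T h"
          using f' partial_isoD(5)[OF f] by (auto intro: adjoinI)
      next
        fix y assume "y \<in> adjoin H T h"
        then obtain i :: nat and t where t: "t \<in> T" "y = h [^]\<^bsub>H\<^esub> i \<otimes>\<^bsub>H\<^esub> t"
          by (rule adjoinE)
        then obtain s where "s \<in> S" "t = f s"
          using memT by blast
        then show "y \<in> f' ` adjoin G S g"
          using t f' by (intro image_eqI[of _ _ "g [^]\<^bsub>G\<^esub> i \<otimes>\<^bsub>G\<^esub> s"]) (auto intro: adjoinI)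
      qed
    qed
    fix x y assume "x \<in> adjoin G S g" "y \<in> adjoin G S g"
    then obtain i j :: nat and s t where s: "s \<in> S" "x = g [^]\<^bsub>G\<^esub> i \<otimes>\<^bsub>G\<^esub> s" and t: "t \<in> S" "y = g [^]\<^bsub>G\<^esub> j \<otimes>\<^bsub>G\<^esub> t"
      by (auto elim!: adjoinE)
    have "\<exists>s'\<in>S. s \<otimes>\<^bsub>G\<^esub> g [^]\<^bsub>G\<^esub> j = g [^]\<^bsub>G\<^esub> j \<otimes>\<^bsub>G\<^esub> s' \<and> f s \<otimes>\<^bsub>H\<^esub> h [^]\<^bsub>H\<^esub> j = h [^]\<^bsub>H\<^esub> j \<otimes>\<^bsub>H\<^esub> f s'"
    proof (induction j)
      case 0
      then show ?case
        using s(1) partial_isoD(6,7)[OF f s(1)] by (intro bexI[of _ s]) auto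
    next
      case (Suc j)
      then obtain s' where s': "s' \<in> S" "s \<otimes>\<^bsub>G\<^esub> g [^]\<^bsub>G\<^esub> j = g [^]\<^bsub>G\<^esub> j \<otimes>\<^bsub>G\<^esub> s'"
        "f s \<otimes>\<^bsub>H\<^esub> h [^]\<^bsub>H\<^esub> j = h [^]\<^bsub>H\<^esub> j \<otimes>\<^bsub>H\<^esub> f s'"
        by blast
      then obtain s'' where s'': "s'' \<in> S" "s' \<otimes>\<^bsub>G\<^esub> g = g \<otimes>\<^bsub>G\<^esub> s''" "f s' \<otimes>\<^bsub>H\<^esub> h = h \<otimes>\<^bsub>H\<^esub> f s''"
        using norm by blast
      note mem = partial_isoD(6,7)[OF f s(1)] partial_isoD(6,7)[OF f s'(1)] partial_isoD(6,7)[OF f s''(1)]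
      have "s \<otimes>\<^bsub>G\<^esub> g [^]\<^bsub>G\<^esub> Suc j = g [^]\<^bsub>G\<^esub> j \<otimes>\<^bsub>G\<^esub> (s' \<otimes>\<^bsub>G\<^esub> g)"
        using mem s' g by (simp flip: G.m_assoc)
      also have "\<dots> = g [^]\<^bsub>G\<^esub> Suc j \<otimes>\<^bsub>G\<^esub> s''"
        unfolding s'' using mem g by (simp add: G.m_assoc)
      finally have 1: "s \<otimes>\<^bsub>G\<^esub> g [^]\<^bsub>G\<^esub> Suc j = g [^]\<^bsub>G\<^esub> Suc j \<otimes>\<^bsub>G\<^esub> s''" .
      have "f s \<otimes>\<^bsub>H\<^esub> h [^]\<^bsub>H\<^esub> Suc j = h [^]\<^bsub>H\<^esub> j \<otimes>\<^bsub>H\<^esub> (f s' \<otimes>\<^bsub>H\<^esub> h)"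
        using mem s' h by (simp flip: H.m_assoc)
      also have "\<dots> = h [^]\<^bsub>H\<^esub> Suc j \<otimes>\<^bsub>H\<^esub> f s''"
        unfolding s'' using mem h by (simp add: H.m_assoc)
      finally show ?case
        using 1 s''(1) by blast
    qed
    then obtain s' where s': "s' \<in> S" "s \<otimes>\<^bsub>G\<^esub> g [^]\<^bsub>G\<^esub> j = g [^]\<^bsub>G\<^esub> j \<otimes>\<^bsub>G\<^esub> s'"
      "f s \<otimes>\<^bsub>H\<^esub> h [^]\<^bsub>H\<^esub> j = h [^]\<^bsub>H\<^esub> j \<otimes>\<^bsub>H\<^esub> f s'"
      by blast
    note mem = partial_isoD(6,7)[OF f s(1)] partial_isoD(6,7)[OF f s'(1)] partial_isoD(6,7)[OF f t(1)]
    have "x \<otimes>\<^bsub>G\<^esub> y = g [^]\<^bsub>G\<^esub> i \<otimes>\<^bsub>G\<^esub> (s \<otimes>\<^bsub>G\<^esub> g [^]\<^bsub>G\<^esub> j) \<otimes>\<^bsub>G\<^esub> t"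
      using mem g by (simp add: s t G.m_assoc)
    also have "\<dots> = g [^]\<^bsub>G\<^esub> (i + j) \<otimes>\<^bsub>G\<^esub> (s' \<otimes>\<^bsub>G\<^esub> t)"
      unfolding s' using mem g by (simp add: G.m_assoc flip: G.nat_pow_mult)
    finally have "f' (x \<otimes>\<^bsub>G\<^esub> y) = h [^]\<^bsub>H\<^esub> (i + j) \<otimes>\<^bsub>H\<^esub> (f s' \<otimes>\<^bsub>H\<^esub> f t)"
      using f' subgroup.m_closed[OF S s'(1) t(1)] partial_isoD(4)[OF f s'(1) t(1)] by simp
    also have "\<dots> = h [^]\<^bsub>H\<^esub> i \<otimes>\<^bsub>H\<^esub> (h [^]\<^bsub>H\<^esub> j \<otimes>\<^bsub>H\<^esub> f s') \<otimes>\<^bsub>H\<^esub> f t"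
      using mem h by (simp add: H.m_assoc flip: H.nat_pow_mult)
    also have "\<dots> = f' x \<otimes>\<^bsub>H\<^esub> f' y"
      unfolding s'(3)[symmetric] using mem h s(1) t(1) by (simp add: s(2) t(2) f' H.m_assoc)
    finally show "f' (x \<otimes>\<^bsub>G\<^esub> y) = f' x \<otimes>\<^bsub>H\<^esub> f' y" .
  qed
  then show ?thesis
    using f' by blast
qed

end

section \<open>Classification\<close>

text \<open>The elements commuting with \<open>v\<close> form a subgroup, so it is enough to test
  the generators.\<close>

lemma (in group) centralizer_adjoin:
  assumes S: "S \<subseteq> carrier G" and v: "v \<in> centralizer G S" and g: "g \<in> carrier G" "v \<otimes> g = g \<otimes> v"
  shows "v \<in> centralizer G (adjoin G S g)"
proof -
  have vG: "v \<in> carrier G"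
    using v by (rule centralizerD(1))
  have "adjoin G S g \<subseteq> centralizer G {v}"
  proof (rule adjoin_subset)
    show "subgroup (centralizer G {v}) G"
      using vG by (intro subgroup_centralizer) auto
    show "S \<subseteq> centralizer G {v}"
      using S centralizerD(2)[OF v] by (auto intro!: centralizerI)
    show "g \<in> centralizer G {v}"
      using g by (auto intro!: centralizerI)
  qed
  then show ?thesis
    using vG centralizerD(2)[of _ G "{v}" v] by (intro centralizerI) (auto simp: subset_iff)
qed

lemma (in group) finite_maximal_subgroup:
  assumes fin: "finite (carrier G)" and S: "subgroup S G" "P S"
  obtains M where "subgroup M G" "P M" "\<And>N. subgroup N G \<Longrightarrow> P N \<Longrightarrow> M \<subseteq> N \<Longrightarrow> M = N"
proof -
  let ?A = "{M. subgroup M G \<and> P M}"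
  have "?A \<subseteq> Pow (carrier G)"
    by (auto dest: subgroup.subset)
  then have "finite ?A"
    using fin by (meson finite_Pow_iff finite_subset)
  then obtain M where "M \<in> ?A" "\<forall>N\<in>?A. M \<subseteq> N \<longrightarrow> M = N"
    using finite_has_maximal[of ?A] S by blast
  then show ?thesis
    using that[of M] by blast
qed

section \<open>Splitting off central elements and hyperbolic pairs\<close>

context central_ext
begin

lemma coprime_less: "0 < i \<Longrightarrow> i < p \<Longrightarrow> coprime i p"
  using prime prime_imp_coprime_nat[of p i] nat_dvd_not_less coprime_commute by blast

lemma subgroup_adjoin_c:
  assumes S: "subgroup S G" "c \<in> S" and g: "g \<in> carrier G"
  shows "subgroup (adjoin G S g) G"
proof (rule subgroup_adjoin[OF fin S(1) g])
  fix s assume s: "s \<in> S"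
  then have sG: "s \<in> carrier G"
    by (rule subgroup.mem_carrier[OF S(1)])
  then obtain i :: nat where i: "s \<otimes> g = g \<otimes> s \<otimes> c [^] i"
    using commute_ex[OF g sG] by blast
  have "s \<otimes> c [^] i \<in> S"
    by (rule subgroup.m_closed[OF S(1) s subgroup_pow_closed[OF S]])
  then show "\<exists>s'\<in>S. s \<otimes> g = g \<otimes> s'"
    unfolding i using g sG by (intro bexI[of _ "s \<otimes> c [^] i"]) (simp_all add: m_assoc)
qed

lemma subgroup_inter_centralizer: "subgroup S G \<Longrightarrow> subgroup (S \<inter> centralizer G S) G"
  by (intro subgroups_Inter_pair subgroup_centralizer subgroup.subset)

lemma c_in_centralizer: "S \<subseteq> carrier G \<Longrightarrow> c \<in> centralizer G S"
  using c_central by (intro centralizerI) auto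

definition cyc :: "'a set" where
  "cyc = range (\<lambda>i::nat. c [^] i)"

lemma cyc_eq_adjoin: "cyc = adjoin G {\<one>} c"
  by (auto simp: cyc_def adjoin_def)

lemma subgroup_cyc: "subgroup cyc G"
  unfolding cyc_eq_adjoin using triv_subgroup by (intro subgroup_adjoin fin) auto

lemma c_in_cyc: "c \<in> cyc"
  unfolding cyc_def by (rule image_eqI[of _ _ 1]) auto

lemma card_cyc: "card cyc = p"
proof -
  have "card (adjoin G {\<one>} c) = p * card {\<one>}"
    using triv_subgroup by (intro card_adjoin) (auto simp: c_pow_p c_pow_eq_one_iff dest: dvd_imp_le)
  then show ?thesis
    by (simp add: cyc_eq_adjoin)
qed

lemma cyc_subset: "subgroup S G \<Longrightarrow> c \<in> S \<Longrightarrow> cyc \<subseteq> S"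
  using subgroup_pow_closed by (auto simp: cyc_def)

lemma finite_subgroup: "subgroup S G \<Longrightarrow> finite S"
  using fin subgroup.subset finite_subset by blast

text \<open>A subgroup \<open>M\<close> of \<open>S\<close> that is maximal among those containing
  \<open>c\<close> but not \<open>a\<close> turns out to be a complement of <a>. As \<open>a\<close>
  is central in \<open>S\<close>, the centre of \<open>S\<close> splits accordingly, which gives its
  order.\<close>

lemma split_central:
  assumes S: "subgroup S G" "c \<in> S" and exp: "\<And>x. x \<in> S \<Longrightarrow> x [^] p = \<one>"
    and a: "a \<in> S" "a \<in> centralizer G S" "a \<notin> cyc"
  obtains M where "subgroup M G" "c \<in> M" "M \<subseteq> S" "S = adjoin G M a"
    "\<forall>i::nat. 0 < i \<and> i < p \<longrightarrow> a [^] i \<notin> M"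
    "card S = p * card M" "card (S \<inter> centralizer G S) = p * card (M \<inter> centralizer G M)"
proof -
  let ?P = "\<lambda>M. c \<in> M \<and> M \<subseteq> S \<and> a \<notin> M"
  obtain M where M: "subgroup M G" "c \<in> M" "M \<subseteq> S" "a \<notin> M"
    and max: "\<And>N. subgroup N G \<Longrightarrow> ?P N \<Longrightarrow> M \<subseteq> N \<Longrightarrow> M = N"
  proof (rule finite_maximal_subgroup[OF fin subgroup_cyc, of ?P])
    show "?P cyc"
      using c_in_cyc cyc_subset[OF S] a(3) by blast
  qed (use that in blast)
  have SG: "x \<in> carrier G" if "x \<in> S" for x
    using S(1) that by (rule subgroup.mem_carrier)
  have aG: "a \<in> carrier G"
    using a SG by blast
  have subMa: "subgroup (adjoin G M a) G"
    using M aG by (intro subgroup_adjoin_c)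
  have min: "a [^] i \<notin> M" if "0 < i" "i < p" for i :: nat
    using mem_of_coprime_pow_mem[OF M(1) aG, of p i] coprime_less[OF that] M exp[OF a(1)]
      subgroup.one_closed[OF M(1)] by auto
  have "S \<subseteq> adjoin G M a"
  proof
    fix y assume y: "y \<in> S"
    have MA: "M \<subseteq> adjoin G M a" "a \<in> adjoin G M a"
      by (rule subset_adjoin[OF subgroup.subset[OF M(1)]], rule mem_adjoin[OF M(1) aG])
    show "y \<in> adjoin G M a"
    proof (cases "y \<in> M")
      case False
      have sub: "subgroup (adjoin G M y) G"
        using M SG[OF y] by (intro subgroup_adjoin_c)
      have "M \<subseteq> adjoin G M y" "y \<in> adjoin G M y" "adjoin G M y \<subseteq> S"
        by (rule subset_adjoin[OF subgroup.subset[OF M(1)]], rule mem_adjoin[OF M(1) SG[OF y]],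
            rule adjoin_subset[OF S(1) M(3) y])
      \<comment> \<open>Maximality of \<open>M\<close> puts \<open>a\<close> into the subgroup
        generated by \<open>M\<close> and \<open>y\<close>. The exponent of \<open>y\<close> in
        \<open>a\<close> is prime to \<open>p\<close>, so conversely \<open>y\<close> lies in the
        subgroup generated by \<open>M\<close> and \<open>a\<close>.\<close>
      then have "a \<in> adjoin G M y"
        using max[OF sub] M(2) False by blast
      then obtain i :: nat and s where s: "s \<in> M" "a = y [^] i \<otimes> s"
        by (rule adjoinE)
      have "\<not> p dvd i"
      proof
        assume "p dvd i"
        then have "y [^] i = \<one>"
          using exp[OF y] SG[OF y] by (auto simp: nat_pow_pow[symmetric])
        then show False
          using s M SG by auto
      qed
      then have coprime: "coprime i p"
        using prime prime_imp_coprime_nat coprime_commute by blast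
      have "y [^] i = a \<otimes> inv s"
        using s SG M(3) SG[OF y] by (simp add: m_assoc subset_iff)
      also have "\<dots> \<in> adjoin G M a"
        using MA s(1) by (intro subgroup.m_closed[OF subMa] subgroup.m_inv_closed[OF subMa]) auto
      finally have "y [^] i \<in> adjoin G M a" .
      moreover have "y [^] p \<in> adjoin G M a"
        using exp[OF y] subgroup.one_closed[OF subMa] by simp
      ultimately show ?thesis
        using mem_of_coprime_pow_mem[OF subMa SG[OF y]] coprime by blast
    qed (use MA in blast)
  qed
  moreover have "adjoin G M a \<subseteq> S"
    using S(1) M(3) a(1) by (rule adjoin_subset)
  ultimately have SA: "S = adjoin G M a"
    by blast
  have exp_a: "a [^] p = \<one>"
    using exp a by blast
  have card_S: "card S = p * card M"
    unfolding SA using M aG min exp_a subgroup.one_closed[OF M(1)] by (intro card_adjoin) auto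
  have MZ: "subgroup (M \<inter> centralizer G M) G"
    using M by (intro subgroup_inter_centralizer)
  have "S \<inter> centralizer G S = adjoin G (M \<inter> centralizer G M) a"
  proof
    have "M \<inter> centralizer G M \<subseteq> S \<inter> centralizer G S"
    proof
      fix v assume v: "v \<in> M \<inter> centralizer G M"
      then have "v \<in> centralizer G (adjoin G M a)"
        using centralizer_adjoin[OF subgroup.subset[OF M(1)], of v a] aG M(3) centralizerD(2)[OF a(2), of v]
        by auto
      then show "v \<in> S \<inter> centralizer G S"
        using SA v M(3) by auto
    qed
    then show "adjoin G (M \<inter> centralizer G M) a \<subseteq> S \<inter> centralizer G S"
      using a S by (intro adjoin_subset subgroup_inter_centralizer) auto
    show "S \<inter> centralizer G S \<subseteq> adjoin G (M \<inter> centralizer G M) a"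
    proof
      fix x assume x: "x \<in> S \<inter> centralizer G S"
      then obtain i :: nat and m where m: "m \<in> M" "x = a [^] i \<otimes> m"
        using SA by (auto elim: adjoinE)
      have mG: "m \<in> carrier G"
        using m M SG by blast
      have "m = inv (a [^] i) \<otimes> x"
        using m mG aG by simp
      also have "\<dots> \<in> centralizer G S"
        using x a subgroup_centralizer[OF subgroup.subset[OF S(1)]]
        by (intro subgroup.m_closed subgroup.m_inv_closed subgroup_pow_closed) auto
      finally have "m \<in> centralizer G M"
        using M(3) mG by (auto simp: centralizer_def)
      then show "x \<in> adjoin G (M \<inter> centralizer G M) a"
        using m by (auto intro: adjoinI)
    qed
  qed
  then have "card (S \<inter> centralizer G S) = p * card (M \<inter> centralizer G M)"
    using MZ aG min exp_a subgroup.one_closed[OF MZ] by (simp, intro card_adjoin) auto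
  then show ?thesis
    using that M SA min card_S by blast
qed

lemma pow_not_commute:
  assumes "x \<in> carrier G" "y \<in> carrier G" "y \<otimes> x = x \<otimes> y \<otimes> c" and i: "0 < i" "i < p"
  shows "y [^] (i::nat) \<otimes> x \<noteq> x \<otimes> y [^] i" "y \<otimes> x [^] i \<noteq> x [^] i \<otimes> y"
proof -
  have "\<not> p dvd i"
    using i by (auto dest: dvd_imp_le)
  then have ne: "c [^] i \<noteq> \<one>"
    by (simp add: c_pow_eq_one_iff)
  have "y [^] i \<otimes> x = x \<otimes> y [^] i \<otimes> c [^] i"
    using commute_pow_left[of x y 1 i] assms by simp
  then show "y [^] i \<otimes> x \<noteq> x \<otimes> y [^] i"
    using ne assms by simp
  have "y \<otimes> x [^] i = x [^] i \<otimes> y \<otimes> c [^] i"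
    using commute_pow[of x y 1 i] assms by simp
  then show "y \<otimes> x [^] i \<noteq> x [^] i \<otimes> y"
    using ne assms by simp
qed

text \<open>\<open>j\<close> is the inverse modulo \<open>p\<close> of the exponent of
  \<open>c\<close> in the commutator of \<open>x\<close> and \<open>y\<close>.\<close>

lemma normalize_commutator:
  assumes "x \<in> carrier G" "y \<in> carrier G" "y \<otimes> x \<noteq> x \<otimes> y"
  obtains j :: nat where "y [^] j \<otimes> x = x \<otimes> y [^] j \<otimes> c"
proof -
  obtain i :: nat where i: "y \<otimes> x = x \<otimes> y \<otimes> c [^] i"
    using commute_ex assms by blast
  have "\<not> p dvd i"
    using i assms by (auto simp: c_pow_eq_one_iff[symmetric])
  then have "coprime i p"
    using prime prime_imp_coprime_nat coprime_commute by blast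
  then obtain j where "[i * j = 1] (mod p)"
    using cong_solve_coprime_nat by fastforce
  then have "c [^] (i * j) = c"
    using c_pow_eq_iff[of "i * j" 1] by (simp add: cong_def)
  then have "y [^] j \<otimes> x = x \<otimes> y [^] j \<otimes> c"
    using commute_pow_left[OF assms(1,2) i, of j] by simp
  then show ?thesis
    by (rule that)
qed

text \<open>\<open>y\<close> acts as a dual vector of \<open>x\<close>: a suitable power of it
  cancels the commutator of \<open>g\<close> with \<open>x\<close>. The exponent (p - 1) * k
  represents -k modulo \<open>p\<close>.\<close>

lemma commuting_multiple:
  assumes x: "x \<in> carrier G" and y: "y \<in> carrier G" "y \<otimes> x = x \<otimes> y \<otimes> c" and g: "g \<in> carrier G"
  obtains m :: nat where "y [^] m \<otimes> g \<otimes> x = x \<otimes> (y [^] m \<otimes> g)"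
proof -
  obtain k :: nat where k: "g \<otimes> x = x \<otimes> g \<otimes> c [^] k"
    using commute_ex x g by blast
  define m where "m = (p - 1) * k"
  have "m + k = p * k"
    using p_pos unfolding m_def by (cases p) auto
  have "y [^] m \<otimes> g \<otimes> x = y [^] m \<otimes> x \<otimes> g \<otimes> c [^] k"
    using x y(1) g k by (simp add: m_assoc)
  also have "y [^] m \<otimes> x = x \<otimes> y [^] m \<otimes> c [^] m"
    using commute_pow_left[of x y 1 m] x y by simp
  also have "x \<otimes> y [^] m \<otimes> c [^] m \<otimes> g \<otimes> c [^] k = x \<otimes> y [^] m \<otimes> (c [^] m \<otimes> g) \<otimes> c [^] k"
    using x y(1) g by (simp add: m_assoc)
  also have "\<dots> = x \<otimes> (y [^] m \<otimes> g) \<otimes> c [^] (m + k)"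
    unfolding c_pow_central[OF g] using x y(1) g by (simp add: m_assoc nat_pow_mult)
  also have "c [^] (m + k) = \<one>"
    unfolding \<open>m + k = p * k\<close> by (simp add: c_pow_eq_one_iff)
  finally show ?thesis
    using that[of m] x y(1) g by simp
qed

text \<open>The commutator is an alternating form on \<open>S\<close> modulo <c> with values in Z/p,
  nondegenerate because the centre of \<open>S\<close> is <c>. Here \<open>x\<close> and
  \<open>y\<close> span a hyperbolic plane and \<open>C\<close> is its orthogonal
  complement.\<close>

lemma split_hyperbolic:
  assumes S: "subgroup S G" "c \<in> S" and Z: "S \<inter> centralizer G S = cyc" and ne: "S \<noteq> cyc"
  obtains C x y where "subgroup C G" "c \<in> C" "C \<subseteq> S" "C \<subseteq> centralizer G {x, y}" "x \<in> S" "y \<in> S"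
    "y \<otimes> x = x \<otimes> y \<otimes> c" "S = adjoin G (adjoin G C y) x" "C \<inter> centralizer G C = cyc"
proof -
  have SG: "x \<in> carrier G" if "x \<in> S" for x
    using S(1) that by (rule subgroup.mem_carrier)
  obtain x where x: "x \<in> S" "x \<notin> centralizer G S"
    using Z ne cyc_subset[OF S] by blast
  then obtain y0 where y0: "y0 \<in> S" "y0 \<otimes> x \<noteq> x \<otimes> y0"
    using centralizerI[of x G S] SG by metis
  obtain j :: nat where j: "y0 [^] j \<otimes> x = x \<otimes> y0 [^] j \<otimes> c"
    using normalize_commutator[of x y0] x y0 SG by blast
  define y where "y = y0 [^] j"
  have y: "y \<in> S" "y \<otimes> x = x \<otimes> y \<otimes> c"
    using j subgroup_pow_closed[OF S(1) y0(1)] by (auto simp: y_def)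
  have xG: "x \<in> carrier G" and yG: "y \<in> carrier G"
    using x y SG by auto
  define C where "C = S \<inter> centralizer G {x, y}"
  have C: "subgroup C G"
    unfolding C_def using xG yG by (intro subgroups_Inter_pair S subgroup_centralizer) auto
  have cC: "c \<in> C"
    using S c_in_centralizer xG yG by (simp add: C_def)
  have Cy: "subgroup (adjoin G C y) G"
    using C cC yG by (rule subgroup_adjoin_c)
  have subs: "C \<subseteq> adjoin G C y" "y \<in> adjoin G C y"
    "adjoin G C y \<subseteq> adjoin G (adjoin G C y) x" "x \<in> adjoin G (adjoin G C y) x"
    by (rule subset_adjoin[OF subgroup.subset[OF C]], rule mem_adjoin[OF C yG],
        rule subset_adjoin[OF subgroup.subset[OF Cy]], rule mem_adjoin[OF Cy xG])
  have "c \<in> adjoin G C y"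
    using subs cC by blast
  then have A: "subgroup (adjoin G (adjoin G C y) x) G"
    using Cy xG by (intro subgroup_adjoin_c[OF Cy])
  have "S \<subseteq> adjoin G (adjoin G C y) x"
  proof
    fix g assume g: "g \<in> S"
    \<comment> \<open>Orthogonal projection of \<open>g\<close> to \<open>C\<close>: a power of
      \<open>y\<close> achieves commutation with \<open>x\<close>, then a power of \<open>x\<close>
      achieves commutation with \<open>y\<close> without disturbing the former.\<close>
    obtain m :: nat where m: "y [^] m \<otimes> g \<otimes> x = x \<otimes> (y [^] m \<otimes> g)"
      using commuting_multiple[OF xG yG y(2) SG[OF g]] by blast
    define h where "h = y [^] m \<otimes> g"
    have h: "h \<in> S"
      using S g y by (simp add: h_def subgroup.m_closed subgroup_pow_closed)
    then have hG: "h \<in> carrier G"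
      by (rule SG)
    obtain k :: nat where k: "y \<otimes> h = h \<otimes> y \<otimes> c [^] k"
      using commute_ex[OF hG yG] by blast
    define n where "n = (p - 1) * k"
    have nk: "n + k = p * k"
      using p_pos unfolding n_def by (cases p) auto
    have yx: "y \<otimes> x [^] n = x [^] n \<otimes> y \<otimes> c [^] n"
      using commute_pow[of x y 1 n] xG yG y by simp
    define v where "v = x [^] n \<otimes> h"
    have v: "v \<in> S"
      using S h x by (simp add: v_def subgroup.m_closed subgroup_pow_closed)
    have "y \<otimes> v = y \<otimes> x [^] n \<otimes> h"
      using xG yG hG by (simp add: v_def m_assoc)
    also have "\<dots> = x [^] n \<otimes> y \<otimes> (c [^] n \<otimes> h)"
      unfolding yx using xG yG hG by (simp add: m_assoc)
    also have "\<dots> = x [^] n \<otimes> (y \<otimes> h) \<otimes> c [^] n"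
      unfolding c_pow_central[OF hG] using xG yG hG by (simp add: m_assoc)
    also have "\<dots> = v \<otimes> y \<otimes> c [^] (k + n)"
      unfolding k v_def using xG yG hG by (simp add: m_assoc flip: nat_pow_mult)
    also have "c [^] (k + n) = \<one>"
      using nk by (simp add: add.commute c_pow_eq_one_iff)
    finally have "v \<otimes> y = y \<otimes> v"
      using xG yG hG by (simp add: v_def)
    moreover have "v \<otimes> x = x \<otimes> v"
    proof -
      have "v \<otimes> x = x [^] n \<otimes> (h \<otimes> x)"
        using xG hG by (simp add: v_def m_assoc)
      also have "\<dots> = x [^] n \<otimes> x \<otimes> h"
        using m xG hG by (simp add: h_def[symmetric] m_assoc)
      also have "x [^] n \<otimes> x = x \<otimes> x [^] n"
        using nat_pow_Suc2[OF xG, of n] by simp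
      finally show ?thesis
        using xG hG by (simp add: v_def m_assoc)
    qed
    ultimately have "v \<in> C"
      using v SG by (auto simp: C_def intro!: centralizerI)
    have "g = inv (y [^] m) \<otimes> (inv (x [^] n) \<otimes> v)"
      using xG yG SG[OF g] by (simp add: v_def h_def)
    also have "\<dots> \<in> adjoin G (adjoin G C y) x"
      using subs \<open>v \<in> C\<close>
      by (intro subgroup.m_closed[OF A] subgroup.m_inv_closed[OF A] subgroup_pow_closed[OF A]) auto
    finally show "g \<in> adjoin G (adjoin G C y) x" .
  qed
  moreover have "adjoin G (adjoin G C y) x \<subseteq> S"
    using x y by (intro adjoin_subset S) (auto simp: C_def)
  ultimately have SA: "S = adjoin G (adjoin G C y) x"
    by blast
  have CZ: "C \<inter> centralizer G C = cyc"
  proof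
    show "cyc \<subseteq> C \<inter> centralizer G C"
      using C cC by (intro cyc_subset subgroup_inter_centralizer) (auto intro: c_in_centralizer dest: subgroup.subset)
    show "C \<inter> centralizer G C \<subseteq> cyc"
    proof
      fix v assume v: "v \<in> C \<inter> centralizer G C"
      then have vx: "v \<otimes> x = x \<otimes> v" "v \<otimes> y = y \<otimes> v"
        by (auto simp: C_def dest: centralizerD(2))
      have "v \<in> centralizer G (adjoin G C y)"
        using centralizer_adjoin[OF subgroup.subset[OF C] _ yG vx(2)] v by blast
      then have "v \<in> centralizer G (adjoin G (adjoin G C y) x)"
        using centralizer_adjoin[OF subgroup.subset[OF Cy] _ xG vx(1)] by blast
      then have "v \<in> centralizer G S"
        using SA by simp
      moreover have "v \<in> S"
        using v by (simp add: C_def)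
      ultimately show "v \<in> cyc"
        using Z by blast
    qed
  qed
  show ?thesis
    by (rule that[OF C cC _ _ x(1) y SA CZ]) (auto simp: C_def)
qed

text \<open>All of \<open>C\<close> commutes with \<open>x\<close> and \<open>y\<close>, whereas
  powers of \<open>y\<close> and \<open>x\<close> with exponent strictly between 0 and
  \<open>p\<close> do not commute with the other partner. So each of the two steps has index
  \<open>p\<close>.\<close>

lemma card_hyperbolic:
  assumes C: "subgroup C G" "c \<in> C" "C \<subseteq> centralizer G {x, y}"
    and x: "x \<in> carrier G" "x [^] p = \<one>" and y: "y \<in> carrier G" "y [^] p = \<one>" "y \<otimes> x = x \<otimes> y \<otimes> c"
  shows "card (adjoin G (adjoin G C y) x) = p * (p * card C)"
    and "\<And>i::nat. 0 < i \<Longrightarrow> i < p \<Longrightarrow> y [^] i \<notin> C"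
    and "\<And>i::nat. 0 < i \<Longrightarrow> i < p \<Longrightarrow> x [^] i \<notin> adjoin G C y"
proof -
  show 1: "y [^] i \<notin> C" if "0 < i" "i < p" for i :: nat
    using pow_not_commute(1)[OF x(1) y(1,3) that] C(3) by (auto simp: subset_iff centralizer_def)
  have comm: "adjoin G C y \<subseteq> centralizer G {y}"
    using y C(3) by (intro adjoin_subset subgroup_centralizer) (auto simp: centralizer_def)
  show 2: "x [^] i \<notin> adjoin G C y" if "0 < i" "i < p" for i :: nat
    using pow_not_commute(2)[OF x(1) y(1,3) that] comm by (auto simp: subset_iff centralizer_def)
  have Cy: "subgroup (adjoin G C y) G"
    using C y by (intro subgroup_adjoin_c)
  have "card (adjoin G (adjoin G C y) x) = p * card (adjoin G C y)"
    using Cy x 2 subgroup.one_closed[OF Cy] by (intro card_adjoin) auto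
  also have "card (adjoin G C y) = p * card C"
    using C y 1 subgroup.one_closed[OF C(1)] by (intro card_adjoin) auto
  finally show "card (adjoin G (adjoin G C y) x) = p * (p * card C)" .
qed

lemma hyperbolic_conj:
  assumes x: "x \<in> carrier G" and y: "y \<in> carrier G" "y \<otimes> x = x \<otimes> y \<otimes> c"
    and s: "s \<in> carrier G" "s \<otimes> x = x \<otimes> s"
  shows "y [^] (j::nat) \<otimes> s \<otimes> x = x \<otimes> (y [^] j \<otimes> s \<otimes> c [^] j)"
proof -
  have yx: "y [^] j \<otimes> x = x \<otimes> y [^] j \<otimes> c [^] j"
    using commute_pow_left[of x y 1 j] x y by simp
  have "y [^] j \<otimes> s \<otimes> x = y [^] j \<otimes> (s \<otimes> x)"
    using x y(1) s(1) by (simp add: m_assoc)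
  also have "\<dots> = y [^] j \<otimes> x \<otimes> s"
    unfolding s(2) using x y(1) s(1) by (simp add: m_assoc)
  also have "\<dots> = x \<otimes> y [^] j \<otimes> (c [^] j \<otimes> s)"
    unfolding yx using x y(1) s(1) by (simp add: m_assoc)
  finally show ?thesis
    unfolding c_pow_central[OF s(1)] using x y(1) s(1) by (simp add: m_assoc)
qed

end

locale central_ext_pair = G: central_ext G p c + H: central_ext H p d
  for G :: "('a, 'm) monoid_scheme" and H :: "('b, 'n) monoid_scheme" and p c d
begin

sublocale group_pair G H
  by unfold_locales

text \<open>First \<open>y\<close> is adjoined, which commutes with \<open>S\<close>, and then
  \<open>x\<close>, which sends \<open>y\<close> to \<open>y \<otimes> c\<close> and fixes
  \<open>S\<close>. The order \<open>n\<close> of \<open>x\<close> is left open, as it is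
  \<open>p\<close> for hyperbolic pairs in exponent \<open>p\<close> but p^(k+1) for a noncentral
  generator of \<open>p\<close>-th powers.\<close>

lemma extend_hyperbolic:
  assumes f: "partial_iso G H S T f" and c: "c \<in> S" "f c = d"
    and x: "x \<in> carrier G" and y: "y \<in> carrier G" "y [^]\<^bsub>G\<^esub> p = \<one>\<^bsub>G\<^esub>" "y \<otimes>\<^bsub>G\<^esub> x = x \<otimes>\<^bsub>G\<^esub> y \<otimes>\<^bsub>G\<^esub> c"
    and S: "S \<subseteq> centralizer G {x, y}"
    and x': "x' \<in> carrier H" and y': "y' \<in> carrier H" "y' [^]\<^bsub>H\<^esub> p = \<one>\<^bsub>H\<^esub>" "y' \<otimes>\<^bsub>H\<^esub> x' = x' \<otimes>\<^bsub>H\<^esub> y' \<otimes>\<^bsub>H\<^esub> d"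
    and T: "T \<subseteq> centralizer H {x', y'}"
    and n: "n > 0" "x [^]\<^bsub>G\<^esub> n \<in> S" "f (x [^]\<^bsub>G\<^esub> n) = x' [^]\<^bsub>H\<^esub> n"
    and min: "\<And>i::nat. 0 < i \<Longrightarrow> i < n \<Longrightarrow> x [^]\<^bsub>G\<^esub> i \<notin> adjoin G S y \<and> x' [^]\<^bsub>H\<^esub> i \<notin> adjoin H T y'"
  shows "\<exists>f'. partial_iso G H (adjoin G (adjoin G S y) x) (adjoin H (adjoin H T y') x') f' \<and> f' c = d"
proof -
  have sub: "subgroup S G" "subgroup T H"
    using partial_isoD[OF f] by auto
  have f_one: "f \<one>\<^bsub>G\<^esub> = \<one>\<^bsub>H\<^esub>"
    using partial_iso_pow[OF f c(1), of 0] by simp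
  have "\<exists>s'\<in>S. s \<otimes>\<^bsub>G\<^esub> y = y \<otimes>\<^bsub>G\<^esub> s' \<and> f s \<otimes>\<^bsub>H\<^esub> y' = y' \<otimes>\<^bsub>H\<^esub> f s'" if s: "s \<in> S" for s
    using s S T partial_isoD(5)[OF f s] by (intro bexI[of _ s]) (auto simp: centralizer_def subset_iff)
  moreover have "y [^]\<^bsub>G\<^esub> i \<notin> S \<and> y' [^]\<^bsub>H\<^esub> i \<notin> T" if "0 < i" "i < p" for i :: nat
    using G.pow_not_commute(1)[OF x y(1,3) that] H.pow_not_commute(1)[OF x' y'(1,3) that] S T
    by (auto simp: centralizer_def subset_iff)
  ultimately obtain f1 where f1: "partial_iso G H (adjoin G S y) (adjoin H T y') f1"
    and f1_eq: "\<And>(i::nat) s. s \<in> S \<Longrightarrow> f1 (y [^]\<^bsub>G\<^esub> i \<otimes>\<^bsub>G\<^esub> s) = y' [^]\<^bsub>H\<^esub> i \<otimes>\<^bsub>H\<^esub> f s"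
    using partial_iso_extend[OF f G.fin H.fin y(1) y'(1), of p] G.p_pos y(2) y'(2) f_one
      subgroup.one_closed[OF sub(1)] by auto
  have on_S: "f1 s = f s" if "s \<in> S" for s
    using f1_eq[OF that, of 0] partial_isoD(6,7)[OF f that] by simp
  have S1: "S \<subseteq> adjoin G S y"
    using sub by (intro G.subset_adjoin) (auto dest: subgroup.subset)
  have c1: "c \<in> adjoin G S y" "f1 c = d"
    using S1 c on_S by auto
  have "\<exists>s'\<in>adjoin G S y. s \<otimes>\<^bsub>G\<^esub> x = x \<otimes>\<^bsub>G\<^esub> s' \<and> f1 s \<otimes>\<^bsub>H\<^esub> x' = x' \<otimes>\<^bsub>H\<^esub> f1 s'"
    if s: "s \<in> adjoin G S y" for s
  proof -
    obtain j :: nat and t where t: "t \<in> S" "s = y [^]\<^bsub>G\<^esub> j \<otimes>\<^bsub>G\<^esub> t"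
      using s by (rule adjoinE)
    have cj: "c [^]\<^bsub>G\<^esub> j \<in> adjoin G S y" "f1 (c [^]\<^bsub>G\<^esub> j) = d [^]\<^bsub>H\<^esub> j"
      using G.subgroup_pow_closed[OF partial_isoD(1)[OF f1] c1(1)] partial_iso_pow[OF f1 c1(1)] c1(2) by auto
    have "s \<otimes>\<^bsub>G\<^esub> x = x \<otimes>\<^bsub>G\<^esub> (s \<otimes>\<^bsub>G\<^esub> c [^]\<^bsub>G\<^esub> j)"
      unfolding t(2) using t(1) S partial_isoD(6)[OF f t(1)]
      by (intro G.hyperbolic_conj x y) (auto simp: centralizer_def subset_iff)
    moreover have "f1 s \<otimes>\<^bsub>H\<^esub> x' = x' \<otimes>\<^bsub>H\<^esub> (f1 s \<otimes>\<^bsub>H\<^esub> d [^]\<^bsub>H\<^esub> j)"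
      unfolding t(2) f1_eq[OF t(1)] using T partial_isoD(5,7)[OF f t(1)]
      by (intro H.hyperbolic_conj x' y') (auto simp: centralizer_def subset_iff)
    moreover have "f1 (s \<otimes>\<^bsub>G\<^esub> c [^]\<^bsub>G\<^esub> j) = f1 s \<otimes>\<^bsub>H\<^esub> d [^]\<^bsub>H\<^esub> j"
      using partial_isoD(4)[OF f1 s cj(1)] cj(2) by simp
    ultimately show ?thesis
      using subgroup.m_closed[OF partial_isoD(1)[OF f1] s cj(1)] by metis
  qed
  moreover have "x [^]\<^bsub>G\<^esub> n \<in> adjoin G S y" "f1 (x [^]\<^bsub>G\<^esub> n) = x' [^]\<^bsub>H\<^esub> n"
    using n S1 on_S by auto
  ultimately obtain f2 where f2: "partial_iso G H (adjoin G (adjoin G S y) x) (adjoin H (adjoin H T y') x') f2"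
    and f2_eq: "\<And>(i::nat) s. s \<in> adjoin G S y \<Longrightarrow> f2 (x [^]\<^bsub>G\<^esub> i \<otimes>\<^bsub>G\<^esub> s) = x' [^]\<^bsub>H\<^esub> i \<otimes>\<^bsub>H\<^esub> f1 s"
    using partial_iso_extend[OF f1 G.fin H.fin x x', of n] n(1) min by auto
  have "f2 c = d"
    using f2_eq[OF c1(1), of 0] c1 by simp
  then show ?thesis
    using f2 by blast
qed

text \<open>The condition \<open>f c = d\<close> is carried along because the commutator relations
  to be matched are written with \<open>c\<close> and \<open>d\<close>. Equal orders of the centres
  ensure that in both groups the same kind of piece is split off.\<close>

lemma exponent_p_classification:
  assumes "subgroup S G" "c \<in> S" "\<And>x. x \<in> S \<Longrightarrow> x [^]\<^bsub>G\<^esub> p = \<one>\<^bsub>G\<^esub>"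
    and "subgroup T H" "d \<in> T" "\<And>x. x \<in> T \<Longrightarrow> x [^]\<^bsub>H\<^esub> p = \<one>\<^bsub>H\<^esub>"
    and "card S = card T" "card (S \<inter> centralizer G S) = card (T \<inter> centralizer H T)"
  shows "\<exists>f. partial_iso G H S T f \<and> f c = d"
  using assms
proof (induction "card S" arbitrary: S T rule: less_induct)
  case less
  note S = less.prems(1-3) and T = less.prems(4-6)
  have ZS: "G.cyc \<subseteq> S \<inter> centralizer G S"
    using G.c_in_centralizer[OF subgroup.subset[OF S(1)]] S(2)
    by (intro G.cyc_subset[OF G.subgroup_inter_centralizer[OF S(1)]]) simp
  have ZT: "H.cyc \<subseteq> T \<inter> centralizer H T"
    using H.c_in_centralizer[OF subgroup.subset[OF T(1)]] T(2)
    by (intro H.cyc_subset[OF H.subgroup_inter_centralizer[OF T(1)]]) simp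
  have fS: "finite (S \<inter> centralizer G S)" "finite (T \<inter> centralizer H T)" "finite S" "finite T"
    using G.finite_subgroup[OF S(1)] H.finite_subgroup[OF T(1)] by auto
  have pos: "card T' > 0" if "subgroup T' H" for T'
    using H.finite_subgroup[OF that] subgroup.one_closed[OF that] card_gt_0_iff by blast
  have posG: "card S' > 0" if "subgroup S' G" for S'
    using G.finite_subgroup[OF that] subgroup.one_closed[OF that] card_gt_0_iff by blast
  show ?case
  proof (cases "S \<inter> centralizer G S = G.cyc")
    case False
    have "T \<inter> centralizer H T \<noteq> H.cyc"
      using False ZS less.prems(8) card_subset_eq[OF fS(1) ZS] G.card_cyc H.card_cyc by auto
    then obtain b where b: "b \<in> T" "b \<in> centralizer H T" "b \<notin> H.cyc"
      using ZT by blast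
    obtain a where a: "a \<in> S" "a \<in> centralizer G S" "a \<notin> G.cyc"
      using False ZS by blast
    obtain M where M: "subgroup M G" "c \<in> M" "M \<subseteq> S" "S = adjoin G M a"
      "\<forall>i::nat. 0 < i \<and> i < p \<longrightarrow> a [^]\<^bsub>G\<^esub> i \<notin> M"
      "card S = p * card M" "card (S \<inter> centralizer G S) = p * card (M \<inter> centralizer G M)"
      by (rule G.split_central[OF S a])
    obtain N where N: "subgroup N H" "d \<in> N" "N \<subseteq> T" "T = adjoin H N b"
      "\<forall>i::nat. 0 < i \<and> i < p \<longrightarrow> b [^]\<^bsub>H\<^esub> i \<notin> N"
      "card T = p * card N" "card (T \<inter> centralizer H T) = p * card (N \<inter> centralizer H N)"
      by (rule H.split_central[OF T b])
    have "card M < card S"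
      using M(6) posG[OF M(1)] G.p_gt_2 by simp
    moreover have "card M = card N" "card (M \<inter> centralizer G M) = card (N \<inter> centralizer H N)"
      using M(6,7) N(6,7) less.prems(7,8) G.p_pos by auto
    ultimately obtain f where f: "partial_iso G H M N f" "f c = d"
      using less.hyps[of M N] M(1,2) N(1,2) S(3) T(3) M(3) N(3) by blast
    have carr: "a \<in> carrier G" "b \<in> carrier H"
      using a b by (auto dest: centralizerD(1))
    have "f \<one>\<^bsub>G\<^esub> = \<one>\<^bsub>H\<^esub>"
      using partial_iso_pow[OF f(1) M(2), of 0] by simp
    moreover have "\<exists>s'\<in>M. s \<otimes>\<^bsub>G\<^esub> a = a \<otimes>\<^bsub>G\<^esub> s' \<and> f s \<otimes>\<^bsub>H\<^esub> b = b \<otimes>\<^bsub>H\<^esub> f s'" if s: "s \<in> M" for s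
      using s M(3) N(3) partial_isoD(5)[OF f(1) s] centralizerD(2)[OF a(2), of s]
        centralizerD(2)[OF b(2), of "f s"] by (intro bexI[of _ s]) auto
    ultimately obtain f' where f': "partial_iso G H (adjoin G M a) (adjoin H N b) f'"
      "\<And>(i::nat) s. s \<in> M \<Longrightarrow> f' (a [^]\<^bsub>G\<^esub> i \<otimes>\<^bsub>G\<^esub> s) = b [^]\<^bsub>H\<^esub> i \<otimes>\<^bsub>H\<^esub> f s"
      using partial_iso_extend[OF f(1) G.fin H.fin carr, of p] S(3)[OF a(1)] T(3)[OF b(1)]
        subgroup.one_closed[OF M(1)] M(5) N(5) G.p_pos by auto
    then have "f' c = d"
      using f'(2)[OF M(2), of 0] f(2) by simp
    then show ?thesis
      using f'(1) M(4) N(4) by auto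
  next
    case True
    have TZ: "T \<inter> centralizer H T = H.cyc"
      using True less.prems(8) card_subset_eq[OF fS(2) ZT] G.card_cyc H.card_cyc by simp
    show ?thesis
    proof (cases "S = G.cyc")
      \<comment> \<open>Here only <c> is left, which arises from the trivial group by adjoining
        \<open>c\<close>.\<close>
      case SC: True
      have "T = H.cyc"
        using SC less.prems(7) card_subset_eq[OF fS(4), of H.cyc] ZT G.card_cyc H.card_cyc by auto
      have triv: "partial_iso G H {\<one>\<^bsub>G\<^esub>} {\<one>\<^bsub>H\<^esub>} (\<lambda>_. \<one>\<^bsub>H\<^esub>)"
        using G.triv_subgroup H.triv_subgroup by (simp add: partial_iso_def bij_betw_def)
      have "\<exists>f'. partial_iso G H (adjoin G {\<one>\<^bsub>G\<^esub>} c) (adjoin H {\<one>\<^bsub>H\<^esub>} d) f' \<and>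
          (\<forall>i::nat. \<forall>s\<in>{\<one>\<^bsub>G\<^esub>}. f' (c [^]\<^bsub>G\<^esub> i \<otimes>\<^bsub>G\<^esub> s) = d [^]\<^bsub>H\<^esub> i \<otimes>\<^bsub>H\<^esub> \<one>\<^bsub>H\<^esub>)"
        by (rule partial_iso_extend[OF triv G.fin H.fin G.c_in H.c_in G.p_pos])
          (auto simp: G.c_pow_p H.c_pow_p G.c_pow_eq_one_iff H.c_pow_eq_one_iff dest: dvd_imp_le)
      then obtain f' where "partial_iso G H (adjoin G {\<one>\<^bsub>G\<^esub>} c) (adjoin H {\<one>\<^bsub>H\<^esub>} d) f'"
        "\<And>i::nat. f' (c [^]\<^bsub>G\<^esub> i \<otimes>\<^bsub>G\<^esub> \<one>\<^bsub>G\<^esub>) = d [^]\<^bsub>H\<^esub> i \<otimes>\<^bsub>H\<^esub> \<one>\<^bsub>H\<^esub>"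
        by blast
      moreover from this(2)[of 1] have "f' c = d"
        by simp
      ultimately show ?thesis
        using SC \<open>T = H.cyc\<close> by (auto simp: G.cyc_eq_adjoin H.cyc_eq_adjoin)
    next
      case SC: False
      have "T \<noteq> H.cyc"
        using SC less.prems(7) card_subset_eq[OF fS(3), of G.cyc] ZS G.card_cyc H.card_cyc by auto
      obtain C x y where C: "subgroup C G" "c \<in> C" "C \<subseteq> S" "C \<subseteq> centralizer G {x, y}" "x \<in> S" "y \<in> S"
        "y \<otimes>\<^bsub>G\<^esub> x = x \<otimes>\<^bsub>G\<^esub> y \<otimes>\<^bsub>G\<^esub> c" "S = adjoin G (adjoin G C y) x" "C \<inter> centralizer G C = G.cyc"
        by (rule G.split_hyperbolic[OF S(1,2) True SC])
      obtain D x' y' where D: "subgroup D H" "d \<in> D" "D \<subseteq> T" "D \<subseteq> centralizer H {x', y'}" "x' \<in> T" "y' \<in> T"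
        "y' \<otimes>\<^bsub>H\<^esub> x' = x' \<otimes>\<^bsub>H\<^esub> y' \<otimes>\<^bsub>H\<^esub> d" "T = adjoin H (adjoin H D y') x'" "D \<inter> centralizer H D = H.cyc"
        by (rule H.split_hyperbolic[OF T(1,2) TZ \<open>T \<noteq> H.cyc\<close>])
      have xy: "x \<in> carrier G" "y \<in> carrier G" "x' \<in> carrier H" "y' \<in> carrier H"
        using subgroup.mem_carrier S(1) T(1) C(5,6) D(5,6) by metis+
      note cG = G.card_hyperbolic[OF C(1,2,4) xy(1) S(3)[OF C(5)] xy(2) S(3)[OF C(6)] C(7)]
      note cH = H.card_hyperbolic[OF D(1,2,4) xy(3) T(3)[OF D(5)] xy(4) T(3)[OF D(6)] D(7)]
      have "card C < card S"
      proof -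
        have "1 < p * p"
          using G.p_gt_2 by (intro less_1_mult) auto
        then show ?thesis
          using cG(1) C(8) posG[OF C(1)] by simp
      qed
      moreover have "card C = card D"
        using cG(1) cH(1) C(8) D(8) less.prems(7) G.p_pos by simp
      moreover have "card (C \<inter> centralizer G C) = card (D \<inter> centralizer H D)"
        using C(9) D(9) G.card_cyc H.card_cyc by simp
      ultimately obtain f where f: "partial_iso G H C D f" "f c = d"
        using less.hyps[of C D] C(1,2) D(1,2) S(3) T(3) C(3) D(3) by blast
      have "f \<one>\<^bsub>G\<^esub> = \<one>\<^bsub>H\<^esub>"
        using partial_iso_pow[OF f(1) C(2), of 0] by simp
      then have "\<exists>f'. partial_iso G H (adjoin G (adjoin G C y) x) (adjoin H (adjoin H D y') x') f' \<and> f' c = d"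
        using S(3)[OF C(5)] T(3)[OF D(5)] subgroup.one_closed[OF C(1)] cG(3) cH(3) G.p_pos
        by (intro extend_hyperbolic[OF f(1) C(2) f(2) xy(1,2) S(3)[OF C(6)] C(7,4) xy(3,4) T(3)[OF D(6)] D(7,4), of p])
          auto
      then show ?thesis
        using C(8) D(8) by simp
    qed
  qed
qed

end

section \<open>The kernel of the p-th power map and one further generator\<close>

context central_ext
begin

definition Omega :: "'a set" where
  "Omega = {g \<in> carrier G. g [^] p = \<one>}"

lemma OmegaD: "g \<in> Omega \<Longrightarrow> g \<in> carrier G" "g \<in> Omega \<Longrightarrow> g [^] p = \<one>"
  by (auto simp: Omega_def)

lemma subgroup_Omega: "subgroup Omega G"
  by (rule finite_subgroupI[OF fin]) (auto simp: Omega_def mult_pow_p intro!: exI[of _ \<one>])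

lemma c_in_Omega: "c \<in> Omega"
  by (simp add: Omega_def c_pow_p)

lemma pow_eq_one_iff:
  assumes x: "x \<in> carrier G" "x [^] (p ^ k) = c"
  shows "x [^] (i::nat) = \<one> \<longleftrightarrow> p ^ Suc k dvd i"
proof -
  have "x [^] (p ^ Suc k) = (x [^] (p ^ k)) [^] p"
    using x(1) by (simp add: nat_pow_pow mult.commute)
  also have "\<dots> = \<one>"
    using x c_pow_p by simp
  finally have "ord x dvd p ^ Suc k"
    using x pow_eq_id by blast
  then obtain j where j: "j \<le> Suc k" "ord x = p ^ j"
    using prime divides_primepow_nat by blast
  have "j = Suc k"
  proof (rule ccontr)
    assume "j \<noteq> Suc k"
    then have "ord x dvd p ^ k"
      using j by (simp add: le_imp_power_dvd)
    then have "x [^] (p ^ k) = \<one>"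
      using x pow_eq_id by blast
    then show False
      using x c_ne by simp
  qed
  then show ?thesis
    using j x pow_eq_id by simp
qed

lemma pow_not_in_Omega:
  assumes x: "x \<in> carrier G" "x [^] (p ^ k) = c" and i: "0 < i" "i < p ^ k"
  shows "x [^] (i::nat) \<notin> Omega"
proof
  assume "x [^] i \<in> Omega"
  then have "x [^] (i * p) = \<one>"
    using x by (simp add: Omega_def nat_pow_pow)
  then have "p ^ Suc k dvd i * p"
    using pow_eq_one_iff[OF x] by blast
  then have "p ^ k dvd i"
    using p_pos by (simp add: mult.commute)
  then show False
    using i by (auto dest: dvd_imp_le)
qed

lemma root_quotient_in_Omega:
  assumes x: "x \<in> carrier G" and g: "g \<in> carrier G" "g [^] p = (x [^] p) [^] (j::nat)"
  shows "inv (x [^] j) \<otimes> g \<in> Omega"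
proof -
  have "(inv (x [^] j)) [^] p = inv ((x [^] p) [^] j)"
    using x by (simp add: nat_pow_inv nat_pow_pow mult.commute)
  then have "(inv (x [^] j) \<otimes> g) [^] p = \<one>"
    using x g by (simp add: mult_pow_p)
  then show ?thesis
    using x g by (simp add: Omega_def)
qed

text \<open>By \<open>roots\<close>, the image of the \<open>p\<close>-th power homomorphism is
  generated by the image of \<open>x\<close>, so each element differs from a power of
  \<open>x\<close> by an element of the kernel \<open>Omega\<close>.\<close>

lemma carrier_eq_adjoin_Omega:
  assumes x: "x \<in> carrier G" and roots: "\<And>g. g \<in> carrier G \<Longrightarrow> \<exists>j::nat. g [^] p = (x [^] p) [^] j"
  shows "carrier G = adjoin G Omega x"
proof
  show "carrier G \<subseteq> adjoin G Omega x"
  proof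
    fix g assume g: "g \<in> carrier G"
    then obtain j :: nat where "g [^] p = (x [^] p) [^] j"
      using roots by blast
    then have "inv (x [^] j) \<otimes> g \<in> Omega"
      using x g by (intro root_quotient_in_Omega)
    then have "x [^] j \<otimes> (inv (x [^] j) \<otimes> g) \<in> adjoin G Omega x"
      by (rule adjoinI)
    then show "g \<in> adjoin G Omega x"
      using x g by simp
  qed
qed (use x in \<open>auto simp: adjoin_def dest: OmegaD(1)\<close>)

lemma card_carrier_adjoin_Omega:
  assumes x: "x \<in> carrier G" "x [^] (p ^ k) = c"
    and roots: "\<And>g. g \<in> carrier G \<Longrightarrow> \<exists>j::nat. g [^] p = (x [^] p) [^] j"
  shows "card (carrier G) = p ^ k * card Omega"
proof -
  have "card (adjoin G Omega x) = p ^ k * card Omega"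
    using x subgroup_Omega pow_not_in_Omega[OF x] c_in_Omega by (intro card_adjoin) auto
  then show ?thesis
    using carrier_eq_adjoin_Omega[OF x(1) roots] by simp
qed

text \<open>A central \<open>z\<close> imposes no commutation condition, so the centre is generated
  by \<open>z\<close> and the centre of \<open>Omega\<close>.\<close>

lemma card_center_central_generator:
  assumes z: "z \<in> center G" "z [^] (p ^ k) = c"
    and roots: "\<And>g. g \<in> carrier G \<Longrightarrow> \<exists>j::nat. g [^] p = (z [^] p) [^] j"
  shows "card (center G) = p ^ k * card (Omega \<inter> centralizer G Omega)"
proof -
  have zG: "z \<in> carrier G"
    using z(1) by (rule centerD(1))
  have Z: "subgroup (Omega \<inter> centralizer G Omega) G"
    by (rule subgroup_inter_centralizer[OF subgroup_Omega])
  have "center G = adjoin G (Omega \<inter> centralizer G Omega) z"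
  proof
    show "center G \<subseteq> adjoin G (Omega \<inter> centralizer G Omega) z"
    proof
      fix g assume g: "g \<in> center G"
      then have gG: "g \<in> carrier G"
        by (rule centerD(1))
      then obtain j :: nat where j: "g [^] p = (z [^] p) [^] j"
        using roots by blast
      have "inv (z [^] j) \<otimes> g \<in> center G"
        by (intro subgroup.m_closed[OF subgroup_center] subgroup.m_inv_closed[OF subgroup_center]
            subgroup_pow_closed[OF subgroup_center] z(1) g)
      then have "inv (z [^] j) \<otimes> g \<in> centralizer G Omega"
        using subgroup.subset[OF subgroup_Omega] by (rule center_in_centralizer)
      then have "z [^] j \<otimes> (inv (z [^] j) \<otimes> g) \<in> adjoin G (Omega \<inter> centralizer G Omega) z"
        using root_quotient_in_Omega[OF zG gG j] by (intro adjoinI) simp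
      then show "g \<in> adjoin G (Omega \<inter> centralizer G Omega) z"
        using zG gG by simp
    qed
    have "Omega \<inter> centralizer G Omega \<subseteq> center G"
    proof
      fix v assume v: "v \<in> Omega \<inter> centralizer G Omega"
      then have "v \<in> centralizer G (adjoin G Omega z)"
        using centralizer_adjoin[OF subgroup.subset[OF subgroup_Omega], of v z] zG
          centerD(2)[OF z(1), of v] OmegaD(1)[of v] by auto
      then show "v \<in> center G"
        using carrier_eq_adjoin_Omega[OF zG roots] by (simp flip: centralizer_carrier)
    qed
    then show "adjoin G (Omega \<inter> centralizer G Omega) z \<subseteq> center G"
      by (rule adjoin_subset[OF subgroup_center _ z(1)])
  qed
  moreover have "card (adjoin G (Omega \<inter> centralizer G Omega) z) = p ^ k * card (Omega \<inter> centralizer G Omega)"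
    using zG z(2) Z pow_not_in_Omega[OF zG z(2)] c_in_Omega
      c_in_centralizer[OF subgroup.subset[OF subgroup_Omega]] by (intro card_adjoin) auto
  ultimately show ?thesis
    by simp
qed

text \<open>Adjoining one element \<open>y\<close> to a subgroup multiplies its order by
  \<open>p\<close> and divides the order of its centralizer by at most \<open>p\<close>, since
  commutators with \<open>y\<close> lie in <c>. So the product of the two orders does not decrease
  on the way up from the centre; a maximal \<open>M\<close> that satisfies the bound must be
  \<open>K\<close>.\<close>

lemma card_centralizer_ge:
  assumes K: "subgroup K G" "center G \<subseteq> K"
  shows "card (carrier G) * card (center G) \<le> card (centralizer G K) * card K"
proof -
  let ?P = "\<lambda>M. center G \<subseteq> M \<and> M \<subseteq> K \<and>
    card (carrier G) * card (center G) \<le> card (centralizer G M) * card M"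
  have "centralizer G (center G) = carrier G"
  proof (intro equalityI subsetI centralizerI)
    fix x z assume "x \<in> carrier G" "z \<in> center G"
    then show "x \<otimes> z = z \<otimes> x"
      by (rule centerD(2)[symmetric, rotated])
  qed (auto dest: centralizerD(1))
  then have "?P (center G)"
    using K by simp
  then obtain M where M: "subgroup M G" "?P M"
    and max: "\<And>N. subgroup N G \<Longrightarrow> ?P N \<Longrightarrow> M \<subseteq> N \<Longrightarrow> M = N"
  proof (rule finite_maximal_subgroup[OF fin subgroup_center, of ?P])
  qed (use that in blast)
  have "M = K"
  proof (rule ccontr)
    assume "M \<noteq> K"
    then obtain y where y: "y \<in> K" "y \<notin> M"
      using M by blast
    have yG: "y \<in> carrier G"
      using K(1) y(1) by (rule subgroup.mem_carrier)
    have subM: "M \<subseteq> carrier G"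
      using M(1) by (rule subgroup.subset)
    have cM: "c \<in> M"
      using M(2) c_in_center by blast
    define N where "N = adjoin G M y"
    have N: "subgroup N G" "M \<subseteq> N" "y \<in> N" "N \<subseteq> K"
      unfolding N_def using subgroup_adjoin_c[OF M(1) cM yG] subset_adjoin[OF subM]
        mem_adjoin[OF M(1) yG] adjoin_subset[OF K(1) _ y(1)] M(2) by auto
    have yp: "y [^] p \<in> M"
      using pow_p_in_center[OF yG] M(2) by blast
    have "y [^] i \<notin> M" if "0 < i" "i < p" for i :: nat
      using mem_of_coprime_pow_mem[OF M(1) yG yp _ coprime_less[OF that]] y by blast
    then have cardN: "card N = p * card M"
      unfolding N_def using yp M(1) yG by (intro card_adjoin) auto
    have CN: "centralizer G N = centralizer G M \<inter> centralizer G {y}"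
    proof
      show "centralizer G N \<subseteq> centralizer G M \<inter> centralizer G {y}"
        using N by (auto simp: centralizer_def)
      show "centralizer G M \<inter> centralizer G {y} \<subseteq> centralizer G N"
        unfolding N_def using centralizer_adjoin[OF subM _ yG] centralizerD(2)[of _ G "{y}" y] by auto
    qed
    \<comment> \<open>If some \<open>x\<close> centralizes \<open>M\<close> but not
      \<open>y\<close>, its powers correct every element that centralizes \<open>M\<close> to one
      that also commutes with \<open>y\<close>.\<close>
    have "card (centralizer G M) \<le> p * card (centralizer G N)"
    proof (cases "centralizer G M \<subseteq> centralizer G {y}")
      case True
      then have "centralizer G N = centralizer G M"
        using CN by blast
      then show ?thesis
        using p_gt_2 by simp
    next
      case False
      then obtain x where x: "x \<in> centralizer G M" "x \<notin> centralizer G {y}"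
        by blast
      have xG: "x \<in> carrier G" and xy: "x \<otimes> y \<noteq> y \<otimes> x"
        using x by (auto simp: centralizer_def)
      obtain j :: nat where j: "x [^] j \<otimes> y = y \<otimes> x [^] j \<otimes> c"
        using normalize_commutator[OF yG xG xy] by blast
      define a where "a = x [^] j"
      have aG: "a \<in> carrier G" and ay: "a \<otimes> y = y \<otimes> a \<otimes> c"
        using xG j by (auto simp: a_def)
      have subN: "subgroup (centralizer G N) G" and subCM: "subgroup (centralizer G M) G"
        by (rule subgroup_centralizer[OF subgroup.subset[OF N(1)]], rule subgroup_centralizer[OF subM])
      have aM: "a \<in> centralizer G M"
        unfolding a_def using subCM x(1) by (rule subgroup_pow_closed)
      have "centralizer G M \<subseteq> adjoin G (centralizer G N) a"
      proof
        fix g assume g: "g \<in> centralizer G M"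
        then have gG: "g \<in> carrier G"
          by (rule centralizerD(1))
        obtain m :: nat where m: "a [^] m \<otimes> g \<otimes> y = y \<otimes> (a [^] m \<otimes> g)"
          by (rule commuting_multiple[OF yG aG ay gG])
        have "a [^] m \<otimes> g \<in> centralizer G M"
          using subgroup_pow_closed[OF subCM aM] g by (rule subgroup.m_closed[OF subCM])
        then have v: "a [^] m \<otimes> g \<in> centralizer G N"
          unfolding CN using m aG gG by (auto intro!: centralizerI)
        have sub: "subgroup (adjoin G (centralizer G N) a) G"
          using subN aG c_in_centralizer[OF subgroup.subset[OF N(1)]] by (intro subgroup_adjoin_c)
        have "g = inv (a [^] m) \<otimes> (a [^] m \<otimes> g)"
          using aG gG by simp
        also have "\<dots> \<in> adjoin G (centralizer G N) a"
          using subset_adjoin[OF subgroup.subset[OF subN]] v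
          by (intro subgroup.m_closed[OF sub subgroup.m_inv_closed[OF sub subgroup_pow_closed[OF sub]]]
              mem_adjoin[OF subN aG]) blast
        finally show "g \<in> adjoin G (centralizer G N) a" .
      qed
      moreover have "card (adjoin G (centralizer G N) a) = p * card (centralizer G N)"
      proof (rule card_adjoin[OF subN aG p_pos])
        show "a [^] p \<in> centralizer G N"
          using pow_p_in_center[OF aG] subgroup.subset[OF N(1)] by (rule center_in_centralizer)
        fix i :: nat assume "0 < i" "i < p"
        then show "a [^] i \<notin> centralizer G N"
          unfolding CN using pow_not_commute(1)[OF yG aG ay] by (auto simp: centralizer_def)
      qed
      moreover have "finite (adjoin G (centralizer G N) a)"
        using fin aG centralizerD(1)[of _ G N] by (auto simp: adjoin_def intro: finite_subset[OF _ fin])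
      ultimately show ?thesis
        using card_mono by metis
    qed
    then have "card (centralizer G M) * card M \<le> card (centralizer G N) * card N"
      unfolding cardN by (metis mult.assoc mult.commute mult_le_mono1)
    then have "?P N"
      using M(2) N by auto
    then have "M = N"
      using max N by blast
    then show False
      using N y by blast
  qed
  then show ?thesis
    using M by simp
qed

text \<open>The elements killed by p^(k+1) form a subgroup \<open>Y\<close> of index
  \<open>p\<close> that contains the centre, so by the preceding bound its centralizer exceeds the
  centre. A noncentral element of it is moved into \<open>Omega\<close> by a central power of
  \<open>x\<close>.\<close>

lemma ex_noncentral_centralizing_Omega:
  assumes x: "x \<in> carrier G" "x [^] (p ^ Suc k) = c"
    and roots: "\<And>g. g \<in> carrier G \<Longrightarrow> \<exists>j::nat. g [^] p = (x [^] p) [^] j"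
    and exp: "\<And>z. z \<in> center G \<Longrightarrow> z [^] (p ^ Suc k) = \<one>"
  obtains w where "w \<in> Omega" "w \<in> centralizer G Omega" "w \<otimes> x = x \<otimes> w \<otimes> c"
proof -
  define Y where "Y = {g \<in> carrier G. g [^] (p ^ Suc k) = \<one>}"
  have Y: "subgroup Y G"
    using mult_pow_p_mult[of _ _ "p ^ k"]
    by (intro finite_subgroupI fin) (auto simp: Y_def intro!: exI[of _ \<one>])
  have YG: "Y \<subseteq> carrier G"
    using Y by (rule subgroup.subset)
  have ZY: "center G \<subseteq> Y"
    using exp by (auto simp: Y_def dest: centerD(1))
  have xp: "x [^] p \<in> Y"
  proof -
    have "(x [^] p) [^] (p ^ Suc k) = (x [^] (p ^ Suc k)) [^] p"
      using x(1) by (simp add: nat_pow_pow mult.commute)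
    then show ?thesis
      using x c_pow_p by (simp add: Y_def)
  qed
  have c_pow: "(x [^] p) [^] (p ^ k * j) = c [^] j" for j :: nat
    using x by (simp add: nat_pow_pow flip: x(2) mult.assoc)
  have min: "x [^] i \<notin> Y" if "0 < i" "i < p" for i :: nat
  proof
    assume "x [^] i \<in> Y"
    then have "(x [^] i) [^] (p ^ Suc k) = \<one>"
      by (simp add: Y_def)
    moreover have "(x [^] i) [^] (p ^ Suc k) = c [^] i"
      unfolding x(2)[symmetric] using x(1) by (simp add: nat_pow_pow mult.commute)
    ultimately have "c [^] i = \<one>"
      by simp
    then show False
      using that by (auto simp: c_pow_eq_one_iff dest: dvd_imp_le)
  qed
  have carrier: "carrier G = adjoin G Y x"
  proof
    have "Omega \<subseteq> Y"
      by (auto simp: Omega_def Y_def nat_pow_pow[symmetric])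
    then show "carrier G \<subseteq> adjoin G Y x"
      using carrier_eq_adjoin_Omega[OF x(1) roots] by (auto simp: adjoin_def)
  qed (use x YG in \<open>auto simp: adjoin_def\<close>)
  have "card (carrier G) = p * card Y"
    unfolding carrier using Y x xp min by (intro card_adjoin) auto
  then have "p * card Y * card (center G) \<le> card (centralizer G Y) * card Y"
    using card_centralizer_ge[OF Y ZY] by simp
  moreover have "card Y > 0"
    using finite_subgroup[OF Y] subgroup.one_closed[OF Y] card_gt_0_iff by blast
  ultimately have "p * card (center G) \<le> card (centralizer G Y)"
    by (simp add: mult.commute mult.left_commute)
  moreover have "card (center G) > 0"
    using finite_subgroup[OF subgroup_center] subgroup.one_closed[OF subgroup_center] card_gt_0_iff by blast
  then have "card (center G) < p * card (center G)"
    using p_gt_2 by simp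
  ultimately have "card (center G) < card (centralizer G Y)"
    by linarith
  then have "\<not> centralizer G Y \<subseteq> center G"
    using card_mono[OF finite_subgroup[OF subgroup_center], of "centralizer G Y"] by linarith
  then obtain u where u: "u \<in> centralizer G Y" "u \<notin> center G"
    by blast
  have uG: "u \<in> carrier G"
    using u(1) by (rule centralizerD(1))
  have not_comm: "v \<otimes> x \<noteq> x \<otimes> v" if "v \<in> centralizer G Y" "v \<notin> center G" for v
    using centralizer_adjoin[OF YG that(1) x(1)] that(2) by (auto simp flip: carrier centralizer_carrier)
  \<comment> \<open>Otherwise \<open>u\<close> is an element of \<open>Y\<close> times a power of
    \<open>x\<close> with exponent prime to \<open>p\<close>. As \<open>u\<close> commutes with the
    element of \<open>Y\<close>, it would commute with \<open>x\<close>, and so be central.\<close>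
  have "u \<in> Y"
  proof (rule ccontr)
    assume "u \<notin> Y"
    obtain i :: nat and v where v: "v \<in> Y" "u = x [^] i \<otimes> v"
      using uG carrier by (auto elim: adjoinE)
    have vG: "v \<in> carrier G"
      using v YG by blast
    have subu: "subgroup (centralizer G {u}) G"
      using uG by (intro subgroup_centralizer) auto
    have "\<not> p dvd i"
    proof
      assume "p dvd i"
      then have "x [^] i \<in> Y"
        using xp x(1) subgroup_pow_closed[OF Y xp] by (auto simp: nat_pow_pow)
      then show False
        using \<open>u \<notin> Y\<close> v subgroup.m_closed[OF Y] by blast
    qed
    then have "coprime i p"
      using prime prime_imp_coprime_nat coprime_commute by blast
    moreover have "x [^] i \<in> centralizer G {u}"
    proof -
      have "x [^] i = u \<otimes> inv v"
        using v x(1) vG by (simp add: m_assoc)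
      also have "\<dots> \<in> centralizer G {u}"
        using uG vG centralizerD(2)[OF u(1) v(1)]
        by (intro subgroup.m_closed[OF subu] subgroup.m_inv_closed[OF subu]) (auto simp: centralizer_def)
      finally show ?thesis .
    qed
    moreover have "x [^] p \<in> centralizer G {u}"
      using pow_p_in_center[OF x(1)] uG by (intro center_in_centralizer) auto
    ultimately have "x \<in> centralizer G {u}"
      using mem_of_coprime_pow_mem[OF subu x(1)] by blast
    then show False
      using not_comm[OF u] by (simp add: centralizer_def)
  qed
  obtain j :: nat where j: "u [^] p = (x [^] p) [^] j"
    using roots uG by blast
  \<comment> \<open>Membership of \<open>u\<close> in \<open>Y\<close> forces p | j, so that
    \<open>x [^] j\<close> is a power of the central element \<open>x [^] p\<close>.\<close>
  have "c [^] j = \<one>"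
  proof -
    have "c [^] j = (x [^] p) [^] (p ^ k * j)"
      by (rule c_pow[symmetric])
    also have "\<dots> = (u [^] p) [^] (p ^ k)"
      unfolding j using x(1) by (simp add: nat_pow_pow mult_ac)
    also have "\<dots> = \<one>"
      using \<open>u \<in> Y\<close> by (simp add: Y_def nat_pow_pow)
    finally show ?thesis .
  qed
  then obtain l where l: "j = p * l"
    by (auto simp: c_pow_eq_one_iff)
  define w0 where "w0 = inv (x [^] j) \<otimes> u"
  have w0: "w0 \<in> Omega"
    unfolding w0_def by (rule root_quotient_in_Omega[OF x(1) uG j])
  have "x [^] j = (x [^] p) [^] l"
    using x(1) by (simp add: l nat_pow_pow)
  then have xj: "x [^] j \<in> center G"
    using subgroup_pow_closed[OF subgroup_center pow_p_in_center[OF x(1)]] by simp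
  have subC: "subgroup (centralizer G Y) G"
    using YG by (rule subgroup_centralizer)
  have xjC: "x [^] j \<in> centralizer G Y"
    using xj YG by (rule center_in_centralizer)
  have w0C: "w0 \<in> centralizer G Y"
    unfolding w0_def by (intro subgroup.m_closed[OF subC] subgroup.m_inv_closed[OF subC] xjC u(1))
  have "w0 \<notin> center G"
  proof
    assume "w0 \<in> center G"
    then have "x [^] j \<otimes> w0 \<in> center G"
      by (rule subgroup.m_closed[OF subgroup_center xj])
    then show False
      using u(2) x(1) uG by (simp add: w0_def)
  qed
  then have "w0 \<otimes> x \<noteq> x \<otimes> w0"
    by (rule not_comm[OF w0C])
  then obtain m :: nat where m: "w0 [^] m \<otimes> x = x \<otimes> w0 [^] m \<otimes> c"
    using normalize_commutator[OF x(1) OmegaD(1)[OF w0]] by blast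
  have "w0 [^] m \<in> Omega"
    using subgroup_Omega w0 by (rule subgroup_pow_closed)
  moreover have "w0 [^] m \<in> centralizer G Omega"
  proof -
    have "w0 [^] m \<in> centralizer G Y"
      using subC w0C by (rule subgroup_pow_closed)
    moreover have "Omega \<subseteq> Y"
      by (auto simp: Omega_def Y_def nat_pow_pow[symmetric])
    ultimately show ?thesis
      by (auto simp: centralizer_def)
  qed
  ultimately show ?thesis
    using that m by blast
qed

text \<open>\<open>w\<close> is central in \<open>Omega\<close> and has commutator \<open>c\<close>
  with \<open>x\<close>, so \<open>G\<close> is the product of the commuting subgroups
  \<open>C\<close> and <x, w>. The centre consists of the centre of \<open>C\<close> times the
  powers of \<open>x [^] p\<close>, and \<open>x [^] p\<close> has order p^k modulo
  \<open>C\<close>.\<close>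

lemma noncentral_generator_structure:
  assumes x: "x \<in> carrier G" "x [^] (p ^ Suc k) = c"
    and roots: "\<And>g. g \<in> carrier G \<Longrightarrow> \<exists>j::nat. g [^] p = (x [^] p) [^] j"
    and exp: "\<And>z. z \<in> center G \<Longrightarrow> z [^] (p ^ Suc k) = \<one>"
    and w: "w \<in> Omega" "w \<in> centralizer G Omega" "w \<otimes> x = x \<otimes> w \<otimes> c"
  defines "C \<equiv> Omega \<inter> centralizer G {x, w}"
  shows "subgroup C G" "c \<in> C" "Omega = adjoin G C w"
    "card (carrier G) = p ^ Suc k * (p * card C)"
    "card (center G) = p ^ k * card (C \<inter> centralizer G C)"
proof -
  have wG: "w \<in> carrier G"
    using w(1) by (rule OmegaD(1))
  show C: "subgroup C G"
    unfolding C_def using x wG by (intro subgroups_Inter_pair subgroup_Omega subgroup_centralizer) auto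
  show cC: "c \<in> C"
    using c_in_Omega c_in_centralizer x wG by (simp add: C_def)
  have Cw: "subgroup (adjoin G C w) G"
    using C cC wG by (rule subgroup_adjoin_c)
  have CG: "C \<subseteq> carrier G"
    using C by (rule subgroup.subset)
  show Om: "Omega = adjoin G C w"
  proof
    show "Omega \<subseteq> adjoin G C w"
    proof
      fix v assume v: "v \<in> Omega"
      then have vG: "v \<in> carrier G"
        by (rule OmegaD(1))
      obtain m :: nat where m: "w [^] m \<otimes> v \<otimes> x = x \<otimes> (w [^] m \<otimes> v)"
        by (rule commuting_multiple[OF x(1) wG w(3) vG])
      have wv: "w [^] m \<otimes> v \<in> Omega"
        using subgroup_pow_closed[OF subgroup_Omega w(1)] v by (rule subgroup.m_closed[OF subgroup_Omega])
      then have "w [^] m \<otimes> v \<in> C"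
        using m centralizerD(2)[OF w(2) wv] wG vG by (auto simp: C_def intro!: centralizerI)
      moreover have "v = inv (w [^] m) \<otimes> (w [^] m \<otimes> v)"
        using wG vG by simp
      ultimately show "v \<in> adjoin G C w"
        using subgroup.m_closed[OF Cw subgroup.m_inv_closed[OF Cw subgroup_pow_closed[OF Cw mem_adjoin[OF C wG]]]]
          subset_adjoin[OF CG] by (metis subsetD)
    qed
    show "adjoin G C w \<subseteq> Omega"
      by (rule adjoin_subset[OF subgroup_Omega _ w(1)]) (simp add: C_def)
  qed
  have "card Omega = p * card C"
  proof -
    have "w [^] i \<notin> C" if "0 < i" "i < p" for i :: nat
      using pow_not_commute(1)[OF x(1) wG w(3) that] by (auto simp: C_def centralizer_def)
    then have "card (adjoin G C w) = p * card C"
      using C wG OmegaD(2)[OF w(1)] subgroup.one_closed[OF C] by (intro card_adjoin) auto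
    then show ?thesis
      using Om by simp
  qed
  then show "card (carrier G) = p ^ Suc k * (p * card C)"
    using card_carrier_adjoin_Omega[OF x roots] by simp
  have xpG: "x [^] p \<in> carrier G" and xpZ: "x [^] p \<in> center G"
    using x pow_p_in_center by auto
  have Z: "subgroup (C \<inter> centralizer G C) G"
    using C by (rule subgroup_inter_centralizer)
  have ZC: "C \<inter> centralizer G C \<subseteq> center G"
  proof
    fix v assume v: "v \<in> C \<inter> centralizer G C"
    then have "v \<otimes> x = x \<otimes> v" "v \<otimes> w = w \<otimes> v" "v \<in> centralizer G C"
      by (auto simp: C_def centralizer_def)
    then have "v \<in> centralizer G (adjoin G C w)"
      using centralizer_adjoin[OF CG _ wG] by blast
    then have "v \<in> centralizer G Omega"
      using Om by simp
    then have "v \<in> centralizer G (adjoin G Omega x)"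
      using centralizer_adjoin[OF subgroup.subset[OF subgroup_Omega] _ x(1)] \<open>v \<otimes> x = x \<otimes> v\<close> by blast
    then show "v \<in> center G"
      using carrier_eq_adjoin_Omega[OF x(1) roots] by (simp flip: centralizer_carrier)
  qed
  have "center G = adjoin G (C \<inter> centralizer G C) (x [^] p)"
  proof
    show "adjoin G (C \<inter> centralizer G C) (x [^] p) \<subseteq> center G"
      by (rule adjoin_subset[OF subgroup_center ZC xpZ])
    show "center G \<subseteq> adjoin G (C \<inter> centralizer G C) (x [^] p)"
    proof
      fix z assume z: "z \<in> center G"
      then have zG: "z \<in> carrier G"
        by (rule centerD(1))
      obtain j :: nat where j: "z [^] p = (x [^] p) [^] j"
        using roots zG by blast
      \<comment> \<open>The bound on the exponent of the centre forces p | j, so the contribution of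
        \<open>x\<close> to \<open>z\<close> is a power of \<open>x [^] p\<close>.\<close>
      have "c [^] j = (z [^] p) [^] (p ^ k)"
        unfolding j x(2)[symmetric] using x(1) by (simp add: nat_pow_pow mult_ac)
      also have "\<dots> = \<one>"
        using exp[OF z] zG by (simp add: nat_pow_pow)
      finally obtain l where l: "j = p * l"
        by (auto simp: c_pow_eq_one_iff)
      have xj: "x [^] j = (x [^] p) [^] l"
        using x(1) by (simp add: l nat_pow_pow)
      have v: "inv (x [^] j) \<otimes> z \<in> Omega"
        by (rule root_quotient_in_Omega[OF x(1) zG j])
      have vZ: "inv (x [^] j) \<otimes> z \<in> center G"
        unfolding xj
        by (intro subgroup.m_closed[OF subgroup_center] subgroup.m_inv_closed[OF subgroup_center]
            subgroup_pow_closed[OF subgroup_center] xpZ z)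
      have "inv (x [^] j) \<otimes> z \<in> centralizer G C" "inv (x [^] j) \<otimes> z \<in> centralizer G {x, w}"
        using center_in_centralizer[OF vZ] CG x(1) wG by auto
      then have "(x [^] p) [^] l \<otimes> (inv (x [^] j) \<otimes> z) \<in> adjoin G (C \<inter> centralizer G C) (x [^] p)"
        using v by (intro adjoinI) (simp add: C_def)
      then show "z \<in> adjoin G (C \<inter> centralizer G C) (x [^] p)"
        using x(1) zG unfolding xj[symmetric] by simp
    qed
  qed
  moreover have "card (adjoin G (C \<inter> centralizer G C) (x [^] p)) = p ^ k * card (C \<inter> centralizer G C)"
  proof (rule card_adjoin[OF Z xpG])
    have c: "(x [^] p) [^] (p ^ k) = c"
      using x by (simp add: nat_pow_pow)
    then show "(x [^] p) [^] (p ^ k) \<in> C \<inter> centralizer G C"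
      using cC c_in_centralizer[OF CG] by simp
    fix i :: nat assume "0 < i" "i < p ^ k"
    then show "(x [^] p) [^] i \<notin> C \<inter> centralizer G C"
      using pow_not_in_Omega[OF xpG c] by (auto simp: C_def)
  qed simp
  ultimately show "card (center G) = p ^ k * card (C \<inter> centralizer G C)"
    by simp
qed

end

context central_ext_pair
begin

lemma iso_of_partial_iso:
  assumes "partial_iso G H (carrier G) (carrier H) f"
  shows "G \<cong> H"
  using partial_isoD[OF assms] by (auto simp: is_iso_def iso_def hom_def)

text \<open>The kernels \<open>Omega\<close> are matched by the classification in exponent
  \<open>p\<close>, sending \<open>c\<close> to \<open>d\<close>. A central generator acts
  trivially, so only its power \<open>p ^ k\<close> has to be matched.\<close>

lemma iso_central_generator:
  assumes z: "z \<in> center G" "z [^]\<^bsub>G\<^esub> (p ^ k) = c"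
    and roots: "\<And>g. g \<in> carrier G \<Longrightarrow> \<exists>j::nat. g [^]\<^bsub>G\<^esub> p = (z [^]\<^bsub>G\<^esub> p) [^]\<^bsub>G\<^esub> j"
    and z': "z' \<in> center H" "z' [^]\<^bsub>H\<^esub> (p ^ k) = d"
    and roots': "\<And>h. h \<in> carrier H \<Longrightarrow> \<exists>j::nat. h [^]\<^bsub>H\<^esub> p = (z' [^]\<^bsub>H\<^esub> p) [^]\<^bsub>H\<^esub> j"
    and card: "card (carrier G) = card (carrier H)" "card (center G) = card (center H)"
  shows "G \<cong> H"
proof -
  have zG: "z \<in> carrier G" and zH: "z' \<in> carrier H"
    using z z' by (auto dest: centerD(1))
  have "card G.Omega = card H.Omega"
    using G.card_carrier_adjoin_Omega[OF zG z(2) roots] H.card_carrier_adjoin_Omega[OF zH z'(2) roots']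
      card(1) G.p_pos by simp
  moreover have "card (G.Omega \<inter> centralizer G G.Omega) = card (H.Omega \<inter> centralizer H H.Omega)"
    using G.card_center_central_generator[OF z roots] H.card_center_central_generator[OF z' roots']
      card(2) G.p_pos by simp
  ultimately obtain f where f: "partial_iso G H G.Omega H.Omega f" "f c = d"
    using exponent_p_classification[OF G.subgroup_Omega G.c_in_Omega G.OmegaD(2)
        H.subgroup_Omega H.c_in_Omega H.OmegaD(2)] by blast
  have "\<exists>f'. partial_iso G H (adjoin G G.Omega z) (adjoin H H.Omega z') f' \<and>
      (\<forall>i::nat. \<forall>s\<in>G.Omega. f' (z [^]\<^bsub>G\<^esub> i \<otimes>\<^bsub>G\<^esub> s) = z' [^]\<^bsub>H\<^esub> i \<otimes>\<^bsub>H\<^esub> f s)"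
  proof (rule partial_iso_extend[OF f(1) G.fin H.fin zG zH, of "p ^ k"])
    show "z [^]\<^bsub>G\<^esub> (p ^ k) \<in> G.Omega" "f (z [^]\<^bsub>G\<^esub> (p ^ k)) = z' [^]\<^bsub>H\<^esub> (p ^ k)"
      using z z' f G.c_in_Omega by auto
    show "z [^]\<^bsub>G\<^esub> i \<notin> G.Omega \<and> z' [^]\<^bsub>H\<^esub> i \<notin> H.Omega" if "0 < i" "i < p ^ k" for i :: nat
      using G.pow_not_in_Omega[OF zG z(2) that] H.pow_not_in_Omega[OF zH z'(2) that] by simp
    fix s assume s: "s \<in> G.Omega"
    then show "\<exists>s'\<in>G.Omega. s \<otimes>\<^bsub>G\<^esub> z = z \<otimes>\<^bsub>G\<^esub> s' \<and> f s \<otimes>\<^bsub>H\<^esub> z' = z' \<otimes>\<^bsub>H\<^esub> f s'"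
      using centerD(2)[OF z(1), of s] centerD(2)[OF z'(1), of "f s"] partial_isoD(6,7)[OF f(1) s]
      by (intro bexI[of _ s]) auto
  qed (use G.p_pos in simp)
  then show ?thesis
    using iso_of_partial_iso G.carrier_eq_adjoin_Omega[OF zG roots] H.carrier_eq_adjoin_Omega[OF zH roots']
    by auto
qed

text \<open>After \<open>C\<close> and \<open>D\<close> have been matched, \<open>w\<close> and
  \<open>x\<close> are adjoined like a hyperbolic pair, except that \<open>x\<close> has order
  p^(k+1) modulo \<open>Omega\<close> and its power with that exponent is \<open>c\<close>.\<close>

lemma iso_noncentral_generator:
  assumes x: "x \<in> carrier G" "x [^]\<^bsub>G\<^esub> (p ^ Suc k) = c"
    and roots: "\<And>g. g \<in> carrier G \<Longrightarrow> \<exists>j::nat. g [^]\<^bsub>G\<^esub> p = (x [^]\<^bsub>G\<^esub> p) [^]\<^bsub>G\<^esub> j"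
    and exp: "\<And>z. z \<in> center G \<Longrightarrow> z [^]\<^bsub>G\<^esub> (p ^ Suc k) = \<one>\<^bsub>G\<^esub>"
    and x': "x' \<in> carrier H" "x' [^]\<^bsub>H\<^esub> (p ^ Suc k) = d"
    and roots': "\<And>h. h \<in> carrier H \<Longrightarrow> \<exists>j::nat. h [^]\<^bsub>H\<^esub> p = (x' [^]\<^bsub>H\<^esub> p) [^]\<^bsub>H\<^esub> j"
    and exp': "\<And>z. z \<in> center H \<Longrightarrow> z [^]\<^bsub>H\<^esub> (p ^ Suc k) = \<one>\<^bsub>H\<^esub>"
    and card: "card (carrier G) = card (carrier H)" "card (center G) = card (center H)"
  shows "G \<cong> H"
proof -
  obtain w where w: "w \<in> G.Omega" "w \<in> centralizer G G.Omega" "w \<otimes>\<^bsub>G\<^esub> x = x \<otimes>\<^bsub>G\<^esub> w \<otimes>\<^bsub>G\<^esub> c"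
    by (rule G.ex_noncentral_centralizing_Omega[OF x roots exp])
  obtain w' where w': "w' \<in> H.Omega" "w' \<in> centralizer H H.Omega" "w' \<otimes>\<^bsub>H\<^esub> x' = x' \<otimes>\<^bsub>H\<^esub> w' \<otimes>\<^bsub>H\<^esub> d"
    by (rule H.ex_noncentral_centralizing_Omega[OF x' roots' exp'])
  define C where "C = G.Omega \<inter> centralizer G {x, w}"
  define D where "D = H.Omega \<inter> centralizer H {x', w'}"
  note C = G.noncentral_generator_structure[OF x roots exp w, folded C_def]
  note D = H.noncentral_generator_structure[OF x' roots' exp' w', folded D_def]
  have "card C = card D" "card (C \<inter> centralizer G C) = card (D \<inter> centralizer H D)"
    using C(4,5) D(4,5) card G.p_pos by simp_all
  moreover have "s [^]\<^bsub>G\<^esub> p = \<one>\<^bsub>G\<^esub>" if "s \<in> C" for s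
    using that G.OmegaD(2) by (simp add: C_def)
  moreover have "s [^]\<^bsub>H\<^esub> p = \<one>\<^bsub>H\<^esub>" if "s \<in> D" for s
    using that H.OmegaD(2) by (simp add: D_def)
  ultimately obtain f where f: "partial_iso G H C D f" "f c = d"
    using exponent_p_classification[OF C(1,2) _ D(1,2)] by blast
  have "\<exists>f'. partial_iso G H (adjoin G (adjoin G C w) x) (adjoin H (adjoin H D w') x') f' \<and> f' c = d"
  proof (rule extend_hyperbolic[OF f(1) C(2) f(2) x(1) G.OmegaD[OF w(1)] w(3) _ x'(1) H.OmegaD[OF w'(1)] w'(3),
        of "p ^ Suc k"])
    show "x [^]\<^bsub>G\<^esub> (p ^ Suc k) \<in> C" "f (x [^]\<^bsub>G\<^esub> (p ^ Suc k)) = x' [^]\<^bsub>H\<^esub> (p ^ Suc k)"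
      unfolding x(2) x'(2) using C(2) f(2) by auto
    show "x [^]\<^bsub>G\<^esub> i \<notin> adjoin G C w \<and> x' [^]\<^bsub>H\<^esub> i \<notin> adjoin H D w'" if "0 < i" "i < p ^ Suc k" for i :: nat
      using G.pow_not_in_Omega[OF x that] H.pow_not_in_Omega[OF x' that] C(3) D(3) by simp
  qed (use G.p_pos in \<open>simp_all add: C_def D_def\<close>)
  then show ?thesis
    using iso_of_partial_iso G.carrier_eq_adjoin_Omega[OF x(1) roots] H.carrier_eq_adjoin_Omega[OF x'(1) roots']
      C(3) D(3) by auto
qed

end

section \<open>The Frattini subgroup\<close>

text \<open>With u = 1 + p a the powers are 1 + i p a modulo p^2, and the sum of all
  \<open>i\<close> below an odd \<open>p\<close> is a multiple of \<open>p\<close>.\<close>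

lemma geometric_sum_cong:
  fixes u p :: nat
  assumes "odd p" "p > 2" "[u = 1] (mod p)"
  shows "[(\<Sum>i<p. u ^ i) = p] (mod p ^ 2)"
proof -
  define a where "a = u div p"
  have "u mod p = 1"
    using assms by (simp add: cong_def)
  then have u: "u = 1 + p * a"
    unfolding a_def by (metis add.commute mult_div_mod_eq)
  have pow: "[u ^ i = 1 + i * (p * a)] (mod p ^ 2)" for i
  proof (induction i)
    case (Suc i)
    have "[u ^ i * u = (1 + i * (p * a)) * u] (mod p ^ 2)"
      using Suc by (rule cong_scalar_right)
    also have "(1 + i * (p * a)) * u = 1 + Suc i * (p * a) + p ^ 2 * (i * a * a)"
      unfolding u by (simp add: algebra_simps power2_eq_square)
    also have "[\<dots> = 1 + Suc i * (p * a)] (mod p ^ 2)"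
      by (simp add: cong_def)
    finally show ?case
      by (simp add: mult.commute)
  qed simp
  have "[(\<Sum>i<p. u ^ i) = (\<Sum>i<p. 1 + i * (p * a))] (mod p ^ 2)"
    using pow by (intro cong_sum)
  also have "(\<Sum>i<p. 1 + i * (p * a)) = p + (\<Sum>i<p. i) * (p * a)"
    by (simp only: sum.distrib sum_distrib_right) simp
  also have "(\<Sum>i<p. i) = p * ((p - 1) div 2)"
  proof -
    obtain b where "p = 2 * b + 1"
      using assms(1) by (elim oddE)
    then show ?thesis
      using Sum_Ico_nat[of 0 p] by (simp add: atLeast0LessThan)
  qed
  also have "p + p * ((p - 1) div 2) * (p * a) = p + p ^ 2 * ((p - 1) div 2 * a)"
    by (simp add: power2_eq_square)
  also have "[\<dots> = p] (mod p ^ 2)"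
    by (simp add: cong_def)
  finally show ?thesis .
qed

text \<open>u^p - 1 is u - 1 times a geometric sum that is divisible by \<open>p\<close> exactly
  once. So passing from \<open>u\<close> to its \<open>p\<close>-th power gains exactly one factor
  \<open>p\<close>.\<close>

lemma prime_power_dvd_of_dvd_pow_diff_one:
  fixes p k r :: nat
  assumes p: "Factorial_Ring.prime p" "p > 2" and dvd: "[(1 + p * k) ^ p = 1] (mod p ^ r)"
  shows "p ^ r dvd p * (p * k)"
proof -
  define u where "u = 1 + p * k"
  define S where "S = (\<Sum>i<p. u ^ i)"
  have "[u = 1] (mod p)"
    by (simp only: cong_def u_def mod_mult_self2)
  then have "[S = p] (mod p ^ 2)"
    unfolding S_def using p prime_odd_nat by (intro geometric_sum_cong) auto
  then have S: "S mod p ^ 2 = p"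
    using p by (simp add: cong_def power2_eq_square)
  then have "S = p * (1 + p * (S div p ^ 2))"
    using mult_div_mod_eq[of "p ^ 2" S] by (simp add: power2_eq_square algebra_simps)
  then obtain w where w: "S = p * w" "w = 1 + p * (S div p ^ 2)"
    by blast
  have "\<not> p dvd w"
    unfolding w(2) using p dvd_add_left_iff[of p "p * (S div p ^ 2)" 1] by simp
  then have "coprime p w"
    using p(1) prime_imp_coprime_nat by blast
  then have cop: "coprime (p ^ r) w"
    by simp
  have "int u ^ p - 1 = (int u - 1) * (\<Sum>i<p. int u ^ i)"
    by (rule power_diff_1_eq)
  then have eq: "int (u ^ p) - 1 = int (p * k * S)"
    by (simp add: u_def S_def)
  have "[int (u ^ p) = int 1] (mod int (p ^ r))"
    using dvd unfolding u_def cong_int_iff .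
  then have "int (p ^ r) dvd int (p * k * S)"
    unfolding eq[symmetric] by (simp add: cong_iff_dvd_diff)
  then have "p ^ r dvd (p * (p * k)) * w"
    unfolding w(1) int_dvd_int_iff by (simp add: mult_ac)
  then show ?thesis
    using cop coprime_dvd_mult_left_iff by blast
qed

text \<open>Divisibility modulo p^N is governed by the valuation at \<open>p\<close>, hence total.
  If the first alternative fails, the valuation of \<open>j\<close> is strictly larger than that of
  \<open>i\<close>, which leaves room for the factor \<open>p\<close>.\<close>

lemma cong_multiple_total:
  fixes i j p N :: nat
  assumes p: "Factorial_Ring.prime p"
  shows "(\<exists>a. [i = j * a] (mod p ^ N)) \<or> (\<exists>a. [j = i * p * a] (mod p ^ N))"
proof (cases "gcd j (p ^ N) dvd i")
  case True
  then obtain b where b: "i = gcd j (p ^ N) * b"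
    by blast
  have "\<exists>x. [j * x = gcd j (p ^ N)] (mod p ^ N)"
    using p by (cases "j = 0") (auto simp: cong_def intro: cong_solve_nat[unfolded cong_def])
  then obtain x where "[j * x = gcd j (p ^ N)] (mod p ^ N)"
    by blast
  then have "[j * x * b = gcd j (p ^ N) * b] (mod p ^ N)"
    by (rule cong_scalar_right)
  then have "[i = j * (x * b)] (mod p ^ N)"
    unfolding b[symmetric] by (simp add: cong_sym mult.assoc)
  then show ?thesis
    by blast
next
  case False
  obtain u where u: "gcd j (p ^ N) = p ^ u"
    using p divides_primepow_nat[of p "gcd j (p ^ N)" N] by auto
  obtain v where v: "gcd i (p ^ N) = p ^ v"
    using p divides_primepow_nat[of p "gcd i (p ^ N)" N] by auto
  have "v < u"
  proof (rule ccontr)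
    assume "\<not> v < u"
    then have "p ^ u dvd p ^ v"
      by (simp add: le_imp_power_dvd)
    also have "p ^ v dvd i"
      using v by (metis gcd_dvd1)
    finally show False
      using False u by simp
  qed
  then have "p ^ Suc v dvd p ^ u"
    by (intro le_imp_power_dvd) simp
  also have "p ^ u dvd j"
    using u by (metis gcd_dvd1)
  finally obtain b where "j = p ^ Suc v * b"
    by (elim dvdE)
  then have b: "j = p ^ v * p * b"
    by (simp add: mult_ac)
  have "i \<noteq> 0"
    using False by (cases "i = 0") auto
  then obtain x where "[i * x = p ^ v] (mod p ^ N)"
    using cong_solve_nat[of i "p ^ N"] v by auto
  then have "[i * x * (p * b) = p ^ v * (p * b)] (mod p ^ N)"
    by (rule cong_scalar_right)
  then have "[j = i * p * (x * b)] (mod p ^ N)"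
    unfolding b by (simp add: cong_sym mult_ac)
  then show ?thesis
    by blast
qed

context group
begin

lemma pow_cong: "s \<in> carrier G \<Longrightarrow> s [^] (n::nat) = \<one> \<Longrightarrow> [i = j] (mod n) \<Longrightarrow> s [^] (i::nat) = s [^] j"
proof -
  assume s: "s \<in> carrier G" "s [^] n = \<one>" and "[i = j] (mod n)"
  have "s [^] k = s [^] (k mod n)" for k
  proof -
    have "s [^] k = (s [^] n) [^] (k div n) \<otimes> s [^] (k mod n)"
      using s(1) by (simp add: nat_pow_pow nat_pow_mult)
    then show ?thesis
      using s by simp
  qed
  then show ?thesis
    using \<open>[i = j] (mod n)\<close> unfolding cong_def by metis
qed

lemma power_total:
  assumes p: "Factorial_Ring.prime p" and s: "s \<in> carrier G" "s [^] (p ^ N :: nat) = \<one>"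
    and a: "a = s [^] (i::nat)" and b: "b = s [^] (j::nat)"
  shows "(\<exists>k::nat. a = b [^] k) \<or> (\<exists>k::nat. b = (a [^] p) [^] k)"
  using cong_multiple_total[OF p, of i j N]
proof
  assume "\<exists>k. [i = j * k] (mod p ^ N)"
  then obtain k where "[i = j * k] (mod p ^ N)"
    by blast
  then have "a = b [^] k"
    using pow_cong[OF s] s(1) by (simp add: a b nat_pow_pow)
  then show ?thesis
    by blast
next
  assume "\<exists>k. [j = i * p * k] (mod p ^ N)"
  then obtain k where "[j = i * p * k] (mod p ^ N)"
    by blast
  then have "b = (a [^] p) [^] k"
    using pow_cong[OF s] s(1) by (simp add: a b nat_pow_pow)
  then show ?thesis
    by blast
qed

definition comm :: "'a \<Rightarrow> 'a \<Rightarrow> 'a" where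
  "comm x y = inv x \<otimes> inv y \<otimes> x \<otimes> y"

lemma comm_closed: "x \<in> carrier G \<Longrightarrow> y \<in> carrier G \<Longrightarrow> comm x y \<in> carrier G"
  by (simp add: comm_def)

lemma mult_comm: "x \<in> carrier G \<Longrightarrow> y \<in> carrier G \<Longrightarrow> x \<otimes> y = y \<otimes> x \<otimes> comm x y"
  by (simp add: comm_def m_assoc)

lemma conj_power:
  assumes "x \<in> carrier G" "g \<in> carrier G" "x \<otimes> g = g \<otimes> x [^] (u::nat)"
  shows "x [^] (n::nat) \<otimes> g = g \<otimes> x [^] (u * n)" "x \<otimes> g [^] (j::nat) = g [^] j \<otimes> x [^] (u ^ j)"
proof -
  show 1: "x [^] n \<otimes> g = g \<otimes> x [^] (u * n)" for n :: nat
  proof (induction n)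
    case (Suc n)
    have "x [^] Suc n \<otimes> g = x [^] n \<otimes> (x \<otimes> g)"
      using assms(1,2) by (simp add: m_assoc)
    also have "\<dots> = (x [^] n \<otimes> g) \<otimes> x [^] u"
      unfolding assms(3) using assms(1,2) by (simp add: m_assoc)
    also have "\<dots> = g \<otimes> x [^] (u * Suc n)"
      unfolding Suc using assms(1,2) by (simp add: m_assoc nat_pow_mult add.commute)
    finally show ?case .
  qed (use assms in simp)
  show "x \<otimes> g [^] j = g [^] j \<otimes> x [^] (u ^ j)"
  proof (induction j)
    case (Suc j)
    have "x \<otimes> g [^] Suc j = (x \<otimes> g [^] j) \<otimes> g"
      using assms(1,2) by (simp add: m_assoc)
    also have "\<dots> = g [^] j \<otimes> (x [^] (u ^ j) \<otimes> g)"
      unfolding Suc using assms(1,2) by (simp add: m_assoc)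
    also have "\<dots> = g [^] Suc j \<otimes> x [^] (u ^ Suc j)"
      unfolding 1 using assms(1,2) by (simp add: m_assoc)
    finally show ?case .
  qed (use assms in simp)
qed

text \<open>Moving each new \<open>x\<close> to the front raises the power of \<open>t\<close>
  before it to the power \<open>u\<close>, which builds up the geometric sum.\<close>

lemma twisted_mult_power:
  assumes "x \<in> carrier G" "t \<in> carrier G" "t \<otimes> x = x \<otimes> t [^] (u::nat)"
  shows "(x \<otimes> t) [^] (n::nat) = x [^] n \<otimes> t [^] (\<Sum>i<n. u ^ i)"
proof (induction n)
  case (Suc n)
  let ?S = "\<Sum>i<n. u ^ i"
  have "(x \<otimes> t) [^] Suc n = x [^] n \<otimes> (t [^] ?S \<otimes> x) \<otimes> t"
    unfolding nat_pow_Suc Suc using assms(1,2) by (simp add: m_assoc)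
  also have "\<dots> = x [^] Suc n \<otimes> t [^] Suc (u * ?S)"
    unfolding conj_power(1)[OF assms(2,1,3)] using assms(1,2) by (simp add: m_assoc)
  also have "Suc (u * ?S) = (\<Sum>i<Suc n. u ^ i)"
    unfolding sum.lessThan_Suc_shift by (simp add: sum_distrib_left)
  finally show ?case .
qed simp

end

section \<open>Maximal subgroups of a group of prime power order\<close>

locale prime_power_group = finite_group_prime G p for G :: "('a, 'm) monoid_scheme" (structure) and p +
  fixes N :: nat
  assumes order: "order G = p ^ N" and p_gt_2: "p > 2"
begin

lemma pow_order_one: "x \<in> carrier G \<Longrightarrow> x [^] (p ^ N) = \<one>"
  using pow_order_eq_1[of x] order by simp

lemma ord_prime_power:
  assumes "x \<in> carrier G"
  obtains r where "ord x = p ^ r"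
  using ord_dvd_group_order[OF assms] order divides_primepow_nat[OF prime] by auto

text \<open>\<open>M\<close> acts on its right cosets. Their number is divisible by
  \<open>p\<close>, orbits have prime power size, and the coset \<open>M\<close> is fixed; so a
  second coset is fixed, and its representatives normalize \<open>M\<close>.\<close>

lemma ex_normalizing_outside:
  assumes M: "subgroup M G" "M \<noteq> carrier G"
  obtains g where "g \<in> carrier G" "g \<notin> M" "\<And>m. m \<in> M \<Longrightarrow> g \<otimes> m \<otimes> inv g \<in> M"
proof -
  have MG: "M \<subseteq> carrier G"
    using M(1) by (rule subgroup.subset)
  let ?E = "rcosets M"
  let ?M = "G\<lparr>carrier := M\<rparr>"
  \<comment> \<open>The inverse turns multiplication from the right into a left action.\<close>
  define \<phi> where "\<phi> = (\<lambda>m. \<lambda>C\<in>?E. C #> inv m)"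
  have E: "C \<subseteq> carrier G" if "C \<in> ?E" for C
    using that r_coset_subset_G[OF MG] by (auto simp: RCOSETS_def)
  have coset: "C #> g \<in> ?E" if "C \<in> ?E" "g \<in> carrier G" for C g
  proof -
    obtain h where "h \<in> carrier G" "C = M #> h"
      using \<open>C \<in> ?E\<close> by (auto simp: RCOSETS_def)
    then have "C #> g = M #> (h \<otimes> g)" "h \<otimes> g \<in> carrier G"
      using MG that by (auto simp: coset_mult_assoc)
    then show ?thesis
      using MG by (auto intro: rcosetsI)
  qed
  have groupM: "group ?M"
    using M(1) subgroup_imp_group by blast
  have invM: "inv\<^bsub>?M\<^esub> m = inv m" if "m \<in> M" for m
    using m_inv_consistent[OF M(1) that] by simp
  have bij: "\<phi> m \<in> Bij ?E" if m: "m \<in> M" for m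
  proof -
    have mG: "m \<in> carrier G"
      using m MG by blast
    have "bij_betw (\<phi> m) ?E ?E"
    proof (rule bij_betw_byWitness[where f' = "\<lambda>C. C #> m"])
      show "\<forall>C\<in>?E. \<phi> m C #> m = C" "\<forall>C\<in>?E. \<phi> m (C #> m) = C"
        using E coset mG by (auto simp: \<phi>_def coset_mult_assoc coset_mult_one)
      show "\<phi> m ` ?E \<subseteq> ?E" "(\<lambda>C. C #> m) ` ?E \<subseteq> ?E"
        using coset mG by (auto simp: \<phi>_def)
    qed
    then show ?thesis
      by (simp add: Bij_def \<phi>_def)
  qed
  have "\<phi> \<in> hom ?M (BijGroup ?E)"
  proof (rule homI)
    show "\<phi> m \<in> carrier (BijGroup ?E)" if "m \<in> carrier ?M" for m
      using bij that by (simp add: BijGroup_def)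
    fix m n assume "m \<in> carrier ?M" "n \<in> carrier ?M"
    then have mn: "m \<in> M" "n \<in> M" "m \<in> carrier G" "n \<in> carrier G"
      using MG by auto
    have "\<phi> (m \<otimes> n) = compose ?E (\<phi> m) (\<phi> n)"
      using E coset mn by (auto simp: \<phi>_def compose_def fun_eq_iff coset_mult_assoc inv_mult_group)
    then show "\<phi> (m \<otimes>\<^bsub>?M\<^esub> n) = \<phi> m \<otimes>\<^bsub>BijGroup ?E\<^esub> \<phi> n"
      using bij mn by (simp add: BijGroup_def)
  qed
  then interpret A: group_action ?M ?E \<phi>
    using groupM group_BijGroup by (simp add: group_action_def group_hom_def group_hom_axioms_def)
  have finE: "finite ?E"
    using fin E by (meson PowI finite_Pow_iff finite_subset subsetI)
  have lagr: "card ?E * card M = p ^ N"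
    using lagrange[OF M(1)] order by simp
  then obtain a where a: "card ?E = p ^ a"
    using divides_primepow_nat[OF prime] by (metis dvd_triv_left)
  have finM: "finite M"
    using fin MG finite_subset by blast
  have cardM: "card M dvd p ^ N"
    using lagr by (metis dvd_triv_right)
  have "card M \<noteq> p ^ N"
    using card_subset_eq[OF fin MG] M(2) order unfolding order_def by auto
  then have "a \<noteq> 0"
    using a lagr by (metis mult_1 power_0)
  then have pE: "p dvd card ?E"
    using a by simp
  have orbit: "card (orbit ?M \<phi> C) = 1 \<or> p dvd card (orbit ?M \<phi> C)" if "C \<in> ?E" for C
  proof -
    have "card (orbit ?M \<phi> C) * card (stabilizer ?M \<phi> C) = card M"
      using A.orbit_stabilizer_theorem[OF that] by (simp add: order_def)
    then have "card (orbit ?M \<phi> C) dvd p ^ N"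
      using cardM by (metis dvd_trans dvd_triv_left)
    then obtain b where "card (orbit ?M \<phi> C) = p ^ b"
      using divides_primepow_nat[OF prime] by blast
    then show ?thesis
      by (cases b) auto
  qed
  have fixed: "\<phi> m C = C" if C: "C \<in> ?E" "card (orbit ?M \<phi> C) = 1" and m: "m \<in> M" for C m
  proof -
    have "C \<in> orbit ?M \<phi> C" "\<phi> m C \<in> orbit ?M \<phi> C"
      using A.orbit_refl[OF C(1)] m by (auto simp: orbit_def)
    then show ?thesis
      using C(2) by (metis card_1_singletonE singletonD)
  qed
  have ME: "M \<in> ?E"
    using rcosetsI[OF MG, of \<one>] MG by (simp add: coset_mult_one)
  have orbM: "orbit ?M \<phi> M = {M}"
  proof -
    have "\<phi> m M = M" if "m \<in> M" for m
      using that ME M(1) MG by (simp add: \<phi>_def coset_join2 subgroup.m_inv_closed subset_iff)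
    then show ?thesis
      using subgroup.one_closed[OF M(1)] by (auto simp: orbit_def)
  qed
  have "\<exists>C\<in>?E. C \<noteq> M \<and> card (orbit ?M \<phi> C) = 1"
  proof (rule ccontr)
    assume "\<not> (\<exists>C\<in>?E. C \<noteq> M \<and> card (orbit ?M \<phi> C) = 1)"
    then have no: "p dvd card (orbit ?M \<phi> C)" if "C \<in> ?E" "C \<noteq> M" for C
      using orbit that by blast
    have finO: "finite (orbits ?M ?E \<phi>)"
      using finE by (simp add: orbits_def)
    have MO: "{M} \<in> orbits ?M ?E \<phi>"
      using orbM ME by (auto simp: orbits_def)
    have "card ?E = (\<Sum>R\<in>orbits ?M ?E \<phi>. \<Sum>C\<in>R. 1)"
      unfolding card_eq_sum by (rule A.disjoint_sum[OF finE, symmetric])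
    also have "\<dots> = (\<Sum>R\<in>orbits ?M ?E \<phi>. card R)"
      by (rule sum.cong) simp_all
    also have "\<dots> = 1 + (\<Sum>R\<in>orbits ?M ?E \<phi> - {{M}}. card R)"
      using sum.remove[OF finO MO, of card] by simp
    finally have card_eq: "card ?E = 1 + (\<Sum>R\<in>orbits ?M ?E \<phi> - {{M}}. card R)" .
    have "p dvd (\<Sum>R\<in>orbits ?M ?E \<phi> - {{M}}. card R)"
    proof (rule dvd_sum)
      fix R assume "R \<in> orbits ?M ?E \<phi> - {{M}}"
      then obtain C where "C \<in> ?E" "R = orbit ?M \<phi> C" "R \<noteq> {M}"
        by (auto simp: orbits_def)
      then show "p dvd card R"
        using no orbM by auto
    qed
    then have "p dvd 1"
      using pE card_eq by (metis dvd_add_left_iff)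
    then show False
      using p_gt_2 by simp
  qed
  then obtain C where C: "C \<in> ?E" "C \<noteq> M" "card (orbit ?M \<phi> C) = 1"
    by blast
  obtain g where g: "g \<in> carrier G" "C = M #> g"
    using C(1) by (auto simp: RCOSETS_def)
  have "g \<notin> M"
    using C(2) g coset_join2[OF g(1) M(1)] by blast
  moreover have "g \<otimes> m \<otimes> inv g \<in> M" if m: "m \<in> M" for m
  proof -
    have mG: "m \<in> carrier G"
      using m MG by blast
    have "M #> g #> m = M #> g"
      using fixed[OF C(1,3) subgroup.m_inv_closed[OF M(1) m]] C(1) g mG by (simp add: \<phi>_def)
    moreover have "g \<otimes> m \<in> M #> g #> m"
      using subgroup.one_closed[OF M(1)] g mG MG rcos_self[OF _ M(1), of "g \<otimes> m"]
      by (simp add: coset_mult_assoc)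
    ultimately have "g \<otimes> m \<in> M #> g"
      by simp
    then obtain n where n: "n \<in> M" "g \<otimes> m = n \<otimes> g"
      by (auto simp: r_coset_def)
    then have "g \<otimes> m \<otimes> inv g = n"
      using g MG by (simp add: m_assoc subset_iff)
    then show ?thesis
      using n by simp
  qed
  ultimately show ?thesis
    using that g(1) by blast
qed

text \<open>The normalizer is strictly larger than \<open>M\<close>, so \<open>M\<close> is normal.
  Together with any \<open>z\<close> outside whose \<open>p\<close>-th power lies in
  \<open>M\<close> it generates \<open>G\<close>, so the quotient is cyclic of order
  \<open>p\<close>.\<close>

lemma maximal_subgroup_contains:
  assumes M: "maximal_subgroup M G" and x: "x \<in> carrier G" and y: "y \<in> carrier G"
  shows "x [^] p \<in> M" "comm x y \<in> M"
proof -
  have M': "subgroup M G" "M \<noteq> carrier G"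
    and max: "\<And>K. subgroup K G \<Longrightarrow> M \<subseteq> K \<Longrightarrow> K = M \<or> K = carrier G"
    using M by (auto simp: maximal_subgroup_def)
  have MG: "m \<in> carrier G" if "m \<in> M" for m
    using M'(1) that by (rule subgroup.mem_carrier)
  define K where "K = {g \<in> carrier G. \<forall>m\<in>M. g \<otimes> m \<otimes> inv g \<in> M}"
  have MK: "M \<subseteq> K"
    using M'(1) MG by (auto simp: K_def intro!: subgroup.m_closed subgroup.m_inv_closed)
  have "subgroup K G"
  proof (rule finite_subgroupI[OF fin])
    show "K \<noteq> {}"
      using MK subgroup.one_closed[OF M'(1)] by blast
    fix g h assume g: "g \<in> K" and h: "h \<in> K"
    have "g \<otimes> h \<otimes> m \<otimes> inv (g \<otimes> h) = g \<otimes> (h \<otimes> m \<otimes> inv h) \<otimes> inv g" if "m \<in> M" for m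
      using g h MG[OF that] by (simp add: K_def inv_mult_group m_assoc)
    then show "g \<otimes> h \<in> K"
      using g h by (simp add: K_def)
  qed (auto simp: K_def)
  moreover obtain g where "g \<in> carrier G" "g \<notin> M" "\<And>m. m \<in> M \<Longrightarrow> g \<otimes> m \<otimes> inv g \<in> M"
    using ex_normalizing_outside[OF M'] by blast
  ultimately have "K = carrier G"
    using max[of K] MK by (auto simp: K_def)
  then have normal: "inv g \<otimes> m \<otimes> g \<in> M" if "g \<in> carrier G" "m \<in> M" for g m
  proof -
    have "inv g \<in> K"
      using \<open>K = carrier G\<close> that by simp
    then have "inv g \<otimes> m \<otimes> inv (inv g) \<in> M"
      using that by (simp only: K_def mem_Collect_eq)
    then show ?thesis
      using that by simp
  qed
  have swap: "\<exists>m'\<in>M. m \<otimes> g = g \<otimes> m'" if "g \<in> carrier G" "m \<in> M" for g m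
    using normal[OF that] that MG by (intro bexI[of _ "inv g \<otimes> m \<otimes> g"]) (auto simp: m_assoc)
  obtain z where z: "z \<in> carrier G" "z \<notin> M" "z [^] p \<in> M"
  proof -
    obtain z0 where z0: "z0 \<in> carrier G" "z0 \<notin> M"
      using M' MG by blast
    \<comment> \<open>\<open>z\<close> will be the last of the iterated \<open>p\<close>-th powers
      of \<open>z0\<close> that lies outside \<open>M\<close>.\<close>
    define n where "n = (LEAST n. z0 [^] (p ^ n) \<in> M)"
    have "z0 [^] (p ^ N) \<in> M"
      using pow_order_one[OF z0(1)] subgroup.one_closed[OF M'(1)] by simp
    then have n: "z0 [^] (p ^ n) \<in> M"
      unfolding n_def by (rule LeastI)
    have "n \<noteq> 0"
      using n z0 by (auto intro!: gr0I)
    then obtain k where k: "n = Suc k"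
      by (cases n) auto
    have "z0 [^] (p ^ k) \<notin> M"
      using not_less_Least[of k "\<lambda>n. z0 [^] (p ^ n) \<in> M"] k by (simp add: n_def)
    moreover have "(z0 [^] (p ^ k)) [^] p \<in> M"
      using n z0 by (simp add: k nat_pow_pow mult.commute)
    ultimately show ?thesis
      using that[of "z0 [^] (p ^ k)"] z0 by simp
  qed
  have "subgroup (adjoin G M z) G"
    using swap z by (intro subgroup_adjoin fin M'(1)) auto
  then have carrier: "carrier G = adjoin G M z"
    using max[of "adjoin G M z"] subset_adjoin[OF subgroup.subset[OF M'(1)], of z] mem_adjoin[OF M'(1) z(1)] z(2)
    by blast
  have mult: "\<exists>m\<in>M. (z [^] i \<otimes> s) \<otimes> (z [^] j \<otimes> t) = z [^] (i + j) \<otimes> m" if st: "s \<in> M" "t \<in> M" for i j :: nat and s t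
  proof -
    obtain s' where s': "s' \<in> M" "s \<otimes> z [^] j = z [^] j \<otimes> s'"
      using swap[of "z [^] j" s] st z by auto
    have "(z [^] i \<otimes> s) \<otimes> (z [^] j \<otimes> t) = z [^] i \<otimes> (s \<otimes> z [^] j) \<otimes> t"
      using z st MG by (simp add: m_assoc)
    also have "\<dots> = z [^] (i + j) \<otimes> (s' \<otimes> t)"
      unfolding s' using z st s' MG by (simp add: m_assoc flip: nat_pow_mult)
    finally show ?thesis
      using subgroup.m_closed[OF M'(1) s'(1) st(2)] by blast
  qed
  obtain i :: nat and s where s: "s \<in> M" "x = z [^] i \<otimes> s"
    using x carrier by (auto elim: adjoinE)
  obtain j :: nat and t where t: "t \<in> M" "y = z [^] j \<otimes> t"
    using y carrier by (auto elim: adjoinE)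
  obtain a where a: "a \<in> M" "x \<otimes> y = z [^] (i + j) \<otimes> a"
    using mult[OF s(1) t(1), of i j] s t by blast
  obtain b where b: "b \<in> M" "y \<otimes> x = z [^] (i + j) \<otimes> b"
    using mult[OF t(1) s(1), of j i] s t by (auto simp: add.commute)
  have "comm x y = inv (y \<otimes> x) \<otimes> (x \<otimes> y)"
    using x y by (simp add: comm_def inv_mult_group m_assoc)
  also have "\<dots> = inv b \<otimes> a"
    unfolding a b using z a(1) b(1) MG by (simp add: inv_mult_group m_assoc)
  also have "\<dots> \<in> M"
    using M'(1) a(1) b(1) by (intro subgroup.m_closed subgroup.m_inv_closed)
  finally show "comm x y \<in> M" .
  have "\<exists>m\<in>M. x [^] n = z [^] (n * i) \<otimes> m" for n :: nat
  proof (induction n)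
    case 0
    show ?case
      using subgroup.one_closed[OF M'(1)] by (intro bexI[of _ \<one>]) auto
  next
    case (Suc n)
    then obtain m where "m \<in> M" "x [^] n = z [^] (n * i) \<otimes> m"
      by blast
    then show ?case
      using mult[of m s "n * i" i] s by (simp add: add.commute)
  qed
  then obtain m where m: "m \<in> M" "x [^] p = z [^] (p * i) \<otimes> m"
    by blast
  then have "x [^] p = (z [^] p) [^] i \<otimes> m"
    using z by (simp add: nat_pow_pow)
  also have "\<dots> \<in> M"
    using subgroup.m_closed[OF M'(1) subgroup_pow_closed[OF M'(1) z(3)] m(1)] .
  finally show "x [^] p \<in> M" .
qed

lemma frattini_contains:
  assumes "x \<in> carrier G" "y \<in> carrier G"
  shows "x [^] p \<in> frattini G" "comm x y \<in> frattini G"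
  using maximal_subgroup_contains[OF _ assms] assms by (auto simp: frattini_def comm_closed)

lemma frattini_cyclic:
  assumes "cyclic_group (G\<lparr>carrier := frattini G\<rparr>)"
  obtains s where "s \<in> carrier G" "\<And>a. a \<in> frattini G \<Longrightarrow> \<exists>i::nat. a = s [^] i"
proof -
  have "frattini G = \<Inter>(insert (carrier G) {M. maximal_subgroup M G})"
    by (simp add: frattini_def)
  then have F: "subgroup (frattini G) G"
    using subgroups_Inter[of "insert (carrier G) {M. maximal_subgroup M G}"] subgroup_self
    by (auto simp: maximal_subgroup_def)
  then interpret F: group "G\<lparr>carrier := frattini G\<rparr>"
    by (rule subgroup_imp_group)
  obtain s where s: "s \<in> frattini G" "frattini G = range (\<lambda>n::int. s [^]\<^bsub>G\<lparr>carrier := frattini G\<rparr>\<^esub> n)"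
    using assms F.cyclic_group by auto
  have sG: "s \<in> carrier G"
    using F s(1) by (rule subgroup.mem_carrier)
  have "\<exists>i::nat. a = s [^] i" if a: "a \<in> frattini G" for a
  proof -
    obtain n :: int where "a = s [^]\<^bsub>G\<lparr>carrier := frattini G\<rparr>\<^esub> n"
      using s(2) a by blast
    then have n: "a = s [^] n"
      using int_pow_consistent[OF F s(1), of n] by simp
    define k where "k = nat (n mod int (p ^ N))"
    have pN: "p ^ N > 0"
      using p_gt_2 by simp
    have "n = int (p ^ N) * (n div int (p ^ N)) + int k"
      using pN by (simp add: k_def)
    then have "s [^] n = (s [^] int (p ^ N)) [^] (n div int (p ^ N)) \<otimes> s [^] int k"
      using sG by (metis int_pow_mult int_pow_pow int_pow_closed mult.commute)
    also have "s [^] int (p ^ N) = \<one>"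
      using pow_order_one[OF sG] by (metis int_pow_int)
    finally have "a = s [^] k"
      using n sG by (simp add: int_pow_int)
    then show ?thesis
      by blast
  qed
  then show ?thesis
    using that[OF sG] by blast
qed

end

lemma (in group) ord_dvd_of_pow_eq_self:
  assumes x: "x \<in> carrier G" and n: "n \<ge> 1" "x [^] (n::nat) = x"
  shows "ord x dvd n - 1"
proof -
  obtain m where m: "n = Suc m"
    using n(1) by (cases n) auto
  then have "x [^] m \<otimes> x = x"
    using n(2) by simp
  then have "x [^] m = \<one>"
    using x by simp
  then show ?thesis
    using pow_eq_id[OF x] m by simp
qed

lemma (in group) pow_eq_imp_cong:
  assumes x: "x \<in> carrier G" and eq: "x [^] (i::nat) = x [^] (j::nat)"
  shows "[i = j] (mod ord x)"
proof -
  have "x [^] int i = x [^] int j"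
    using eq by (simp add: int_pow_int)
  then have "int (ord x) dvd int j - int i"
    using int_pow_eq[OF x] by blast
  then show ?thesis
    by (simp add: cong_iff_dvd_diff dvd_diff_commute flip: cong_int_iff)
qed

section \<open>Commutators are central of order p\<close>

context prime_power_group
begin

definition powers_and_commutators :: "'a set" where
  "powers_and_commutators = (\<lambda>x. x [^] p) ` carrier G \<union> (\<lambda>(x, y). comm x y) ` (carrier G \<times> carrier G)"

lemma powers_and_commutatorsI:
  "x \<in> carrier G \<Longrightarrow> x [^] p \<in> powers_and_commutators"
  "x \<in> carrier G \<Longrightarrow> y \<in> carrier G \<Longrightarrow> comm x y \<in> powers_and_commutators"
  by (auto simp: powers_and_commutators_def)

text \<open>Conjugation by \<open>g\<close> raises \<open>x\<close> to a power u = 1 + p k, while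
  \<open>g [^] p\<close>, being a power of \<open>x\<close>, commutes with \<open>x\<close>; so u^p
  = 1 modulo the order of \<open>x\<close>. This forces p^2 k to vanish modulo that order, which
  says that conjugation fixes \<open>x [^] p\<close>.\<close>

lemma pth_power_generator_central:
  assumes x: "x \<in> carrier G" and gen: "\<And>a. a \<in> powers_and_commutators \<Longrightarrow> \<exists>k::nat. a = (x [^] p) [^] k"
  shows "x [^] p \<in> center G"
proof (rule centerI)
  fix g assume g: "g \<in> carrier G"
  obtain k :: nat where k: "comm x g = (x [^] p) [^] k"
    using gen powers_and_commutatorsI(2)[OF x g] by blast
  define u where "u = 1 + p * k"
  have "x \<otimes> g = g \<otimes> x \<otimes> x [^] (p * k)"
    using mult_comm[OF x g] k x by (simp add: nat_pow_pow)
  also have "\<dots> = g \<otimes> x [^] u"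
    using x g nat_pow_mult[of x 1 "p * k"] by (simp add: u_def m_assoc del: nat_pow_Suc)
  finally have xg: "x \<otimes> g = g \<otimes> x [^] u" .
  obtain l :: nat where l: "g [^] p = (x [^] p) [^] l"
    using gen powers_and_commutatorsI(1)[OF g] by blast
  have "g [^] p \<otimes> x = x \<otimes> g [^] p"
    unfolding l using x nat_pow_Suc2[OF x, of "p * l"] by (simp add: nat_pow_pow)
  also have "x \<otimes> g [^] p = g [^] p \<otimes> x [^] (u ^ p)"
    by (rule conj_power(2)[OF x g xg])
  finally have xu: "x [^] (u ^ p) = x"
    using x g by simp
  obtain r where r: "ord x = p ^ r"
    using ord_prime_power[OF x] .
  have "u ^ p \<ge> 1"
    by (simp add: u_def)
  then have "p ^ r dvd u ^ p - 1"
    using ord_dvd_of_pow_eq_self[OF x _ xu] r by simp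
  then have "[u ^ p = 1] (mod p ^ r)"
    using \<open>u ^ p \<ge> 1\<close> by (simp add: cong_altdef_nat)
  then have "p ^ r dvd p * (p * k)"
    using prime_power_dvd_of_dvd_pow_diff_one[OF prime p_gt_2] by (simp add: u_def)
  then have "x [^] (p * (p * k)) = \<one>"
    using pow_eq_id[OF x] r by simp
  moreover have "u * p = p + p * (p * k)"
    by (simp add: u_def algebra_simps)
  ultimately have "x [^] (u * p) = x [^] p"
    using x by (simp flip: nat_pow_mult)
  then show "x [^] p \<otimes> g = g \<otimes> x [^] p"
    using conj_power(1)[OF x g xg, of p] by simp
qed (use x in simp)

text \<open>The conjugate of \<open>x [^] p\<close> by \<open>y\<close> is computed in two ways: as
  a power of t = [x, y], and as the \<open>p\<close>-th power of x t by the geometric sum. Modulo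
  p^2 the exponents differ by \<open>p\<close>, so the order of \<open>t\<close> divides
  \<open>p\<close>; then conjugation, which raises \<open>t\<close> to powers that are 1 modulo
  \<open>p\<close>, fixes it.\<close>

lemma commutator_generator_central:
  assumes x: "x \<in> carrier G" and y: "y \<in> carrier G"
    and gen: "\<And>a. a \<in> powers_and_commutators \<Longrightarrow> \<exists>k::nat. a = comm x y [^] k"
    and powers: "\<And>g. g \<in> carrier G \<Longrightarrow> \<exists>k::nat. g [^] p = (comm x y [^] p) [^] k"
  shows "comm x y \<in> center G"
proof -
  define t where "t = comm x y"
  have t: "t \<in> carrier G"
    using x y by (simp add: t_def comm_closed)
  obtain r where r: "ord t = p ^ r"
    using ord_prime_power[OF t] .
  \<comment> \<open>As \<open>g [^] p\<close> commutes with \<open>t\<close>, u^p = 1 modulo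
    \<open>p\<close>, and Fermat gives u = 1 modulo \<open>p\<close>. For a trivial \<open>t\<close>
    its order carries no information, and u = 1 is chosen.\<close>
  have conj: "\<exists>u. t \<otimes> g = g \<otimes> t [^] u \<and> [u = 1] (mod p)" if g: "g \<in> carrier G" for g
  proof (cases "r = 0")
    case True
    then have "t = \<one>"
      using r t ord_eq_1 by auto
    then show ?thesis
      using g by (intro exI[of _ 1]) simp
  next
    case False
    obtain l :: nat where l: "comm t g = t [^] l"
      using gen powers_and_commutatorsI(2)[OF t g] by (auto simp: t_def)
    define u where "u = Suc l"
    have "t \<otimes> g = g \<otimes> (t \<otimes> t [^] l)"
      using mult_comm[OF t g] t g by (simp add: l m_assoc)
    then have tg: "t \<otimes> g = g \<otimes> t [^] u"
      using nat_pow_Suc2[OF t, of l] by (simp add: u_def)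
    obtain k :: nat where k: "g [^] p = t [^] k"
      using gen powers_and_commutatorsI(1)[OF g] by (auto simp: t_def)
    have "g [^] p \<otimes> t = t \<otimes> g [^] p"
      unfolding k using nat_pow_Suc2[OF t, of k] by simp
    also have "\<dots> = g [^] p \<otimes> t [^] (u ^ p)"
      by (rule conj_power(2)[OF t g tg])
    finally have tu: "t [^] (u ^ p) = t"
      using t g by simp
    have "u ^ p \<ge> 1"
      by (simp add: u_def)
    then have "p ^ r dvd u ^ p - 1"
      using ord_dvd_of_pow_eq_self[OF t _ tu] r by simp
    then have "p dvd u ^ p - 1"
      using False by (metis dvd_power dvd_trans gr0I)
    then have "[u ^ p = 1] (mod p)"
      using \<open>u ^ p \<ge> 1\<close> by (simp add: cong_altdef_nat)
    moreover have "[int u ^ p = int u] (mod int p)"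
      by (rule fermat_int[OF prime])
    then have "[u ^ p = u] (mod p)"
      by (simp flip: of_nat_power add: cong_int_iff)
    ultimately have "[u = 1] (mod p)"
      using cong_sym cong_trans by blast
    then show ?thesis
      using tg by blast
  qed
  obtain u where u: "t \<otimes> x = x \<otimes> t [^] u" "[u = 1] (mod p)"
    using conj[OF x] by blast
  obtain v where v: "t \<otimes> y = y \<otimes> t [^] v" "[v = 1] (mod p)"
    using conj[OF y] by blast
  define S where "S = (\<Sum>i<p. u ^ i)"
  have S: "[S = p] (mod p ^ 2)"
    unfolding S_def using u p_gt_2 prime prime_odd_nat by (intro geometric_sum_cong) auto
  obtain k :: nat where k: "x [^] p = t [^] (p * k)"
    using powers[OF x] t by (auto simp: t_def nat_pow_pow)
  have "x \<otimes> y = y \<otimes> (x \<otimes> t)"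
    using mult_comm[OF x y] x y t by (simp add: t_def m_assoc)
  have pow: "x [^] n \<otimes> y = y \<otimes> (x \<otimes> t) [^] n" for n :: nat
  proof (induction n)
    case (Suc n)
    have "x [^] Suc n \<otimes> y = x [^] n \<otimes> (x \<otimes> y)"
      using x y by (simp add: m_assoc)
    also have "\<dots> = (x [^] n \<otimes> y) \<otimes> (x \<otimes> t)"
      unfolding \<open>x \<otimes> y = y \<otimes> (x \<otimes> t)\<close> using x y t by (simp add: m_assoc)
    also have "\<dots> = y \<otimes> (x \<otimes> t) [^] Suc n"
      unfolding Suc using x y t by (simp add: m_assoc)
    finally show ?case .
  qed (use x y t in simp)
  have "y \<otimes> t [^] (v * (p * k)) = x [^] p \<otimes> y"
    unfolding k by (rule conj_power(1)[OF t y v(1), symmetric])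
  also have "\<dots> = y \<otimes> (x [^] p \<otimes> t [^] S)"
    unfolding pow twisted_mult_power[OF x t u(1)] S_def ..
  also have "\<dots> = y \<otimes> t [^] (p * k + S)"
    unfolding k using t by (simp add: nat_pow_mult)
  finally have eq: "t [^] (v * (p * k)) = t [^] (p * k + S)"
    using t y by simp
  have "r < 2"
  proof (rule ccontr)
    assume "\<not> r < 2"
    then have "p ^ 2 dvd ord t"
      using r by (simp add: le_imp_power_dvd)
    define b where "b = v div p"
    have "v mod p = 1"
      using v(2) p_gt_2 by (simp add: cong_def)
    then have vb: "v = 1 + p * b"
      unfolding b_def by (metis add.commute mult_div_mod_eq)
    \<comment> \<open>One exponent is p k modulo p^2 and the other p k + p, which is impossible if
      p^2 divides the order of \<open>t\<close>.\<close>
    have "v * (p * k) = p * k + p ^ 2 * (b * k)"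
      unfolding vb by (simp add: algebra_simps power2_eq_square)
    then have "t [^] (p * k) \<otimes> t [^] (p ^ 2 * (b * k)) = t [^] (p * k) \<otimes> t [^] S"
      using eq t by (simp add: nat_pow_mult)
    then have "t [^] (p ^ 2 * (b * k)) = t [^] S"
      using t by simp
    then have "[p ^ 2 * (b * k) = S] (mod ord t)"
      by (rule pow_eq_imp_cong[OF t])
    then have "[p ^ 2 * (b * k) = S] (mod p ^ 2)"
      using \<open>p ^ 2 dvd ord t\<close> cong_dvd_modulus_nat by blast
    then have "[p ^ 2 * (b * k) = p] (mod p ^ 2)"
      using S cong_trans by blast
    then have "p ^ 2 dvd p"
      by (simp add: cong_def mod_eq_0_iff_dvd)
    then show False
      using p_gt_2 by (auto dest!: dvd_imp_le simp: power2_eq_square)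
  qed
  then have "p ^ r dvd p"
    by (cases r) (auto simp: less_2_cases_iff)
  then have tp: "t [^] p = \<one>"
    using pow_eq_id[OF t] r by simp
  have "t \<in> center G"
  proof (rule centerI[OF t])
    fix g assume g: "g \<in> carrier G"
    then obtain w where w: "t \<otimes> g = g \<otimes> t [^] w" "[w = 1] (mod p)"
      using conj by blast
    have "t [^] w = t [^] (1::nat)"
      using pow_cong[OF t tp w(2)] .
    then show "t \<otimes> g = g \<otimes> t"
      using w t by simp
  qed
  then show ?thesis
    by (simp add: t_def)
qed

text \<open>Inside the cyclic <s> some \<open>t\<close> among the \<open>p\<close>-th powers and
  commutators generates all the others. Either it is a power of a \<open>p\<close>-th power, or it
  is a commutator and all \<open>p\<close>-th powers lie in <t^p>; the two preceding centrality
  lemmas treat these cases. Once everything is central, [x, y]^p = [x^p, y] = 1.\<close>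

lemma ex_central_ext:
  assumes s: "s \<in> carrier G" and gen: "\<And>a. a \<in> powers_and_commutators \<Longrightarrow> \<exists>i::nat. a = s [^] i"
    and nonabelian: "\<not> comm_group G"
  obtains c where "central_ext G p c" "\<exists>i::nat. c = s [^] i"
proof -
  have total: "(\<exists>k::nat. a = b [^] k) \<or> (\<exists>k::nat. b = (a [^] p) [^] k)"
    if ab: "a \<in> powers_and_commutators" "b \<in> powers_and_commutators" for a b
  proof -
    obtain i j :: nat where "a = s [^] i" "b = s [^] j"
      using gen ab by blast
    then show ?thesis
      by (rule power_total[OF prime s pow_order_one[OF s]])
  qed
  have closed: "a \<in> carrier G" if "a \<in> powers_and_commutators" for a
    using that by (auto simp: powers_and_commutators_def comm_closed)
  have max: "\<exists>t\<in>F. \<forall>a\<in>F. \<exists>k::nat. a = t [^] k"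
    if "finite F" "F \<noteq> {}" "F \<subseteq> powers_and_commutators" for F
    using that
  proof (induction F rule: finite_ne_induct)
    case (singleton x)
    then have "x = x [^] (1::nat)"
      using closed by simp
    then show ?case
      by blast
  next
    case (insert x F)
    then obtain t where t: "t \<in> F" "\<forall>a\<in>F. \<exists>k::nat. a = t [^] k"
      by auto
    have tx: "t \<in> carrier G" "x \<in> carrier G"
      using insert t closed by auto
    from total[of x t] insert t consider (1) k :: nat where "x = t [^] k" | (2) k :: nat where "t = (x [^] p) [^] k"
      by blast
    then show ?case
    proof cases
      case 1
      then show ?thesis
        using t by blast
    next
      case 2
      have "\<exists>k::nat. a = x [^] k" if aF: "a \<in> insert x F" for a
      proof (cases "a = x")
        case True
        then have "a = x [^] (1::nat)"
          using tx by simp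
        then show ?thesis
          by blast
      next
        case False
        then obtain l :: nat where "a = t [^] l"
          using t aF by blast
        then have "a = x [^] (p * k * l)"
          using 2 tx by (simp add: nat_pow_pow)
        then show ?thesis
          by blast
      qed
      then show ?thesis
        by blast
    qed
  qed
  have "finite powers_and_commutators"
    using fin by (simp add: powers_and_commutators_def)
  moreover have "powers_and_commutators \<noteq> {}"
    using powers_and_commutatorsI(1)[OF s] by blast
  ultimately obtain t where t: "t \<in> powers_and_commutators"
    and t_gen: "\<And>a. a \<in> powers_and_commutators \<Longrightarrow> \<exists>k::nat. a = t [^] k"
    using max[of powers_and_commutators] by blast
  have tG: "t \<in> carrier G"
    using t closed by blast
  have "\<exists>t\<in>center G. \<forall>a\<in>powers_and_commutators. \<exists>k::nat. a = t [^] k"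
  proof (cases "\<exists>x\<in>carrier G. \<exists>k::nat. t = (x [^] p) [^] k")
    case True
    then obtain x and k :: nat where x: "x \<in> carrier G" "t = (x [^] p) [^] k"
      by blast
    have "\<exists>l::nat. a = (x [^] p) [^] l" if a: "a \<in> powers_and_commutators" for a
    proof -
      obtain l :: nat where "a = t [^] l"
        using t_gen[OF a] by blast
      then have "a = (x [^] p) [^] (k * l)"
        using x by (simp add: nat_pow_pow mult.assoc)
      then show ?thesis
        by blast
    qed
    then show ?thesis
      using pth_power_generator_central[OF x(1)] by blast
  next
    case False
    have "t \<noteq> x [^] p" if "x \<in> carrier G" for x
    proof
      assume "t = x [^] p"
      then have "t = (x [^] p) [^] (1::nat)"
        using that by simp
      then show False
        using False that by blast
    qed
    then obtain x y where xy: "x \<in> carrier G" "y \<in> carrier G" "t = comm x y"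
      using t by (auto simp: powers_and_commutators_def)
    have "\<exists>k::nat. g [^] p = (t [^] p) [^] k" if g: "g \<in> carrier G" for g
      using total[OF t powers_and_commutatorsI(1)[OF g]] False g by blast
    then have "t \<in> center G"
      using commutator_generator_central[OF xy(1,2)] t_gen unfolding xy(3) by blast
    then show ?thesis
      using t_gen by blast
  qed
  then obtain t' where t': "t' \<in> center G" "\<forall>a\<in>powers_and_commutators. \<exists>k::nat. a = t' [^] k"
    by blast
  have central: "a \<in> center G" if "a \<in> powers_and_commutators" for a
    using t' that subgroup_pow_closed[OF subgroup_center t'(1)] by metis
  have comm_p: "comm x y [^] p = \<one>" if x: "x \<in> carrier G" and y: "y \<in> carrier G" for x y
  proof -
    define d where "d = comm x y"
    have d: "d \<in> center G" "d \<in> carrier G"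
      using central[OF powers_and_commutatorsI(2)[OF x y]] comm_closed[OF x y] by (simp_all add: d_def)
    have xy: "x \<otimes> y = y \<otimes> x \<otimes> d"
      using mult_comm[OF x y] by (simp add: d_def)
    have "x [^] n \<otimes> y = y \<otimes> x [^] n \<otimes> d [^] n" for n :: nat
    proof (induction n)
      case (Suc n)
      have dn: "d [^] n \<otimes> x = x \<otimes> d [^] n"
        using centerD(2)[OF subgroup_pow_closed[OF subgroup_center d(1)] x] .
      have "x [^] Suc n \<otimes> y = x [^] n \<otimes> (x \<otimes> y)"
        using x y by (simp add: m_assoc)
      also have "\<dots> = (x [^] n \<otimes> y) \<otimes> x \<otimes> d"
        unfolding xy using x y d by (simp add: m_assoc)
      also have "\<dots> = y \<otimes> x [^] n \<otimes> (d [^] n \<otimes> x) \<otimes> d"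
        unfolding Suc using x y d by (simp add: m_assoc)
      also have "\<dots> = y \<otimes> x [^] Suc n \<otimes> d [^] Suc n"
        unfolding dn using x y d by (simp add: m_assoc)
      finally show ?case .
    qed (use x y in simp)
    then have "x [^] p \<otimes> y = y \<otimes> x [^] p \<otimes> d [^] p"
      by blast
    moreover have "x [^] p \<otimes> y = y \<otimes> x [^] p"
      using centerD(2)[OF central[OF powers_and_commutatorsI(1)[OF x]] y] .
    ultimately show ?thesis
      using x y d by (simp add: d_def)
  qed
  obtain x y where xy: "x \<in> carrier G" "y \<in> carrier G" "x \<otimes> y \<noteq> y \<otimes> x"
    using nonabelian group_comm_groupI by metis
  \<comment> \<open>Any nontrivial commutator serves, since in a cyclic \<open>p\<close>-group the
    elements killed by \<open>p\<close> are powers of any nontrivial one among them.\<close>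
  define c where "c = comm x y"
  have c: "c \<in> powers_and_commutators" "c \<in> carrier G"
    using xy powers_and_commutatorsI(2) closed by (auto simp: c_def)
  have "c \<noteq> \<one>"
    using mult_comm[OF xy(1,2)] xy by (auto simp: c_def)
  have cp: "c [^] p = \<one>"
    using comm_p xy by (simp add: c_def)
  have "central_ext G p c"
  proof
    fix a assume "a \<in> carrier G"
    then show "c \<otimes> a = a \<otimes> c"
      using centerD(2)[OF central[OF c(1)]] by blast
    fix b assume "b \<in> carrier G"
    with \<open>a \<in> carrier G\<close> have ba: "comm b a \<in> powers_and_commutators" "b \<otimes> a = a \<otimes> b \<otimes> comm b a"
      by (auto intro: powers_and_commutatorsI mult_comm)
    have "(comm b a [^] p) [^] k = \<one>" for k :: nat
      using comm_p \<open>a \<in> carrier G\<close> \<open>b \<in> carrier G\<close> by simp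
    then have "\<exists>k::nat. comm b a = c [^] k"
      using total[OF ba(1) c(1)] \<open>c \<noteq> \<one>\<close> by auto
    then show "\<exists>i::nat. b \<otimes> a = a \<otimes> b \<otimes> c [^] i"
      using ba(2) by metis
  qed (use p_gt_2 c cp \<open>c \<noteq> \<one>\<close> in auto)
  then show ?thesis
    using that gen c by blast
qed

end

text \<open>The index \<open>k\<close> is normalized by the centre, which has exponent p^(k+1) in
  both types. Here \<open>G\<close> has the same exponent, whereas in the noncentral type it has
  exponent p^(k+2).\<close>

definition central_type :: "('a, 'm) monoid_scheme \<Rightarrow> nat \<Rightarrow> nat \<Rightarrow> 'a \<Rightarrow> bool" where
  "central_type G p k c \<longleftrightarrow> central_ext G p c \<and>
    (\<exists>z\<in>center G. z [^]\<^bsub>G\<^esub> (p ^ k) = c \<and>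
      (\<forall>g\<in>carrier G. \<exists>j::nat. g [^]\<^bsub>G\<^esub> p = (z [^]\<^bsub>G\<^esub> p) [^]\<^bsub>G\<^esub> j)) \<and>
    (\<forall>g\<in>carrier G. g [^]\<^bsub>G\<^esub> (p ^ Suc k) = \<one>\<^bsub>G\<^esub>)"

definition noncentral_type :: "('a, 'm) monoid_scheme \<Rightarrow> nat \<Rightarrow> nat \<Rightarrow> 'a \<Rightarrow> bool" where
  "noncentral_type G p k c \<longleftrightarrow> central_ext G p c \<and>
    (\<exists>x\<in>carrier G. x [^]\<^bsub>G\<^esub> (p ^ Suc k) = c \<and>
      (\<forall>g\<in>carrier G. \<exists>j::nat. g [^]\<^bsub>G\<^esub> p = (x [^]\<^bsub>G\<^esub> p) [^]\<^bsub>G\<^esub> j)) \<and>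
    (\<forall>z\<in>center G. z [^]\<^bsub>G\<^esub> (p ^ Suc k) = \<one>\<^bsub>G\<^esub>)"

context prime_power_group
begin

text \<open>The \<open>p\<close>-th power of an element of maximal order generates all other
  \<open>p\<close>-th powers by totality in <s>. The type records whether such an element exists in
  the centre.\<close>

lemma type_dichotomy:
  assumes c: "central_ext G p c" "\<exists>i::nat. c = s [^] i" and s: "s \<in> carrier G"
    and powers: "\<And>x. x \<in> carrier G \<Longrightarrow> \<exists>i::nat. x [^] p = s [^] i"
  shows "\<exists>k c. central_type G p k c \<or> noncentral_type G p k c"
proof -
  interpret C: central_ext G p c
    by fact
  define e where "e = (LEAST e. \<forall>x\<in>carrier G. x [^] (p ^ e) = \<one>)"
  have e: "\<forall>x\<in>carrier G. x [^] (p ^ e) = \<one>"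
    unfolding e_def by (rule LeastI[of _ N]) (use pow_order_one in blast)
  have "e \<noteq> 0"
  proof
    assume "e = 0"
    then show False
      using e C.c_ne by force
  qed
  then obtain k where k: "e = Suc k"
    by (cases e) auto
  obtain x where x: "x \<in> carrier G" "x [^] (p ^ k) \<noteq> \<one>"
    using not_less_Least[of k "\<lambda>e. \<forall>x\<in>carrier G. x [^] (p ^ e) = \<one>"] k by (auto simp: e_def)
  show ?thesis
  proof (cases k)
    \<comment> \<open>In exponent \<open>p\<close> all \<open>p\<close>-th powers are trivial, so
      \<open>c\<close> itself serves as the central generator.\<close>
    case 0
    have exp: "\<forall>g\<in>carrier G. g [^] (p ^ Suc 0) = \<one>"
      using e unfolding k 0 .
    then have roots: "\<forall>g\<in>carrier G. \<exists>j::nat. g [^] p = (c [^] p) [^] j"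
      by (auto intro!: exI[of _ 0])
    have "c [^] (p ^ 0) = c"
      by simp
    then have "central_type G p 0 c"
      unfolding central_type_def using c(1) exp roots C.c_in_center by blast
    then show ?thesis
      by blast
  next
    case (Suc l)
    \<comment> \<open>The given \<open>c\<close> is replaced by the power of \<open>t\<close> of
      order \<open>p\<close>, which generates the same subgroup, so that the generator ends exactly
      in the distinguished element.\<close>
    have gen: "central_ext G p (t [^] (p ^ k)) \<and> (\<forall>g\<in>carrier G. \<exists>j::nat. g [^] p = (t [^] p) [^] j)"
      if t: "t \<in> carrier G" "t [^] (p ^ k) \<noteq> \<one>" for t
    proof
      have tk: "t [^] (p ^ k) = (t [^] p) [^] (p ^ l)"
        using t by (simp add: Suc nat_pow_pow)
      obtain i :: nat where i: "t [^] p = s [^] i"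
        using powers[OF t(1)] by blast
      show "\<forall>g\<in>carrier G. \<exists>j::nat. g [^] p = (t [^] p) [^] j"
      proof
        fix g assume g: "g \<in> carrier G"
        obtain m :: nat where m: "g [^] p = s [^] m"
          using powers[OF g] by blast
        have "t [^] p \<noteq> ((g [^] p) [^] p) [^] j" for j :: nat
        proof
          assume tp: "t [^] p = ((g [^] p) [^] p) [^] j"
          have "t [^] (p ^ k) = (g [^] (p ^ e)) [^] j"
            unfolding tk tp using g by (simp add: k Suc nat_pow_pow mult_ac)
          then show False
            using t e g by simp
        qed
        then show "\<exists>j::nat. g [^] p = (t [^] p) [^] j"
          using power_total[OF prime s pow_order_one[OF s] m i] by blast
      qed
      define d where "d = t [^] (p ^ k)"
      have d: "d \<in> carrier G" "d \<noteq> \<one>"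
        using t by (simp_all add: d_def)
      have dp: "d [^] p = \<one>"
        using e t by (simp add: d_def nat_pow_pow k mult.commute)
      have "d = s [^] (i * p ^ l)"
        using s by (simp add: d_def tk i nat_pow_pow)
      moreover obtain i0 :: nat where "c = s [^] i0"
        using c by blast
      ultimately obtain j :: nat where j: "c = d [^] j"
        using power_total[OF prime s pow_order_one[OF s], of c i0 d "i * p ^ l"] C.c_pow_p d(2) by auto
      have dZ: "d \<in> center G"
        unfolding d_def tk by (rule subgroup_pow_closed[OF subgroup_center C.pow_p_in_center[OF t(1)]])
      show "central_ext G p (t [^] (p ^ k))"
        unfolding d_def[symmetric]
      proof
        fix a b assume "a \<in> carrier G"
        then show "d \<otimes> a = a \<otimes> d"
          by (rule centerD(2)[OF dZ])
        assume "b \<in> carrier G"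
        then obtain m :: nat where "b \<otimes> a = a \<otimes> b \<otimes> c [^] m"
          using C.commute_ex \<open>a \<in> carrier G\<close> by blast
        then have "b \<otimes> a = a \<otimes> b \<otimes> d [^] (j * m)"
          using d by (simp add: j nat_pow_pow)
        then show "\<exists>i::nat. b \<otimes> a = a \<otimes> b \<otimes> d [^] i"
          by blast
      qed (use p_gt_2 d dp in auto)
    qed
    show ?thesis
    proof (cases "\<exists>z\<in>center G. z [^] (p ^ k) \<noteq> \<one>")
      case True
      then obtain z where z: "z \<in> center G" "z [^] (p ^ k) \<noteq> \<one>"
        by blast
      then have "central_type G p k (z [^] (p ^ k))"
        using gen[OF centerD(1)[OF z(1)] z(2)] e k by (auto simp: central_type_def)
      then show ?thesis
        by blast
    next
      case False
      \<comment> \<open>The index drops by one because the centre is already killed by p^k, where k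
        = l + 1.\<close>
      then have "noncentral_type G p l (x [^] (p ^ k))"
        using gen[OF x] x(1) by (auto simp: noncentral_type_def Suc)
      then show ?thesis
        by blast
    qed
  qed
qed

end

lemma type_of_cyclic_frattini:
  assumes "Factorial_Ring.prime p" "p > 2" "p_group p G" "finite (carrier G)" "\<not> comm_group G"
    and cyclic: "cyclic_group (G\<lparr>carrier := frattini G\<rparr>)"
  shows "\<exists>k c. central_type G p k c \<or> noncentral_type G p k c"
proof -
  obtain N where N: "group G" "order G = p ^ N"
    using assms(3) by (auto simp: p_group_def)
  interpret prime_power_group G p N
    using assms N by (simp add: prime_power_group_def finite_group_prime_def finite_group_prime_axioms_def
        prime_power_group_axioms_def)
  obtain s where s: "s \<in> carrier G" "\<And>a. a \<in> frattini G \<Longrightarrow> \<exists>i::nat. a = s [^]\<^bsub>G\<^esub> i"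
    using frattini_cyclic[OF cyclic] by blast
  have gen: "\<exists>i::nat. a = s [^]\<^bsub>G\<^esub> i" if "a \<in> powers_and_commutators" for a
    using that frattini_contains s(2) by (auto simp: powers_and_commutators_def)
  obtain c where c: "central_ext G p c" "\<exists>i::nat. c = s [^]\<^bsub>G\<^esub> i"
    using ex_central_ext[OF s(1) gen assms(5)] by blast
  show ?thesis
    using type_dichotomy[OF c s(1)] gen powers_and_commutatorsI(1) by blast
qed

section \<open>The isomorphism problem\<close>

lemma (in central_ext) point_in_center_V:
  assumes z: "z \<in> center G"
  shows "point G z \<in> center V"
proof -
  have zG: "z \<in> carrier G"
    using z by (rule centerD(1))
  have "point G z (g \<otimes> c) = point G z g" if "g \<in> carrier G - center G" for g
    using that z mult_c_center_iff[of g] by (auto simp: point_def)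
  then show ?thesis
    using center_V_iff[of "point G z"] zG by auto
qed

text \<open>Both types agree on the exponent of the centre; in the noncentral one it is attained by
  \<open>x [^] p\<close>.\<close>

lemma type_center_exponent:
  assumes "central_type G p k c \<or> noncentral_type G p k c"
  shows "central_ext G p c" "\<And>z. z \<in> center G \<Longrightarrow> z [^]\<^bsub>G\<^esub> (p ^ Suc k) = \<one>\<^bsub>G\<^esub>"
    "\<exists>z\<in>center G. z [^]\<^bsub>G\<^esub> (p ^ k) = c"
proof -
  show c: "central_ext G p c"
    using assms by (auto simp: central_type_def noncentral_type_def)
  then interpret central_ext G p c .
  show "z [^]\<^bsub>G\<^esub> (p ^ Suc k) = \<one>\<^bsub>G\<^esub>" if "z \<in> center G" for z
    using assms that centerD(1)[OF that] unfolding central_type_def noncentral_type_def by blast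
  show "\<exists>z\<in>center G. z [^]\<^bsub>G\<^esub> (p ^ k) = c"
  proof (cases "central_type G p k c")
    case False
    then obtain x where x: "x \<in> carrier G" "x [^]\<^bsub>G\<^esub> (p ^ Suc k) = c"
      using assms by (auto simp: noncentral_type_def)
    then have "(x [^]\<^bsub>G\<^esub> p) [^]\<^bsub>G\<^esub> (p ^ k) = c"
      by (simp add: nat_pow_pow)
    then show ?thesis
      using pow_p_in_center[OF x(1)] by blast
  qed (auto simp: central_type_def)
qed

text \<open>If \<open>l\<close> were larger, a central element of \<open>H\<close> of order p^(l+1),
  viewed as a central unit, would be killed by p^(k+1), which kills the centre of the unit group of
  \<open>G\<close>.\<close>

lemma type_exponent_le:
  assumes G: "central_type G p k c \<or> noncentral_type G p k c"
    and H: "central_type H p l d \<or> noncentral_type H p l d"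
    and center_pow: "\<And>n::nat. (\<forall>u\<in>center (unit_group p G). u [^]\<^bsub>unit_group p G\<^esub> n = \<one>\<^bsub>unit_group p G\<^esub>)
      \<longleftrightarrow> (\<forall>u\<in>center (unit_group p H). u [^]\<^bsub>unit_group p H\<^esub> n = \<one>\<^bsub>unit_group p H\<^esub>)"
  shows "l \<le> k"
proof (rule ccontr)
  assume "\<not> l \<le> k"
  interpret G: central_ext G p c
    by (rule type_center_exponent(1)[OF G])
  interpret H: central_ext H p d
    by (rule type_center_exponent(1)[OF H])
  have "\<forall>u\<in>center H.V. u [^]\<^bsub>H.V\<^esub> (p ^ Suc k) = \<one>\<^bsub>H.V\<^esub>"
    using G.center_V_exponent type_center_exponent(2)[OF G] center_pow by blast
  moreover obtain z where z: "z \<in> center H" "z [^]\<^bsub>H\<^esub> (p ^ l) = d"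
    using type_center_exponent(3)[OF H] by blast
  moreover have zH: "z \<in> carrier H"
    using z(1) by (rule centerD(1))
  ultimately have "point H (z [^]\<^bsub>H\<^esub> (p ^ Suc k)) = point H \<one>\<^bsub>H\<^esub>"
    using H.point_in_center_V[OF z(1)] H.pow_point[OF zH, of "p ^ Suc k"] by (simp only: H.one_V)
  then have one: "z [^]\<^bsub>H\<^esub> (p ^ Suc k) = \<one>\<^bsub>H\<^esub>"
    using zH by (intro H.point_inj) auto
  have "p ^ l = p ^ Suc k * p ^ (l - Suc k)"
    using \<open>\<not> l \<le> k\<close> by (metis le_add_diff_inverse not_less_eq_eq power_add)
  then have "d = (z [^]\<^bsub>H\<^esub> (p ^ Suc k)) [^]\<^bsub>H\<^esub> (p ^ (l - Suc k))"
    using z(2) zH by (simp only: H.nat_pow_pow)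
  then have "d = \<one>\<^bsub>H\<^esub>"
    unfolding one by simp
  then show False
    using H.c_ne by simp
qed

lemma types_distinguished:
  fixes H :: "('b, 'n) monoid_scheme"
  assumes G: "central_type G p k c" and H: "noncentral_type H p k d"
    and card: "card (carrier G) = card (carrier H)" "card (center G) = card (center H)"
    and card_V: "card (carrier (unit_group p G)) = card (carrier (unit_group p H))"
    and card_pow: "\<And>n::nat. card {u \<in> carrier (unit_group p G). u [^]\<^bsub>unit_group p G\<^esub> n = \<one>\<^bsub>unit_group p G\<^esub>}
      = card {u \<in> carrier (unit_group p H). u [^]\<^bsub>unit_group p H\<^esub> n = \<one>\<^bsub>unit_group p H\<^esub>}"
  shows False
proof -
  interpret G: central_ext G p c
    using G by (simp add: central_type_def)
  interpret H: central_ext H p d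
    using H by (simp add: noncentral_type_def)
  have exp_G: "\<And>g. g \<in> carrier G \<Longrightarrow> g [^]\<^bsub>G\<^esub> (p ^ Suc k) = \<one>\<^bsub>G\<^esub>"
    using G unfolding central_type_def by blast
  obtain x where x: "x \<in> carrier H" "x [^]\<^bsub>H\<^esub> (p ^ Suc k) = d"
    and roots: "\<And>g. g \<in> carrier H \<Longrightarrow> \<exists>j::nat. g [^]\<^bsub>H\<^esub> p = (x [^]\<^bsub>H\<^esub> p) [^]\<^bsub>H\<^esub> j"
    using H unfolding noncentral_type_def by blast
  show False
  proof (cases k)
    \<comment> \<open>Here p^(k+1) is at least p^2, so it kills the units over \<open>G\<close>,
      while the group element \<open>x\<close> of \<open>H\<close> is not killed.\<close>
    case (Suc l)
    have "{u \<in> carrier G.V. u [^]\<^bsub>G.V\<^esub> (p ^ Suc k) = \<one>\<^bsub>G.V\<^esub>} = carrier G.V"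
      using G.V_exponent[of l] exp_G unfolding Suc by blast
    then have "card {u \<in> carrier H.V. u [^]\<^bsub>H.V\<^esub> (p ^ Suc k) = \<one>\<^bsub>H.V\<^esub>} = card (carrier H.V)"
      using card_pow[of "p ^ Suc k"] card_V by simp
    then have "{u \<in> carrier H.V. u [^]\<^bsub>H.V\<^esub> (p ^ Suc k) = \<one>\<^bsub>H.V\<^esub>} = carrier H.V"
      using H.finite_V by (intro card_subset_eq) auto
    then have "point H x [^]\<^bsub>H.V\<^esub> (p ^ Suc k) = \<one>\<^bsub>H.V\<^esub>"
      using H.point_in_V[OF x(1)] by blast
    then have "point H d = point H \<one>\<^bsub>H\<^esub>"
      using x by (simp only: H.pow_point H.one_V)
    then have "d = \<one>\<^bsub>H\<^esub>"
      by (intro H.point_inj) auto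
    then show False
      using H.c_ne by simp
  next
    case 0
    have xp: "x [^]\<^bsub>H\<^esub> p = d"
      using x(2) by (simp add: 0)
    interpret T: twist H p d
      using roots by unfold_locales (simp add: xp)
    interpret P: central_ext_pair G T.K p c d
      by unfold_locales
    \<comment> \<open>Both groups have exponent \<open>p\<close>, so \<open>c\<close> and
      \<open>d\<close> serve as central generators with trivial \<open>p\<close>-th powers.\<close>
    have "G \<cong> T.K"
    proof (rule P.iso_central_generator[of c 0 d])
      show "c \<in> center G" "d \<in> center T.K"
        by (rule G.c_in_center, rule T.K.c_in_center)
      show "c [^]\<^bsub>G\<^esub> (p ^ 0) = c" "d [^]\<^bsub>T.K\<^esub> (p ^ 0) = d"
        by simp_all
      show "\<exists>j::nat. g [^]\<^bsub>G\<^esub> p = (c [^]\<^bsub>G\<^esub> p) [^]\<^bsub>G\<^esub> j" if "g \<in> carrier G" for g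
        using exp_G[OF that] by (intro exI[of _ 0]) (simp add: 0)
      show "\<exists>j::nat. h [^]\<^bsub>T.K\<^esub> p = (d [^]\<^bsub>T.K\<^esub> p) [^]\<^bsub>T.K\<^esub> j" if "h \<in> carrier T.K" for h
        using T.pow_K that by (intro exI[of _ 0]) simp
      show "card (carrier G) = card (carrier T.K)" "card (center G) = card (center T.K)"
        using card by (simp_all add: T.center_K)
    qed
    then have "G.V \<cong> T.K.V"
      by (intro unit_group_iso G.finite_group_prime_axioms T.K.finite_group_prime_axioms)
    then have "card {u \<in> carrier G.V. u [^]\<^bsub>G.V\<^esub> p = \<one>\<^bsub>G.V\<^esub>} = card {u \<in> carrier T.K.V. u [^]\<^bsub>T.K.V\<^esub> p = \<one>\<^bsub>T.K.V\<^esub>}"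
      by (rule iso_monoid_invariants(3)[OF G.monoid_V T.K.monoid_V])
    moreover have "x [^]\<^bsub>H\<^esub> p \<noteq> \<one>\<^bsub>H\<^esub>"
      using H.c_ne xp by simp
    ultimately show False
      using T.card_pow_p_less[OF x(1)] card_pow[of p] by simp
  qed
qed

theorem mainTheorem1:
  fixes p :: nat and G :: "'a monoid" and H :: "'b monoid"
  assumes "Factorial_Ring.prime p" and "p > 2"
    and "p_group p G" and "finite (carrier G)" and "\<not> comm_group G"
    and "p_group p H" and "finite (carrier H)" and "\<not> comm_group H"
    and "cyclic_group (G\<lparr>carrier := frattini G\<rparr>)"
    and "cyclic_group (H\<lparr>carrier := frattini H\<rparr>)"
  shows "normalized_units (residue_ring (int p)) G \<cong> normalized_units (residue_ring (int p)) H
    \<longleftrightarrow> G \<cong> H"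
proof
  have G: "finite_group_prime G p" and H: "finite_group_prime H p"
    using assms by (auto simp: finite_group_prime_def finite_group_prime_axioms_def p_group_def)
  show "unit_group p G \<cong> unit_group p H" if "G \<cong> H"
    using G H that by (rule unit_group_iso)
  assume iso: "unit_group p G \<cong> unit_group p H"
  obtain k c where Gt: "central_type G p k c \<or> noncentral_type G p k c"
    using type_of_cyclic_frattini[OF assms(1,2,3,4,5,9)] by blast
  obtain l d where Ht: "central_type H p l d \<or> noncentral_type H p l d"
    using type_of_cyclic_frattini[OF assms(1,2,6,7,8,10)] by blast
  interpret G: central_ext G p c
    by (rule type_center_exponent(1)[OF Gt])
  interpret H: central_ext H p d
    by (rule type_center_exponent(1)[OF Ht])
  note inv = iso_monoid_invariants[OF G.monoid_V H.monoid_V iso]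
  \<comment> \<open>The order of the unit group yields the group order minus one; positivity is what
    undoes this truncated subtraction.\<close>
  have "card (carrier G) > 0" "card (carrier H) > 0"
    using G.fin H.fin G.one_closed H.one_closed card_gt_0_iff by blast+
  moreover have "card (carrier G) - 1 = card (carrier H) - 1"
    using inv(1) G.card_V H.card_V assms(2) by simp
  ultimately have card: "card (carrier G) = card (carrier H)"
    by linarith
  obtain m where m: "card (center G.V) = p ^ (m - 1)" "m \<ge> 1"
    "p * m = card (carrier G) + (p - 1) * card (center G)"
    by (rule G.card_center_V)
  obtain n where n: "card (center H.V) = p ^ (n - 1)" "n \<ge> 1"
    "p * n = card (carrier H) + (p - 1) * card (center H)"
    by (rule H.card_center_V)
  \<comment> \<open>The order of the centre of the unit group gives the class number, and together
    with the group order this determines the order of the centre.\<close>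
  have "m - 1 = n - 1"
    using inv(2) m(1) n(1) assms(2) by simp
  then have "m = n"
    using m(2) n(2) by linarith
  then have "(p - 1) * card (center G) = (p - 1) * card (center H)"
    using m(3) n(3) card unfolding \<open>m = n\<close> by linarith
  then have card_Z: "card (center G) = card (center H)"
    using assms(2) by simp
  have "k = l"
    using type_exponent_le[OF Gt Ht inv(4)] type_exponent_le[OF Ht Gt inv(4)[symmetric]] by simp
  interpret P: central_ext_pair G H p c d
    by unfold_locales
  consider "central_type G p k c" "central_type H p k d" | "noncentral_type G p k c" "noncentral_type H p k d"
    | "central_type G p k c" "noncentral_type H p k d" | "noncentral_type G p k c" "central_type H p k d"
    using Gt Ht \<open>k = l\<close> by blast
  then show "G \<cong> H"
  proof cases
    case 1
    then obtain z z' where "z \<in> center G" "z [^]\<^bsub>G\<^esub> (p ^ k) = c"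
      "\<And>g. g \<in> carrier G \<Longrightarrow> \<exists>j::nat. g [^]\<^bsub>G\<^esub> p = (z [^]\<^bsub>G\<^esub> p) [^]\<^bsub>G\<^esub> j"
      "z' \<in> center H" "z' [^]\<^bsub>H\<^esub> (p ^ k) = d"
      "\<And>h. h \<in> carrier H \<Longrightarrow> \<exists>j::nat. h [^]\<^bsub>H\<^esub> p = (z' [^]\<^bsub>H\<^esub> p) [^]\<^bsub>H\<^esub> j"
      unfolding central_type_def by blast
    then show ?thesis
      using card card_Z by (rule P.iso_central_generator)
  next
    case 2
    then obtain x x' where x: "x \<in> carrier G" "x [^]\<^bsub>G\<^esub> (p ^ Suc k) = c"
      "\<And>g. g \<in> carrier G \<Longrightarrow> \<exists>j::nat. g [^]\<^bsub>G\<^esub> p = (x [^]\<^bsub>G\<^esub> p) [^]\<^bsub>G\<^esub> j"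
      and x': "x' \<in> carrier H" "x' [^]\<^bsub>H\<^esub> (p ^ Suc k) = d"
      "\<And>h. h \<in> carrier H \<Longrightarrow> \<exists>j::nat. h [^]\<^bsub>H\<^esub> p = (x' [^]\<^bsub>H\<^esub> p) [^]\<^bsub>H\<^esub> j"
      unfolding noncentral_type_def by blast
    have Ht': "central_type H p k d \<or> noncentral_type H p k d"
      using 2 by simp
    show ?thesis
      by (rule P.iso_noncentral_generator[OF x type_center_exponent(2)[OF Gt] x'
          type_center_exponent(2)[OF Ht'] card card_Z])
  next
    case 3
    then show ?thesis
      using types_distinguished[OF _ _ card card_Z inv(1,3)] by blast
  next
    case 4
    then show ?thesis
      using types_distinguished[OF _ _ card[symmetric] card_Z[symmetric] inv(1)[symmetric] inv(3)[symmetric]] by blast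
  qed
qed

end
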